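(* Let $T$ be a weakly positive current of bidimension $(p,p)$ on $\mathbb{R}^n\times\mathbb{R}^n$ and let $\varphi$ be a positive function of class $\mathscr{C}^2$ on $\mathbb{R}^n$. Put $\omega=dd^{\#}\varphi$ and $B(r)=\{x\in\mathbb{R}^n:\varphi(x)<r\}$, and assume that $\varphi^{1/2}$ is convex and that $T\wedge\omega^{p-1}$ is concave. If the function $$r\longmapsto\frac{\nu_{dd^{\#}T}(\varphi,r)}{2r^{1/2}},\qquad \nu_{dd^{\#}T}(\varphi,r)=\frac{1}{2^{p-1}r^{(p-1)/2}}\int_{B(r)\times\mathbb{R}^n}dd^{\#}T\wedge\omega^{p-1},$$ is integrable in a neighborhood of $0$, then the Lelong number of $T$ relative to the weight $\varphi$, $$\nu_T(\varphi)=\lim_{r\to0}\frac{1}{2^pr^{p/2}}\int_{B(r)\times\mathbb{R}^n}T\wedge\omega^p,$$ exists.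
   Context: Superformalism. On $\mathbb{R}^n\times\mathbb{R}^n$ with coordinates $(x,\xi)$, a form of bidegree $(p,q)$ is $\sum_{|K|=p,|L|=q}\alpha_{KL}(x)\,dx_K\wedge d\xi_L$ with coefficients depending only on $x$ (smooth unless otherwise said); $dx_i,d\xi_j$ all anticommute. $d=\sum_i dx_i\wedge\partial_{x_i}$ and $d^{\#}=\sum_j d\xi_j\wedge\partial_{x_j}$; for a function $u$, $dd^{\#}u=\sum_{i,j}\frac{\partial^2u}{\partial x_i\partial x_j}dx_i\wedge d\xi_j$. For $\alpha=\sum_i a_i\,dx_i$ put $J(\alpha)=\sum_i a_i\,d\xi_i$. The integral of $\alpha_0(x)\,dx_1\wedge d\xi_1\wedge\dots\wedge dx_n\wedge d\xi_n$ over $A\times\mathbb{R}^n$ is $\int_A\alpha_0\,dx$ (similarly for measures). Currents. A current of bidegree $(p,q)$ is $T=\sum_{|I|=p,|J|=q}T_{IJ}\,dx_I\wedge d\xi_J$ with $T_{IJ}$ distributions in $x$; it acts on forms of bidegree $(n-p,n-q)$ with compactly supported coefficients by $\langle T,\alpha\rangle=\int T\wedge\alpha$. Bidimension $(p,p)$ means bidegree $(n-p,n-p)$. A current of bidegree $(k,k)$ is symmetric if $T_{IJ}=T_{JI}$. A form of bidegree $(k,k)$ is strongly positive if it is a finite sum $\sum_s\lambda_s\alpha_{1,s}\wedge J(\alpha_{1,s})\wedge\dots\wedge\alpha_{k,s}\wedge J(\alpha_{k,s})$, $\lambda_s\ge0$, $\alpha_{i,s}$ of bidegree $(1,0)$.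 A symmetric current of bidimension $(p,p)$ is weakly positive if it is $\ge0$ on all compactly supported strongly positive forms of bidegree $(p,p)$; its coefficients are then measures. A current $S$ is convex if $dd^{\#}S$ is weakly positive, and concave if $-S$ is convex. Here $dd^{\#}T\wedge\omega^{p-1}=dd^{\#}(T\wedge\omega^{p-1})$. "Positive" for functions means $\ge0$.
   Formalization: The formal theorem additionally assumes that the intersection of the support of T with B(r0) is bounded for some r0 > 0 (φ semi-exhaustive on Supp T); without this, mass can escape to infinity and the limit can fail to exist even when dd^#T = 0. *)

theory Defs
  imports "HOL-Analysis.Analysis"
begin

section \<open>Smooth functions, test functions, distributions\<close>

definition partial :: "'n::finite \<Rightarrow> (real^'n \<Rightarrow> real) \<Rightarrow> real^'n \<Rightarrow> real" where
  "partial i f = (\<lambda>x. frechet_derivative f (at x) (axis i 1))"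

primrec C_k :: "nat \<Rightarrow> (real^'n::finite \<Rightarrow> real) \<Rightarrow> bool" where
  "C_k 0 f \<longleftrightarrow> continuous_on UNIV f"
| "C_k (Suc k) f \<longleftrightarrow> (\<forall>x. f differentiable (at x)) \<and> (\<forall>i. C_k k (partial i f))"

definition smooth :: "(real^'n::finite \<Rightarrow> real) \<Rightarrow> bool" where
  "smooth f \<longleftrightarrow> (\<forall>k. C_k k f)"

definition test_fun :: "(real^'n::finite \<Rightarrow> real) \<Rightarrow> bool" where
  "test_fun f \<longleftrightarrow> smooth f \<and> bounded {x. f x \<noteq> 0}"

primrec iter_partial :: "'n::finite list \<Rightarrow> (real^'n \<Rightarrow> real) \<Rightarrow> real^'n \<Rightarrow> real" where
  "iter_partial [] f = f"
| "iter_partial (i # is) f = partial i (iter_partial is f)"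

text \<open>A functional is only ever evaluated at test functions; its values elsewhere are
  irrelevant. Continuity is the usual estimate by finitely many derivatives on each compact set.\<close>

definition distribution :: "((real^'n::finite \<Rightarrow> real) \<Rightarrow> real) \<Rightarrow> bool" where
  "distribution u \<longleftrightarrow>
     (\<forall>f g. test_fun f \<longrightarrow> test_fun g \<longrightarrow> u (\<lambda>x. f x + g x) = u f + u g) \<and>
     (\<forall>c f. test_fun f \<longrightarrow> u (\<lambda>x. c * f x) = c * u f) \<and>
     (\<forall>C. compact C \<longrightarrow>
        (\<exists>k c. \<forall>f b. test_fun f \<longrightarrow> {x. f x \<noteq> 0} \<subseteq> C \<longrightarrow>
           (\<forall>is x. length is \<le> k \<longrightarrow> \<bar>iter_partial is f x\<bar> \<le> b) \<longrightarrow> \<bar>u f\<bar> \<le> c * b))"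

definition dist_partial ::
    "'n::finite \<Rightarrow> ((real^'n \<Rightarrow> real) \<Rightarrow> real) \<Rightarrow> (real^'n \<Rightarrow> real) \<Rightarrow> real" where
  "dist_partial i u = (\<lambda>f. - u (partial i f))"


section \<open>Superforms and supercurrents\<close>

text \<open>The family \<open>\<alpha>\<close> stands for \<open>\<Sum>K L. \<alpha> K L dx_K \<and> d\<xi>_L\<close>, where \<open>dx_K\<close> and \<open>d\<xi>_L\<close> are
  ordered increasingly with respect to the linear order on the index type. The coefficients
  are functions on \<open>real^'n\<close> (forms) or functionals on test functions (currents).\<close>

type_synonym ('n, 't) super = "'n set \<Rightarrow> 'n set \<Rightarrow> 't \<Rightarrow> real"
type_synonym 'n form = "('n, real^'n) super"
type_synonym 'n current = "('n, real^'n \<Rightarrow> real) super"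

text \<open>\<open>dx_A \<and> dx_B = shuffle_sign A B dx_(A \<union> B)\<close> for disjoint \<open>A\<close> and \<open>B\<close>.\<close>

definition shuffle_sign :: "'n::linorder set \<Rightarrow> 'n set \<Rightarrow> real" where
  "shuffle_sign A B = (-1) ^ card {(a, b). a \<in> A \<and> b \<in> B \<and> b < a}"

text \<open>\<open>(dx_A \<and> d\<xi>_B) \<and> (dx_A' \<and> d\<xi>_B') = super_sign A B A' B' dx_(A \<union> A') \<and> d\<xi>_(B \<union> B')\<close>:
  the factor \<open>(-1) ^ (card B * card A')\<close> comes from moving \<open>dx_A'\<close> past \<open>d\<xi>_B\<close>.\<close>

definition super_sign :: "'n::linorder set \<Rightarrow> 'n set \<Rightarrow> 'n set \<Rightarrow> 'n set \<Rightarrow> real" where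
  "super_sign A B A' B' = (-1) ^ (card B * card A') * shuffle_sign A A' * shuffle_sign B B'"

text \<open>\<open>dx_1 \<and> d\<xi>_1 \<and> \<dots> \<and> dx_n \<and> d\<xi>_n = vol_sign dx_UNIV \<and> d\<xi>_UNIV\<close>; the former is the
  form of integral \<open>1\<close> per unit volume.\<close>

definition vol_sign :: "'n::finite itself \<Rightarrow> real" where
  "vol_sign _ = (-1) ^ (CARD('n) * (CARD('n) - 1) div 2)"

text \<open>The operators \<open>d\<close> and \<open>d\<^sup>#\<close>, where \<open>D i\<close> is the i-th partial derivative on the
  coefficients: \<open>partial\<close> for forms, \<open>dist_partial\<close> for currents.\<close>

definition ext_d :: "('n \<Rightarrow> ('t \<Rightarrow> real) \<Rightarrow> 't \<Rightarrow> real) \<Rightarrow>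
    ('n::{finite,linorder}, 't) super \<Rightarrow> ('n, 't) super" where
  "ext_d D \<alpha> K L = (\<lambda>t. \<Sum>i\<in>K. shuffle_sign {i} (K - {i}) * D i (\<alpha> (K - {i}) L) t)"

definition ext_d_sharp :: "('n \<Rightarrow> ('t \<Rightarrow> real) \<Rightarrow> 't \<Rightarrow> real) \<Rightarrow>
    ('n::{finite,linorder}, 't) super \<Rightarrow> ('n, 't) super" where
  "ext_d_sharp D \<alpha> K L =
     (\<lambda>t. (-1) ^ card K * (\<Sum>j\<in>L. shuffle_sign {j} (L - {j}) * D j (\<alpha> K (L - {j})) t))"

definition bidegree_form :: "nat \<Rightarrow> nat \<Rightarrow> 'n::finite form \<Rightarrow> bool" where
  "bidegree_form a b \<alpha> \<longleftrightarrow> (\<forall>K L. \<not> (card K = a \<and> card L = b) \<longrightarrow> \<alpha> K L = (\<lambda>_. 0))"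

definition smooth_form :: "'n::finite form \<Rightarrow> bool" where
  "smooth_form \<alpha> \<longleftrightarrow> (\<forall>K L. smooth (\<alpha> K L))"

definition test_form :: "'n::finite form \<Rightarrow> bool" where
  "test_form \<alpha> \<longleftrightarrow> (\<forall>K L. test_fun (\<alpha> K L))"

definition symmetric_form :: "'n form \<Rightarrow> bool" where
  "symmetric_form \<alpha> \<longleftrightarrow> (\<forall>K L. \<alpha> K L = \<alpha> L K)"

definition zero_form :: "(real^'n \<Rightarrow> real) \<Rightarrow> 'n form" where
  "zero_form f K L = (if K = {} \<and> L = {} then f else (\<lambda>_. 0))"

definition wedge :: "'n::{finite,linorder} form \<Rightarrow> 'n form \<Rightarrow> 'n form" where
  "wedge \<alpha> \<beta> K L =
     (\<lambda>x. \<Sum>A\<in>Pow K. \<Sum>B\<in>Pow L.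
        super_sign A B (K - A) (L - B) * \<alpha> A B x * \<beta> (K - A) (L - B) x)"

primrec wedge_pow :: "'n::{finite,linorder} form \<Rightarrow> nat \<Rightarrow> 'n form" where
  "wedge_pow \<omega> 0 = zero_form (\<lambda>_. 1)"
| "wedge_pow \<omega> (Suc q) = wedge \<omega> (wedge_pow \<omega> q)"

text \<open>Intended for \<open>\<alpha>\<close> of bidegree (1,0).\<close>

definition J_form :: "'n form \<Rightarrow> 'n form" where
  "J_form \<alpha> K L = (if K = {} then \<alpha> L {} else (\<lambda>_. 0))"

primrec J_product :: "(nat \<Rightarrow> 'n::{finite,linorder} form) \<Rightarrow> nat \<Rightarrow> 'n form" where
  "J_product a 0 = zero_form (\<lambda>_. 1)"
| "J_product a (Suc k) = wedge (J_product a k) (wedge (a k) (J_form (a k)))"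

text \<open>The weights \<open>lam s\<close> are nonnegative functions, so that for \<open>k = 0\<close> one obtains the
  nonnegative functions.\<close>

definition strongly_positive_form :: "nat \<Rightarrow> 'n::{finite,linorder} form \<Rightarrow> bool" where
  "strongly_positive_form k \<alpha> \<longleftrightarrow>
     (\<exists>(m::nat) lam a.
        (\<forall>s<m. smooth (lam s) \<and> (\<forall>x. 0 \<le> lam s x) \<and>
               (\<forall>i<k. smooth_form (a s i) \<and> bidegree_form 1 0 (a s i))) \<and>
        \<alpha> = (\<lambda>K L x. \<Sum>s<m. lam s x * J_product (a s) k K L x))"

definition is_current :: "nat \<Rightarrow> nat \<Rightarrow> 'n::finite current \<Rightarrow> bool" where
  "is_current a b T \<longleftrightarrow>
     (\<forall>K L. distribution (T K L)) \<and>
     (\<forall>K L f. \<not> (card K = a \<and> card L = b) \<longrightarrow> test_fun f \<longrightarrow> T K L f = 0)"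

definition symmetric_current :: "'n::finite current \<Rightarrow> bool" where
  "symmetric_current T \<longleftrightarrow> (\<forall>K L f. test_fun f \<longrightarrow> T K L f = T L K f)"

definition neg_current :: "'n current \<Rightarrow> 'n current" where
  "neg_current T K L f = - T K L f"

definition current_wedge :: "'n::{finite,linorder} current \<Rightarrow> 'n form \<Rightarrow> 'n current" where
  "current_wedge T \<alpha> K L =
     (\<lambda>f. \<Sum>A\<in>Pow K. \<Sum>B\<in>Pow L.
        super_sign A B (K - A) (L - B) * T A B (\<lambda>x. \<alpha> (K - A) (L - B) x * f x))"

definition pairing :: "'n::{finite,linorder} current \<Rightarrow> 'n form \<Rightarrow> real" where
  "pairing T \<alpha> = vol_sign TYPE('n) *
     (\<Sum>A\<in>UNIV. \<Sum>B\<in>UNIV. super_sign A B (- A) (- B) * T A B (\<alpha> (- A) (- B)))"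

definition current_support :: "'n::finite current \<Rightarrow> (real^'n) set" where
  "current_support T =
     - \<Union>{U. open U \<and> (\<forall>K L f. test_fun f \<longrightarrow> closure {x. f x \<noteq> 0} \<subseteq> U \<longrightarrow> T K L f = 0)}"


section \<open>Positivity and convexity\<close>

abbreviation dd_sharp_form :: "'n::{finite,linorder} form \<Rightarrow> 'n form" where
  "dd_sharp_form \<alpha> \<equiv> ext_d partial (ext_d_sharp partial \<alpha>)"

abbreviation dd_sharp :: "'n::{finite,linorder} current \<Rightarrow> 'n current" where
  "dd_sharp T \<equiv> ext_d dist_partial (ext_d_sharp dist_partial T)"

text \<open>In the following definitions \<open>p\<close> is such that the current has bidimension \<open>(p, p)\<close>.\<close>

definition weakly_positive :: "nat \<Rightarrow> 'n::{finite,linorder} current \<Rightarrow> bool" where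
  "weakly_positive p T \<longleftrightarrow>
     p \<le> CARD('n) \<and> is_current (CARD('n) - p) (CARD('n) - p) T \<and> symmetric_current T \<and>
     (\<forall>\<alpha>. test_form \<alpha> \<longrightarrow> strongly_positive_form p \<alpha> \<longrightarrow> 0 \<le> pairing T \<alpha>)"

definition convex_current :: "nat \<Rightarrow> 'n::{finite,linorder} current \<Rightarrow> bool" where
  "convex_current p S \<longleftrightarrow> weakly_positive (p - 1) (dd_sharp S)"

definition concave_current :: "nat \<Rightarrow> 'n::{finite,linorder} current \<Rightarrow> bool" where
  "concave_current p S \<longleftrightarrow> convex_current p (neg_current S)"


section \<open>Products with continuous forms\<close>

text \<open>\<open>T \<and> \<omega>^q\<close> for a weakly positive current \<open>T\<close> and a merely continuous symmetric (1,1)-form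
  \<open>\<omega>\<close>, by continuity: the common limit of \<open>T \<and> \<omega>' k ^ q\<close> along all sequences of smooth
  symmetric (1,1)-forms \<open>\<omega>' k\<close> converging locally uniformly to \<open>\<omega>\<close>. If the coefficients of \<open>T\<close>
  are measures this is the product of these measures with the continuous coefficients of
  \<open>\<omega>^q\<close>. For \<open>T\<close> of bidimension \<open>(p, p)\<close> and \<open>q \<in> {p - 1, p}\<close> it only involves the pairing of
  \<open>T\<close> with linear combinations of strongly positive forms, on which \<open>T\<close> has order 0. This
  matters because strongly positive forms do not span all symmetric forms if \<open>2 \<le> p \<le> n - 2\<close>.\<close>

definition current_wedge_pow ::
    "'n::{finite,linorder} current \<Rightarrow> 'n form \<Rightarrow> nat \<Rightarrow> 'n current" where
  "current_wedge_pow T \<omega> q K L f =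
     (THE l. \<forall>\<omega>' :: nat \<Rightarrow> 'n form.
        (\<forall>k. smooth_form (\<omega>' k) \<and> bidegree_form 1 1 (\<omega>' k) \<and> symmetric_form (\<omega>' k)) \<longrightarrow>
        (\<forall>A B C. compact C \<longrightarrow> uniform_limit C (\<lambda>k. \<omega>' k A B) (\<omega> A B) sequentially) \<longrightarrow>
        (\<lambda>k. current_wedge T (wedge_pow (\<omega>' k) q) K L f) \<longlonglongrightarrow> l)"


section \<open>Integration of currents of bidegree (n,n)\<close>

definition radon_measure :: "(real^'n::finite) measure \<Rightarrow> bool" where
  "radon_measure M \<longleftrightarrow> sets M = sets borel \<and> (\<forall>C. compact C \<longrightarrow> emeasure M C < \<infinity>)"

text \<open>The integral over \<open>A \<times> real^'n\<close> of a current \<open>U\<close> of bidegree (n,n) whose coefficient is a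
  signed measure \<open>M - N\<close> with \<open>M A\<close> and \<open>N A\<close> finite.\<close>

definition current_integral ::
    "(real^'n::{finite,linorder}) set \<Rightarrow> 'n current \<Rightarrow> real" where
  "current_integral A U =
     (THE v. \<exists>M N. radon_measure M \<and> radon_measure N \<and>
        (\<forall>f. test_fun f \<longrightarrow> pairing U (zero_form f) = (\<integral>x. f x \<partial>M) - (\<integral>x. f x \<partial>N)) \<and>
        emeasure M A < \<infinity> \<and> emeasure N A < \<infinity> \<and> v = measure M A - measure N A)"


section \<open>Lelong numbers\<close>

definition sublevel :: "(real^'n \<Rightarrow> real) \<Rightarrow> real \<Rightarrow> (real^'n) set" where
  "sublevel \<phi> r = {x. \<phi> x < r}"

definition omega :: "(real^'n::{finite,linorder} \<Rightarrow> real) \<Rightarrow> 'n form" where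
  "omega \<phi> = dd_sharp_form (zero_form \<phi>)"

lemma omega_apply: "omega \<phi> {i} {j} = partial i (partial j \<phi>)"
  by (simp add: omega_def ext_d_def ext_d_sharp_def zero_form_def shuffle_sign_def)

definition lelong_ratio ::
    "'n current \<Rightarrow> nat \<Rightarrow> (real^'n::{finite,linorder} \<Rightarrow> real) \<Rightarrow> real \<Rightarrow> real" where
  "lelong_ratio T p \<phi> r =
     1 / (2 ^ p * r powr (real p / 2)) *
     current_integral (sublevel \<phi> r) (current_wedge_pow T (omega \<phi>) p)"

text \<open>The function \<open>\<nu>\<close> of \<open>dd\<^sup># T\<close>, for \<open>T\<close> of bidimension \<open>(p, p)\<close> with \<open>p \<ge> 1\<close>, where
  \<open>dd\<^sup># T \<and> \<omega>^(p - 1)\<close> is read as \<open>dd\<^sup># (T \<and> \<omega>^(p - 1))\<close>.\<close>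

definition lelong_ratio_dd_sharp ::
    "'n current \<Rightarrow> nat \<Rightarrow> (real^'n::{finite,linorder} \<Rightarrow> real) \<Rightarrow> real \<Rightarrow> real" where
  "lelong_ratio_dd_sharp T p \<phi> r =
     1 / (2 ^ (p - 1) * r powr (real (p - 1) / 2)) *
     current_integral (sublevel \<phi> r) (dd_sharp (current_wedge_pow T (omega \<phi>) (p - 1)))"

text \<open>With \<open>X\<close> the support of \<open>T\<close>, the integrals over small sublevel sets only involve a
  relatively compact part of \<open>T\<close>. Otherwise mass may escape to infinity, and the limit defining
  the Lelong number need not exist even if \<open>dd\<^sup># T = 0\<close> and all the integrals are finite.\<close>

definition semi_exhaustive_on ::
    "(real^'n::finite) set \<Rightarrow> (real^'n \<Rightarrow> real) \<Rightarrow> bool" where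
  "semi_exhaustive_on X \<phi> \<longleftrightarrow> (\<exists>r0>0. bounded (X \<inter> sublevel \<phi> r0))"

end

theory Submission
  imports Defs
begin

text \<open>Write \<open>c = p / 2\<close>, and let \<open>\<mu>\<close> and \<open>\<rho>\<close> be the measures \<open>T \<and> \<omega>^p\<close> and
  \<open>- dd\<^sup># (T \<and> \<omega>^(p - 1))\<close>. Convexity of the square root of \<open>\<phi>\<close> means that
  \<open>2 \<phi> \<omega> - d\<phi> \<and> d\<^sup>#\<phi>\<close> is a positive form, and its p-th power gives
  \<open>T \<and> \<omega>^(p - 1) \<and> d\<phi> \<and> d\<^sup>#\<phi> \<le> (\<phi> / c) \<mu>\<close>. Inserted in the pairing of
  \<open>dd\<^sup># (T \<and> \<omega>^(p - 1))\<close> with a decreasing convex function of \<open>\<phi>\<close> whose derivative at \<open>t\<close>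
  between \<open>a\<close> and \<open>b\<close> is \<open>b powr - c - t powr - c\<close>, this bound yields
  \<open>a powr - c * \<mu> (B a) \<le> b powr - c * \<mu> (B b) + E b\<close> for \<open>a < b\<close>, where \<open>E b\<close> is the integral of
  \<open>s powr - c * \<rho> (B s)\<close> over \<open>{0<..<b}\<close>. Integrability of \<open>\<nu>\<close> makes \<open>E b\<close> tend to 0, so the
  nonnegative ratios have equal lower and upper limits at 0.\<close>

section \<open>Smooth functions\<close>

text \<open>Three obstacles shape the proof. A weakly positive current is controlled only on
  strongly positive forms, which need not span the symmetric ones; hence all products with powers of
  \<omega> and with rank one matrices are shown to stay in their span. Next, \<phi> is only of class
  C^2: \<omega> is merely continuous and a function of \<phi> is not a test function, so the
  pairings pass through mollification. Last, sublevel sets may be unbounded; only their part in the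
  support of \<open>T\<close> is bounded, whence the cutoffs. The constant 1 / c = 2 / p arises
  because \<open>d\<phi> \<and> d\<^sup>#\<phi>\<close> squares to zero: the p-th power of
  \<open>2 \<phi> \<omega> - d\<phi> \<and> d\<^sup>#\<phi>\<close> is linear in it, with
  coefficient p. The profile g, with g' = - h, is designed so that g - t h / c is, up to smoothing,
  a difference of weighted indicators of two sublevel sets; the pairing therefore compares the two
  ratios. The integrand \<open>s powr - c * \<rho> (B s)\<close> of the error is - 2^p times the
  function whose integrability is assumed.\<close>

lemma partial_eqI: "(f has_derivative f') (at x) \<Longrightarrow> partial i f x = f' (axis i 1)"
  by (simp add: partial_def frechet_derivative_at[symmetric])

lemma has_derivative_partial:
  fixes f :: "real^'n::finite \<Rightarrow> real"
  assumes "f differentiable (at x)"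
  shows "(f has_derivative (\<lambda>v. \<Sum>i\<in>UNIV. v $ i * partial i f x)) (at x)"
proof -
  from assms obtain f' where f': "(f has_derivative f') (at x)"
    by (auto simp: differentiable_def)
  then have lin: "linear f'" by (rule has_derivative_linear)
  have "f' v = (\<Sum>i\<in>UNIV. v $ i * partial i f x)" for v
  proof -
    have "f' v = f' (\<Sum>i\<in>UNIV. v $ i *\<^sub>R axis i 1)"
      using basis_expansion[of v] by (simp add: scalar_mult_eq_scaleR)
    also have "\<dots> = (\<Sum>i\<in>UNIV. v $ i * partial i f x)"
      by (simp add: linear_sum[OF lin] linear_cmul[OF lin] partial_eqI[OF f'])
    finally show ?thesis .
  qed
  then show ?thesis using f' by (metis (no_types, lifting) ext)
qed

lemma partial_const [simp]: "partial i (\<lambda>_. c) = (\<lambda>_. 0)"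
  by (rule ext, rule partial_eqI[where f' = "\<lambda>_. 0", simplified]) simp

lemma partial_coord: "partial i (\<lambda>x. x $ j) = (\<lambda>_. if i = j then 1 else 0)"
  by (rule ext, subst partial_eqI[where f' = "\<lambda>x. x $ j"])
     (auto intro!: bounded_linear_imp_has_derivative bounded_linear_vec_nth simp: axis_def)

lemma partial_add:
  assumes "\<And>x. f differentiable (at x)" "\<And>x. g differentiable (at x)"
  shows "partial i (\<lambda>x. f x + g x) = (\<lambda>x. partial i f x + partial i g x)"
proof
  fix x
  obtain f' g' where "(f has_derivative f') (at x)" "(g has_derivative g') (at x)"
    using assms by (auto simp: differentiable_def) metis
  from partial_eqI[OF has_derivative_add[OF this]] this
  show "partial i (\<lambda>x. f x + g x) x = partial i f x + partial i g x"
    by (simp add: partial_eqI)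
qed

lemma partial_mult:
  assumes "\<And>x. f differentiable (at x)" "\<And>x. g differentiable (at x)"
  shows "partial i (\<lambda>x. f x * g x) = (\<lambda>x. f x * partial i g x + partial i f x * g x)"
proof
  fix x
  obtain f' g' where "(f has_derivative f') (at x)" "(g has_derivative g') (at x)"
    using assms by (auto simp: differentiable_def) metis
  from partial_eqI[OF has_derivative_mult[OF this]] this
  show "partial i (\<lambda>x. f x * g x) x = f x * partial i g x + partial i f x * g x"
    by (simp add: partial_eqI)
qed

lemma partial_compose:
  assumes "\<And>x. f differentiable (at x)" "\<And>t. (h has_real_derivative h' t) (at t)"
  shows "partial i (\<lambda>x. h (f x)) = (\<lambda>x. h' (f x) * partial i f x)"
proof
  fix x
  obtain f' where f': "(f has_derivative f') (at x)"
    using assms(1) unfolding differentiable_def by blast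
  have "((\<lambda>x. h (f x)) has_derivative (\<lambda>v. h' (f x) * f' v)) (at x)"
    using has_derivative_compose[OF f', of h "\<lambda>v. h' (f x) * v"] assms(2)[of "f x"]
    by (simp add: has_field_derivative_def)
  from partial_eqI[OF this] show "partial i (\<lambda>x. h (f x)) x = h' (f x) * partial i f x"
    using partial_eqI[OF f'] by simp
qed

lemma C_k_continuous: "C_k k f \<Longrightarrow> continuous_on UNIV f"
  by (cases k) (auto intro!: continuous_at_imp_continuous_on differentiable_imp_continuous_within)

lemma C_k_Suc: "C_k (Suc k) f \<Longrightarrow> C_k k f"
proof (induction k arbitrary: f)
  case 0 then show ?case using C_k_continuous by fastforce
next
  case (Suc k) then show ?case by auto
qed

lemma C_k_const: "C_k k (\<lambda>_. c)"
  by (induction k arbitrary: c) auto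

lemma C_k_coord: "C_k k (\<lambda>x. x $ j)"
  by (cases k) (auto simp: partial_coord C_k_const intro!: continuous_intros
     bounded_linear_imp_differentiable bounded_linear_vec_nth)

lemma C_k_add: "C_k k f \<Longrightarrow> C_k k g \<Longrightarrow> C_k k (\<lambda>x. f x + g x)"
proof (induction k arbitrary: f g)
  case 0 then show ?case by (auto intro: continuous_intros)
next
  case (Suc k) then show ?case by (simp add: partial_add)
qed

lemma C_k_mult: "C_k k f \<Longrightarrow> C_k k g \<Longrightarrow> C_k k (\<lambda>x. f x * g x)"
proof (induction k arbitrary: f g)
  case 0 then show ?case by (auto intro: continuous_intros)
next
  case (Suc k)
  then have "C_k k f" "C_k k g" using C_k_Suc by blast+
  with Suc show ?case by (simp add: partial_mult C_k_add)
qed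

lemma C_k_sum: "(\<And>s. s \<in> I \<Longrightarrow> C_k k (f s)) \<Longrightarrow> C_k k (\<lambda>x. \<Sum>s\<in>I. f s x)"
  by (induction I rule: infinite_finite_induct) (auto simp: C_k_const C_k_add)

text \<open>\<open>H\<close> lists the successive derivatives of the outer function. Carrying the
  whole tower lets the induction apply its hypothesis to \<open>\<lambda>m. H (Suc m)\<close>, and
  only continuity is asked of the last member.\<close>

lemma C_k_compose:
  assumes "\<And>m t. m < k \<Longrightarrow> (H m has_real_derivative H (Suc m) t) (at t)"
    and "continuous_on UNIV (H k)" and "C_k k f"
  shows "C_k k (\<lambda>x. H 0 (f x))"
  using assms
proof (induction k arbitrary: H)
  case 0
  then show ?case by (auto intro: continuous_on_compose2)
next
  case (Suc k)
  have d: "f differentiable (at x)" for x using Suc.prems by simp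
  have "C_k k (\<lambda>x. H (Suc 0) (f x))"
    using Suc.IH[of "\<lambda>m. H (Suc m)"] Suc.prems C_k_Suc[OF Suc.prems(3)] by simp
  moreover have "(\<lambda>x. H 0 (f x)) differentiable (at x)" for x
    using differentiable_chain_at[OF d, of "H 0"] Suc.prems(1)[of 0]
    by (auto simp: o_def has_field_derivative_def differentiable_def)
  moreover have "partial i (\<lambda>x. H 0 (f x)) = (\<lambda>x. H (Suc 0) (f x) * partial i f x)" for i
    by (rule partial_compose[OF d]) (use Suc.prems(1)[of 0] in simp)
  ultimately show ?case using Suc.prems by (simp add: C_k_mult)
qed

lemma smooth_const: "smooth (\<lambda>_. c)" by (simp add: smooth_def C_k_const)
lemma smooth_coord: "smooth (\<lambda>x. x $ j)" by (simp add: smooth_def C_k_coord)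
lemma smooth_add: "smooth f \<Longrightarrow> smooth g \<Longrightarrow> smooth (\<lambda>x. f x + g x)"
  by (simp add: smooth_def C_k_add)
lemma smooth_mult: "smooth f \<Longrightarrow> smooth g \<Longrightarrow> smooth (\<lambda>x. f x * g x)"
  by (simp add: smooth_def C_k_mult)
lemma smooth_sum: "(\<And>s. s \<in> I \<Longrightarrow> smooth (f s)) \<Longrightarrow> smooth (\<lambda>x. \<Sum>s\<in>I. f s x)"
  by (simp add: smooth_def C_k_sum)
lemma smooth_continuous: "smooth f \<Longrightarrow> continuous_on UNIV f"
  unfolding smooth_def using C_k_continuous by blast
lemma smooth_partial: "smooth f \<Longrightarrow> smooth (partial i f)"
  unfolding smooth_def by (metis C_k.simps(2))

lemma test_fun_smooth: "test_fun f \<Longrightarrow> smooth f" by (simp add: test_fun_def)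

lemma test_fun_zero: "test_fun (\<lambda>_. 0)" by (simp add: test_fun_def smooth_const)

lemma test_fun_add: "test_fun f \<Longrightarrow> test_fun g \<Longrightarrow> test_fun (\<lambda>x. f x + g x)"
  unfolding test_fun_def
  by (auto simp: smooth_add intro: bounded_subset[of "{x. f x \<noteq> 0} \<union> {x. g x \<noteq> 0}"])

lemma test_fun_mult: "smooth f \<Longrightarrow> test_fun g \<Longrightarrow> test_fun (\<lambda>x. f x * g x)"
  unfolding test_fun_def
  by (auto simp: smooth_mult intro: bounded_subset[of "{x. g x \<noteq> 0}"])

lemma test_fun_mult': "smooth f \<Longrightarrow> test_fun g \<Longrightarrow> test_fun (\<lambda>x. g x * f x)"
  using test_fun_mult[of f g] by (simp add: mult.commute)

lemma test_fun_sum: "(\<And>s. s \<in> I \<Longrightarrow> test_fun (f s)) \<Longrightarrow> test_fun (\<lambda>x. \<Sum>s\<in>I. f s x)"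
  by (induction I rule: infinite_finite_induct) (auto simp: test_fun_zero test_fun_add)

lemma test_fun_partial:
  assumes "test_fun f" shows "test_fun (partial i f)"
proof -
  have "partial i f x = 0" if "x \<notin> closure {x. f x \<noteq> 0}" for x
  proof -
    let ?U = "- closure {x. f x \<noteq> 0}"
    have "((\<lambda>_. 0) has_derivative (\<lambda>_. 0)) (at x)" by simp
    then have "(f has_derivative (\<lambda>_. 0)) (at x)"
    proof (rule has_derivative_transform_within_open[of _ _ _ _ ?U])
      show "\<And>y. y \<in> ?U \<Longrightarrow> 0 = f y" using closure_subset[of "{x. f x \<noteq> 0}"] by auto
    qed (use that in auto)
    then show ?thesis by (simp add: partial_eqI)
  qed
  then have "{x. partial i f x \<noteq> 0} \<subseteq> closure {x. f x \<noteq> 0}" by auto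
  with assms show ?thesis
    unfolding test_fun_def using smooth_partial bounded_closure bounded_subset by blast
qed

section \<open>Mollification\<close>

definition exp_poly :: "real poly \<Rightarrow> real \<Rightarrow> real" where
  "exp_poly P t = (if 0 < t then poly P (1 / t) * exp (- (1 / t)) else 0)"

text \<open>With y = 1/t the product and chain rules turn P(y) exp(-y) into (P(y) - P'(y)) y^2
  exp(-y), so the family \<open>exp_poly\<close> is closed under differentiation and smoothness
  follows from one first-order statement.\<close>

definition exp_poly_deriv :: "real poly \<Rightarrow> real poly" where
  "exp_poly_deriv P = (P - pderiv P) * monom 1 2"

lemma tendsto_poly_times_exp: "((\<lambda>y. poly P y * exp (- y)) \<longlongrightarrow> (0::real)) at_top"
proof -
  have "((\<lambda>y. \<Sum>i\<le>degree P. coeff P i * (y ^ i / exp y)) \<longlongrightarrow> (\<Sum>i\<le>degree P. coeff P i * 0)) at_top"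
    by (intro tendsto_intros tendsto_power_div_exp_0)
  then show ?thesis
    by (simp add: poly_altdef sum_distrib_right exp_minus divide_inverse mult.assoc)
qed

lemma exp_poly_at_right: "(exp_poly P \<longlongrightarrow> 0) (at_right 0)"
proof -
  have "((\<lambda>t. poly P (inverse t) * exp (- inverse t)) \<longlongrightarrow> 0) (at_right 0)"
    using filterlim_compose[OF tendsto_poly_times_exp filterlim_inverse_at_top_right] by simp
  then show ?thesis
    by (rule Lim_transform_eventually)
       (auto simp: eventually_at_filter exp_poly_def inverse_eq_divide)
qed

lemma exp_poly_has_derivative:
  "(exp_poly P has_real_derivative exp_poly (exp_poly_deriv P) t) (at t)"
proof -
  consider "t < 0" | "t = 0" | "t > 0" by linarith
  then show ?thesis
  proof cases
    case 1
    have "((\<lambda>_. 0) has_real_derivative 0) (at t)" by simp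
    then have "(exp_poly P has_real_derivative 0) (at t)"
      by (rule has_field_derivative_transform_within_open[of _ _ _ "{..<0}"])
         (use 1 in \<open>auto simp: exp_poly_def\<close>)
    with 1 show ?thesis by (simp add: exp_poly_def)
  next
    case 2
    \<comment> \<open>Dividing by h multiplies the polynomial in 1/h by its variable, so the right
      difference quotient at 0 is again a member of the family.\<close>
    have r: "((\<lambda>h. exp_poly P h / h) \<longlongrightarrow> 0) (at_right 0)"
    proof (rule Lim_transform_eventually[OF exp_poly_at_right[of "P * monom 1 1"]])
      show "\<forall>\<^sub>F t in at_right 0. exp_poly (P * monom 1 1) t = exp_poly P t / t"
        by (auto simp: eventually_at_filter exp_poly_def poly_monom)
    qed
    have l: "((\<lambda>h. exp_poly P h / h) \<longlongrightarrow> 0) (at_left 0)"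
      by (rule Lim_transform_eventually[OF tendsto_const])
         (auto simp: eventually_at_filter exp_poly_def)
    from l r have "((\<lambda>h. exp_poly P h / h) \<longlongrightarrow> 0) (at 0)"
      by (simp add: filterlim_at_split)
    then show ?thesis using 2 by (simp add: DERIV_def exp_poly_def)
  next
    case 3
    have "((\<lambda>t. poly P (1 / t) * exp (- (1 / t))) has_real_derivative exp_poly (exp_poly_deriv P) t) (at t)"
      using 3 by (auto intro!: derivative_eq_intros
        simp: exp_poly_def exp_poly_deriv_def poly_monom field_simps power2_eq_square)
    then show ?thesis
      by (rule has_field_derivative_transform_within_open[of _ _ _ "{0<..}"])
         (use 3 in \<open>auto simp: exp_poly_def\<close>)
  qed
qed

lemma smooth_exp_poly:
  assumes "smooth f" shows "smooth (\<lambda>x. exp_poly P (f x))"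
proof -
  have "C_k k (\<lambda>x. exp_poly ((exp_poly_deriv ^^ 0) P) (f x))" for k
  proof (rule C_k_compose[of k "\<lambda>m. exp_poly ((exp_poly_deriv ^^ m) P)"])
    show "continuous_on UNIV (exp_poly ((exp_poly_deriv ^^ k) P))"
      by (intro continuous_at_imp_continuous_on ballI DERIV_isCont[OF exp_poly_has_derivative])
  qed (use assms in \<open>auto simp: exp_poly_has_derivative smooth_def\<close>)
  then show ?thesis by (simp add: smooth_def)
qed

lemma bump_exists:
  fixes e :: real
  assumes "0 < e"
  obtains b :: "real^'n::finite \<Rightarrow> real"
  where "test_fun b" "\<And>x. 0 \<le> b x" "\<And>x. norm x < e \<Longrightarrow> 0 < b x" "\<And>x. e \<le> norm x \<Longrightarrow> b x = 0"
proof -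
  \<comment> \<open>The squared norm is a polynomial in the coordinates, hence smooth also at the
    centre.\<close>
  define b :: "real^'n \<Rightarrow> real" where "b x = exp_poly 1 (e\<^sup>2 - (norm x)\<^sup>2)" for x
  have "smooth (\<lambda>x::real^'n. e\<^sup>2 + (\<Sum>i\<in>UNIV. (-1) * (x $ i * x $ i)))"
    by (intro smooth_add smooth_sum smooth_mult smooth_const smooth_coord)
  also have "(\<lambda>x::real^'n. e\<^sup>2 + (\<Sum>i\<in>UNIV. (-1) * (x $ i * x $ i))) = (\<lambda>x. e\<^sup>2 - (norm x)\<^sup>2)"
    by (simp add: norm_vec_def L2_set_def sum_nonneg sum_negf power2_eq_square[symmetric])
  finally have sm: "smooth b" unfolding b_def by (rule smooth_exp_poly)
  have pos: "0 < b x" if "norm x < e" for x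
    using that assms by (auto simp: b_def exp_poly_def power_strict_mono)
  have zero: "b x = 0" if "e \<le> norm x" for x
    using that assms by (auto simp: b_def exp_poly_def dest: power_mono[of e _ 2])
  have "{x. b x \<noteq> 0} \<subseteq> ball 0 e" using zero by force
  then have "test_fun b" using sm by (auto simp: test_fun_def intro: bounded_subset)
  with pos zero show ?thesis
    by (intro that[of b]) (auto simp: b_def exp_poly_def)
qed


section \<open>Convolution and mollifiers\<close>

definition conv :: "(real^'n::finite \<Rightarrow> real) \<Rightarrow> (real^'n \<Rightarrow> real) \<Rightarrow> real^'n \<Rightarrow> real" where
  "conv f g x = (\<integral>y. f y * g (x - y) \<partial>lborel)"

lemma lborel_integral_reflect:
  fixes F :: "'a::euclidean_space \<Rightarrow> real"
  assumes [measurable]: "F \<in> borel_measurable borel"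
  shows "(\<integral>y. F (x - y) \<partial>lborel) = (\<integral>y. F y \<partial>lborel)"
proof -
  have "lborel = distr lborel borel (\<lambda>y::'a. x - y)"
    using lborel_affine[of "-1" x] by (simp add: density_1)
  then have "(\<integral>y. F y \<partial>lborel) = (\<integral>y. F y \<partial>distr lborel borel (\<lambda>y. x - y))" by simp
  also have "\<dots> = (\<integral>y. F (x - y) \<partial>lborel)" by (rule integral_distr) auto
  finally show ?thesis ..
qed

lemma continuous_borel: "continuous_on UNIV f \<Longrightarrow> f \<in> borel_measurable borel"
  by (rule borel_measurable_continuous_onI)

lemma conv_commute:
  assumes "continuous_on UNIV f" "continuous_on UNIV g"
  shows "conv f g = conv g f"
proof
  fix x
  have [measurable]: "f \<in> borel_measurable borel" "g \<in> borel_measurable borel"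
    using assms by (auto intro: continuous_borel)
  have "conv f g x = (\<integral>y. f (x - y) * g (x - (x - y)) \<partial>lborel)"
    unfolding conv_def by (subst lborel_integral_reflect[where x = x, symmetric]) auto
  then show "conv f g x = conv g f x" by (simp add: conv_def mult.commute)
qed

lemma conv_eq_integral:
  assumes f: "continuous_on UNIV f" and g: "continuous_on UNIV g" and s: "{x. f x \<noteq> 0} \<subseteq> cbox a b"
  shows "conv f g x = integral (cbox a b) (\<lambda>y. f y * g (x - y))"
proof -
  have c: "continuous_on S (\<lambda>y. f y * g (x - y))" for S
    by (rule continuous_on_subset[of UNIV])
       (auto intro!: continuous_intros f continuous_on_compose2[OF g])
  have "set_integrable lborel (cbox a b) (\<lambda>y. f y * g (x - y))"
    unfolding set_integrable_def by (rule borel_integrable_compact[OF compact_cbox c])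
  from set_borel_integral_eq_integral(2)[OF this]
  have "(LINT y:cbox a b|lborel. f y * g (x - y)) = integral (cbox a b) (\<lambda>y. f y * g (x - y))" .
  moreover have "(LINT y:cbox a b|lborel. f y * g (x - y)) = conv f g x"
    unfolding set_lebesgue_integral_def conv_def
    by (rule Bochner_Integration.integral_cong) (use s in \<open>auto simp: indicator_def\<close>)
  ultimately show ?thesis by simp
qed

lemma bounded_support_cbox:
  fixes f :: "real^'n::finite \<Rightarrow> real"
  assumes "bounded {x. f x \<noteq> 0}" obtains a b where "{x. f x \<noteq> 0} \<subseteq> cbox a b"
  using bounded_subset_cbox_symmetric[OF assms] by blast

text \<open>The integral runs over one fixed box containing the support of \<open>f\<close>, and x
  enters through \<open>g\<close> alone; so the derivative may be taken under the integral sign and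
  falls on \<open>g\<close>.\<close>

lemma conv_differentiable:
  fixes f g :: "real^'n::finite \<Rightarrow> real"
  assumes f: "continuous_on UNIV f" "bounded {x. f x \<noteq> 0}" and g: "C_k (Suc 0) g"
  shows "conv f g differentiable (at x)" "partial i (conv f g) x = conv f (partial i g) x"
proof -
  obtain a b where ab: "{x. f x \<noteq> 0} \<subseteq> cbox a b" using bounded_support_cbox[OF f(2)] .
  have gd: "g differentiable (at x)" and gp: "continuous_on UNIV (partial i g)" for x i
    using g by auto
  have gc: "continuous_on UNIV g" using g C_k_continuous by blast
  \<comment> \<open>\<open>leibniz_rule\<close> expects the derivative as a bounded linear function,
    so it is assembled from the coordinate functionals \<open>e i\<close>.\<close>
  define e :: "'n \<Rightarrow> (real^'n) \<Rightarrow>\<^sub>L real" where "e i = Blinfun (\<lambda>v. v $ i)" for i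
  have e: "blinfun_apply (e i) v = v $ i" for i v
    unfolding e_def by (subst bounded_linear_Blinfun_apply) (auto intro: bounded_linear_vec_nth)
  define D where "D x t = (\<Sum>i\<in>UNIV. (f t * partial i g (x - t)) *\<^sub>R e i)" for x t
  have Da: "blinfun_apply (D x t) v = f t * (\<Sum>i\<in>UNIV. v $ i * partial i g (x - t))" for x t v
    by (simp add: D_def blinfun.sum_left blinfun.scaleR_left e sum_distrib_left mult_ac)
  have c: "continuous_on UNIV (\<lambda>(x, t). D x t)"
    unfolding D_def case_prod_beta
    by (intro continuous_intros continuous_on_compose2[OF f(1)] continuous_on_compose2[OF gp]) auto
  have cm: "continuous_on S (\<lambda>t. f t * g (x - t))" for S x
    by (rule continuous_on_subset[of UNIV])
       (auto intro!: continuous_intros f continuous_on_compose2[OF gc])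
  have d: "((\<lambda>x. integral (cbox a b) (\<lambda>t. f t * g (x - t))) has_derivative integral (cbox a b) (D x))
        (at x within UNIV)"
  proof (rule leibniz_rule)
    fix x t
    have "((\<lambda>x. g (x - t)) has_derivative (\<lambda>v. \<Sum>i\<in>UNIV. v $ i * partial i g (x - t))) (at x)"
      by (rule has_derivative_compose[OF _ has_derivative_partial[OF gd], of "\<lambda>x. x - t", simplified])
         (auto intro!: derivative_eq_intros)
    from has_derivative_mult_right[OF this, of "f t"]
    show "((\<lambda>x. f t * g (x - t)) has_derivative blinfun_apply (D x t)) (at x)"
      by (simp add: Da[abs_def])
    show "(\<lambda>t. f t * g (x - t)) integrable_on cbox a b"
      by (rule integrable_continuous[OF cm])
    show "continuous_on (UNIV \<times> cbox a b) (\<lambda>(x, t). D x t)"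
      by (rule continuous_on_subset[OF c]) auto
  qed auto
  have eq: "conv f g = (\<lambda>x. integral (cbox a b) (\<lambda>t. f t * g (x - t)))"
    by (rule ext, rule conv_eq_integral[OF f(1) gc ab])
  show "conv f g differentiable (at x)"
    using d unfolding eq differentiable_def by blast
  have "partial i (conv f g) x = blinfun_apply (integral (cbox a b) (D x)) (axis i 1)"
    unfolding eq by (rule partial_eqI) (use d in simp)
  also have "\<dots> = integral (cbox a b) ((\<lambda>B. blinfun_apply B (axis i 1)) \<circ> D x)"
    by (rule integral_linear[symmetric])
       (auto intro!: integrable_continuous continuous_on_compose2[OF c, of _ "Pair x", simplified]
         continuous_intros bounded_linear_intros)
  also have "\<dots> = integral (cbox a b) (\<lambda>t. f t * partial i g (x - t))"
    by (simp add: o_def Da axis_def if_distrib if_distribR sum.delta cong: if_cong)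
  also have "\<dots> = conv f (partial i g) x"
    by (rule conv_eq_integral[OF f(1) gp ab, symmetric])
  finally show "partial i (conv f g) x = conv f (partial i g) x" .
qed

lemma partial_conv_right:
  assumes "continuous_on UNIV f" "bounded {x. f x \<noteq> 0}" "C_k (Suc 0) g"
  shows "partial i (conv f g) = conv f (partial i g)"
  using conv_differentiable(2)[OF assms] by blast

lemma partial_conv_left:
  assumes f: "C_k (Suc 0) f" and g: "continuous_on UNIV g" "bounded {x. g x \<noteq> 0}"
  shows "partial i (conv f g) = conv (partial i f) g"
proof -
  have "continuous_on UNIV f" "continuous_on UNIV (partial i f)" using f C_k_continuous by fastforce+
  then show ?thesis using partial_conv_right[OF g f, of i] conv_commute g(1) by metis
qed

lemma smooth_conv:
  assumes f: "continuous_on UNIV f" "bounded {x. f x \<noteq> 0}" and g: "smooth g"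
  shows "smooth (conv f g)"
proof -
  have "C_k k (conv f g)" if "smooth g" for k g
    using that
  proof (induction k arbitrary: g)
    case 0
    then have "C_k (Suc 0) g" by (simp add: smooth_def del: C_k.simps)
    from conv_differentiable(1)[OF f this] show ?case
      by (auto intro!: continuous_at_imp_continuous_on differentiable_imp_continuous_within)
  next
    case (Suc k)
    then have "C_k (Suc 0) g" by (simp add: smooth_def del: C_k.simps)
    from conv_differentiable(1)[OF f this] partial_conv_right[OF f this] Suc
    show ?case by (simp add: smooth_partial)
  qed
  with g show ?thesis by (simp add: smooth_def)
qed

lemma conv_nonzeroD:
  assumes "conv f g x \<noteq> 0" obtains y where "f y \<noteq> 0" "g (x - y) \<noteq> 0"
proof (rule ccontr)
  assume "\<not> thesis"
  then have "(\<lambda>y. f y * g (x - y)) = (\<lambda>_. 0)" using that by (metis mult_eq_0_iff)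
  with assms show False by (simp add: conv_def)
qed

lemma test_fun_conv:
  assumes f: "continuous_on UNIV f" "bounded {x. f x \<noteq> 0}" and g: "test_fun g"
  shows "test_fun (conv f g)"
proof -
  have "bounded {x. g x \<noteq> 0}" using g by (simp add: test_fun_def)
  from bounded_plus[OF f(2) this]
  have "bounded {x + y | x y. x \<in> {x. f x \<noteq> 0} \<and> y \<in> {x. g x \<noteq> 0}}"
    by (rule bounded_subset) auto
  moreover have "{x. conv f g x \<noteq> 0} \<subseteq> {x + y | x y. x \<in> {x. f x \<noteq> 0} \<and> y \<in> {x. g x \<noteq> 0}}"
  proof safe
    fix x assume "conv f g x \<noteq> 0"
    then obtain y where "f y \<noteq> 0" "g (x - y) \<noteq> 0" by (rule conv_nonzeroD)
    then show "\<exists>a b. x = a + b \<and> a \<in> {x. f x \<noteq> 0} \<and> b \<in> {x. g x \<noteq> 0}"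
      by (intro exI[of _ y] exI[of _ "x - y"]) auto
  qed
  ultimately show ?thesis
    using f g by (auto simp: test_fun_def smooth_conv intro: bounded_subset)
qed

lemma conv_nonneg: "(\<And>x. 0 \<le> f x) \<Longrightarrow> (\<And>x. 0 \<le> g x) \<Longrightarrow> 0 \<le> conv f g x"
  unfolding conv_def by (intro integral_nonneg_AE) auto

lemma integrable_continuous_bounded_support:
  fixes f :: "real^'n::finite \<Rightarrow> real"
  assumes "continuous_on UNIV f" "bounded {x. f x \<noteq> 0}"
  shows "integrable lborel f"
proof -
  obtain a b where ab: "{x. f x \<noteq> 0} \<subseteq> cbox a b" using bounded_support_cbox[OF assms(2)] .
  have "integrable lborel (\<lambda>x. indicator (cbox a b) x *\<^sub>R f x)"
    by (rule borel_integrable_compact) (use assms in \<open>auto intro: continuous_on_subset\<close>)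
  also have "(\<lambda>x. indicator (cbox a b) x *\<^sub>R f x) = f" using ab by (fastforce simp: indicator_def)
  finally show ?thesis .
qed

definition mollifier :: "real \<Rightarrow> (real^'n::finite \<Rightarrow> real) \<Rightarrow> bool" where
  "mollifier e k \<longleftrightarrow> test_fun k \<and> (\<forall>x. 0 \<le> k x) \<and> (\<forall>x. e \<le> norm x \<longrightarrow> k x = 0) \<and> (\<integral>x. k x \<partial>lborel) = 1"

lemma mollifier_exists:
  assumes "0 < e" shows "\<exists>k :: real^'n::finite \<Rightarrow> real. mollifier e k"
proof -
  obtain b :: "real^'n \<Rightarrow> real" where b: "test_fun b" "\<And>x. 0 \<le> b x"
      "\<And>x. norm x < e \<Longrightarrow> 0 < b x" "\<And>x. e \<le> norm x \<Longrightarrow> b x = 0"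
    using bump_exists[OF assms] by metis
  have int: "integrable lborel b"
    using b(1) by (intro integrable_continuous_bounded_support)
       (auto simp: test_fun_def smooth_continuous)
  have "(\<integral>x. b x \<partial>lborel) \<noteq> 0"
  proof
    assume "(\<integral>x. b x \<partial>lborel) = 0"
    then have "AE x in lborel. b x = 0"
      using integral_nonneg_eq_0_iff_AE[OF int] b(2) by simp
    then have "AE x in lborel. x \<notin> ball (0::real^'n) e" by eventually_elim (use b(3) in force)
    then have "emeasure lborel (ball (0::real^'n) e) = 0"
      using AE_iff_measurable[of "ball (0::real^'n) e" lborel "\<lambda>x. x \<notin> ball 0 e"]
      by (simp add: ball_def)
    with content_ball_pos[of e "0::real^'n"] assms show False by (simp add: measure_def)
  qed
  moreover have "0 \<le> (\<integral>x. b x \<partial>lborel)" using b(2) by (intro integral_nonneg_AE) auto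
  ultimately have "mollifier e (\<lambda>x. inverse (\<integral>x. b x \<partial>lborel) * b x)"
    using b by (auto simp: mollifier_def test_fun_mult smooth_const)
  then show ?thesis by blast
qed

definition moll :: "nat \<Rightarrow> real^'n::finite \<Rightarrow> real" where
  "moll j = (SOME k. mollifier (1 / Suc j) k)"

lemma mollifier_moll: "mollifier (1 / Suc j) (moll j)"
  unfolding moll_def using mollifier_exists[of "1 / Suc j"] by (rule someI_ex) simp

lemma test_fun_moll: "test_fun (moll j)" and moll_nonneg: "0 \<le> moll j x"
  using mollifier_moll[of j] by (auto simp: mollifier_def)

lemma continuous_moll: "continuous_on UNIV (moll j)"
  by (rule smooth_continuous[OF test_fun_smooth[OF test_fun_moll]])

lemma bounded_moll: "bounded {x. moll j x \<noteq> 0}"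
  using test_fun_moll unfolding test_fun_def by blast

text \<open>The difference is an average of v (x - y) - v x against a kernel of mass 1 that lives
  where norm y < 1 / Suc j. The bound is pointwise in x and allows d = 0: mollification does not
  change \<open>v\<close> at a point around which it is constant.\<close>

lemma conv_moll_close:
  fixes v :: "real^'n::finite \<Rightarrow> real"
  assumes v: "continuous_on UNIV v" and d: "\<And>y. norm y < 1 / Suc j \<Longrightarrow> \<bar>v (x - y) - v x\<bar> \<le> d"
  shows "\<bar>conv v (moll j) x - v x\<bar> \<le> d"
proof -
  let ?k = "moll j :: real^'n \<Rightarrow> real"
  note kc = continuous_moll[of j, where 'a = 'n] and kb = bounded_moll[of j, where 'a = 'n]
  have k1: "(\<integral>x. ?k x \<partial>lborel) = 1" and k0: "\<And>x. 1 / Suc j \<le> norm x \<Longrightarrow> ?k x = 0"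
    using mollifier_moll[of j, where 'a = 'n] by (auto simp: mollifier_def)
  have i0: "integrable lborel ?k" by (rule integrable_continuous_bounded_support[OF kc kb])
  have i1: "integrable lborel (\<lambda>y. ?k y * v (x - y))"
    by (rule integrable_continuous_bounded_support)
       (auto intro!: continuous_intros kc continuous_on_compose2[OF v] bounded_subset[OF kb])
  have "conv v ?k x - v x = (\<integral>y. ?k y * v (x - y) \<partial>lborel) - (\<integral>y. ?k y * v x \<partial>lborel)"
    by (simp add: conv_commute[OF v kc] k1) (simp add: conv_def)
  also have "\<dots> = (\<integral>y. ?k y * (v (x - y) - v x) \<partial>lborel)"
    using i0 i1 by (simp add: right_diff_distrib)
  finally have "\<bar>conv v ?k x - v x\<bar> \<le> (\<integral>y. \<bar>?k y * (v (x - y) - v x)\<bar> \<partial>lborel)"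
    by (metis integral_abs_bound)
  also have "\<dots> \<le> (\<integral>y. ?k y * d \<partial>lborel)"
  proof (rule integral_mono)
    show "integrable lborel (\<lambda>y. \<bar>?k y * (v (x - y) - v x)\<bar>)"
      using i0 i1 by (simp add: right_diff_distrib)
    show "integrable lborel (\<lambda>y. ?k y * d)" using i0 by simp
    show "\<bar>?k y * (v (x - y) - v x)\<bar> \<le> ?k y * d" for y
      using d[of y] k0[of y] moll_nonneg[of j y]
      by (cases "norm y < 1 / Suc j") (auto simp: abs_mult intro!: mult_left_mono)
  qed
  finally show ?thesis by (simp add: k1)
qed

lemma uniformly_continuous_bounded_support:
  fixes v :: "'a::heine_borel \<Rightarrow> 'b::real_normed_vector"
  assumes "continuous_on UNIV v" "bounded {x. v x \<noteq> 0}"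
  shows "uniformly_continuous_on UNIV v"
  unfolding uniformly_continuous_on_def
proof safe
  fix e :: real assume "e > 0"
  obtain c r where cr: "{x. v x \<noteq> 0} \<subseteq> cball c r" using assms(2) bounded_subset_cball by blast
  have "uniformly_continuous_on (cball c (r + 1)) v"
    by (rule compact_uniformly_continuous) (auto intro: continuous_on_subset[OF assms(1)])
  then obtain d where d: "d > 0"
    "\<And>x y. x \<in> cball c (r + 1) \<Longrightarrow> y \<in> cball c (r + 1) \<Longrightarrow> dist y x < d \<Longrightarrow> dist (v y) (v x) < e"
    unfolding uniformly_continuous_on_def using \<open>e > 0\<close> by metis
  show "\<exists>d>0. \<forall>x\<in>UNIV. \<forall>y\<in>UNIV. dist y x < d \<longrightarrow> dist (v y) (v x) < e"
  proof (intro exI[of _ "min d 1"] conjI ballI impI)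
    fix x y :: 'a assume xy: "dist y x < min d 1"
    show "dist (v y) (v x) < e"
    \<comment> \<open>At distance below 1, either both points lie in the compact ball of radius r +
      1 or both lie off the support.\<close>
    proof (cases "x \<in> cball c r \<or> y \<in> cball c r")
      case True
      then have "x \<in> cball c (r + 1)" "y \<in> cball c (r + 1)"
        using xy dist_triangle[of c x y] dist_triangle[of c y x] by (auto simp: dist_commute)
      then show ?thesis using d(2) xy by auto
    next
      case False
      then have "v x = 0" "v y = 0" using cr by auto
      then show ?thesis using \<open>e > 0\<close> by simp
    qed
  qed (use d in auto)
qed

lemma conv_moll_uniform_limit:
  fixes v :: "real^'n::finite \<Rightarrow> real"
  assumes v: "continuous_on UNIV v" "bounded {x. v x \<noteq> 0}"
  shows "uniform_limit UNIV (\<lambda>j. conv v (moll j)) v sequentially"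
proof (rule uniform_limitI)
  fix e :: real assume "e > 0"
  then obtain d where d: "d > 0" "\<And>x y. dist y x < d \<Longrightarrow> dist (v y) (v x) < e / 2"
    using uniformly_continuous_bounded_support[OF v] unfolding uniformly_continuous_on_def
    by (metis UNIV_I half_gt_zero)
  obtain N where N: "1 / Suc N < d" using d(1) nat_approx_posE by metis
  have "\<forall>\<^sub>F j in sequentially. N \<le> j" by (rule eventually_ge_at_top)
  then show "\<forall>\<^sub>F j in sequentially. \<forall>x\<in>UNIV. dist (conv v (moll j) x) (v x) < e"
  proof eventually_elim
    case (elim j)
    show ?case
    proof
      fix x
      have "\<bar>conv v (moll j) x - v x\<bar> \<le> e / 2"
      proof (rule conv_moll_close[OF v(1)])
        fix y :: "real^'n" assume "norm y < 1 / Suc j"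
        also have "1 / Suc j \<le> 1 / Suc N" using elim by (simp add: frac_le)
        finally have "dist (x - y) x < d" using N by (simp add: dist_norm)
        from d(2)[OF this] show "\<bar>v (x - y) - v x\<bar> \<le> e / 2" by (simp add: dist_real_def)
      qed
      then show "dist (conv v (moll j) x) (v x) < e" using \<open>e > 0\<close> by (simp add: dist_real_def)
    qed
  qed
qed

lemma conv_moll_support:
  assumes "conv v (moll j) x \<noteq> 0" obtains y where "v y \<noteq> 0" "dist x y < 1 / Suc j"
proof -
  from assms obtain y where "v y \<noteq> 0" "moll j (x - y) \<noteq> 0" by (rule conv_nonzeroD)
  moreover from this have "dist x y < 1 / Suc j"
    using mollifier_moll[of j] unfolding mollifier_def by (metis dist_norm linorder_not_le)
  ultimately show ?thesis using that by blast
qed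

text \<open>Uniform limits are passed through integrals against a Radon measure only for functions
  living in one ball; this provides its radius.\<close>

lemma conv_moll_common_support:
  assumes "bounded {x. v x \<noteq> 0}"
  obtains r where "\<And>j x. conv v (moll j) x \<noteq> 0 \<Longrightarrow> norm x \<le> r" "\<And>x. v x \<noteq> 0 \<Longrightarrow> norm x \<le> r"
proof -
  obtain r where r: "\<And>x. v x \<noteq> 0 \<Longrightarrow> norm x \<le> r" using assms by (auto simp: bounded_iff)
  have "norm x \<le> r + 1" if nz: "conv v (moll j) x \<noteq> 0" for j x
  proof -
    obtain y where "v y \<noteq> 0" "dist x y < 1 / Suc j" using nz by (rule conv_moll_support)
    moreover from this have "dist x y < 1" by (rule_tac order.strict_trans2) auto
    ultimately show ?thesis using r[of y] norm_triangle_sub[of x y] by (simp add: dist_norm)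
  qed
  then show ?thesis using r that[of "r + 1"] by (metis add_increasing2 zero_le_one order.trans norm_ge_zero)
qed

lemma cutoff_exists:
  fixes C :: "(real^'n::finite) set"
  assumes "bounded C"
  obtains \<theta> U where "test_fun \<theta>" "\<And>x. 0 \<le> \<theta> x" "\<And>x. \<theta> x \<le> 1" "open U" "C \<subseteq> U" "\<And>x. x \<in> U \<Longrightarrow> \<theta> x = 1"
proof -
  obtain r where r: "\<And>x. x \<in> C \<Longrightarrow> norm x < r" using assms by (meson bounded_pos_less)
  \<comment> \<open>The function equals 1 up to radius r + 1 because \<open>moll 0\<close> has
    radius 1: its mollification is then still 1 on the ball of radius r.\<close>
  define v :: "real^'n \<Rightarrow> real" where "v x = max 0 (min 1 (r + 2 - norm x))" for x
  have vc: "continuous_on UNIV v" unfolding v_def by (intro continuous_intros)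
  have vb: "bounded {x. v x \<noteq> 0}"
    by (rule bounded_subset[of "cball 0 (r + 2)"]) (auto simp: v_def split: if_splits)
  let ?\<theta> = "conv v (moll 0)"
  have "?\<theta> x = 1" if "x \<in> ball 0 r" for x
  proof -
    have v1: "v y = 1" if "norm y \<le> r + 1" for y using that by (auto simp: v_def)
    have "\<bar>conv v (moll 0) x - v x\<bar> \<le> 0"
    proof (rule conv_moll_close[OF vc])
      fix y :: "real^'n" assume "norm y < 1 / Suc 0"
      then have "norm (x - y) \<le> r + 1" "norm x \<le> r + 1"
        using that norm_triangle_ineq4[of x y] by auto
      then show "\<bar>v (x - y) - v x\<bar> \<le> 0" by (simp add: v1)
    qed
    moreover have "v x = 1" using that by (intro v1) auto
    ultimately show ?thesis by simp
  qed
  moreover have "?\<theta> x \<le> 1" for x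
  proof -
    have mb: "integrable lborel (moll 0 :: real^'n \<Rightarrow> real)"
      by (intro integrable_continuous_bounded_support continuous_moll bounded_moll)
    note mc = continuous_moll[of 0, where 'a = 'n]
    have "conv (moll 0) v x \<le> (\<integral>y. moll 0 y \<partial>(lborel::(real^'n) measure))"
      unfolding conv_def
    proof (rule integral_mono[OF _ mb])
      show "integrable lborel (\<lambda>y. moll 0 y * v (x - y))"
        by (intro integrable_continuous_bounded_support)
         (auto intro!: continuous_intros mc continuous_on_compose2[OF vc] bounded_subset[OF bounded_moll])
      show "moll 0 y * v (x - y) \<le> moll 0 y" for y
        using moll_nonneg[of 0 y] by (intro mult_left_le) (auto simp: v_def)
    qed
    also have "\<dots> = 1" using mollifier_moll[of 0, where 'a = 'n] by (simp add: mollifier_def)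
    finally show ?thesis using conv_commute[OF vc mc] by simp
  qed
  ultimately show ?thesis
    using r by (intro that[of ?\<theta> "ball 0 r"])
      (auto intro!: test_fun_conv[OF vc vb test_fun_moll] conv_nonneg moll_nonneg simp: v_def)
qed

section \<open>Positive functionals and Radon measures\<close>

definition Cc :: "('a::metric_space \<Rightarrow> 'b::real_normed_vector) \<Rightarrow> bool" where
  "Cc f \<longleftrightarrow> continuous_on UNIV f \<and> bounded {x. f x \<noteq> 0}"

lemma Cc_zero: "Cc (\<lambda>_. 0)" by (simp add: Cc_def)

lemma Cc_subset:
  "Cc f \<Longrightarrow> continuous_on UNIV g \<Longrightarrow> (\<And>x. f x = 0 \<Longrightarrow> g x = 0) \<Longrightarrow> Cc g"
  unfolding Cc_def by (auto elim: bounded_subset)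

lemma Cc_add: assumes "Cc f" "Cc g" shows "Cc (\<lambda>x. f x + g x)"
proof -
  have "bounded ({x. f x \<noteq> 0} \<union> {x. g x \<noteq> 0})" using assms by (simp add: Cc_def)
  then have "bounded {x. f x + g x \<noteq> 0}" by (rule bounded_subset) auto
  with assms show ?thesis by (simp add: Cc_def continuous_on_add)
qed

lemma Cc_scaleR: "continuous_on UNIV g \<Longrightarrow> Cc f \<Longrightarrow> Cc (\<lambda>x. g x *\<^sub>R f x)"
  by (rule Cc_subset) (auto intro!: continuous_intros simp: Cc_def)

lemma Cc_mult: "continuous_on UNIV g \<Longrightarrow> Cc f \<Longrightarrow> Cc (\<lambda>x. g x * f x :: real)"
  by (rule Cc_subset) (auto intro!: continuous_intros simp: Cc_def)

lemma Cc_diff: "Cc f \<Longrightarrow> Cc g \<Longrightarrow> Cc (\<lambda>x. f x - g x)"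
  using Cc_add[of f "\<lambda>x. (-1) *\<^sub>R g x"] Cc_scaleR[of "\<lambda>_. -1" g] by simp

lemma Cc_sum: "(\<And>s. s \<in> I \<Longrightarrow> Cc (f s)) \<Longrightarrow> Cc (\<lambda>x. \<Sum>s\<in>I. f s x)"
  by (induction I rule: infinite_finite_induct) (auto simp: Cc_zero Cc_add)

lemma test_fun_Cc: "test_fun f \<Longrightarrow> Cc f"
  by (auto simp: test_fun_def Cc_def smooth_continuous)

lemma Cc_bounded:
  fixes f :: "'a::heine_borel \<Rightarrow> 'b::real_normed_vector"
  assumes "Cc f" obtains b where "0 < b" "\<And>x. norm (f x) \<le> b"
proof -
  have "compact (f ` closure {x. f x \<noteq> 0})"
    using assms unfolding Cc_def
    by (intro compact_continuous_image) (auto intro: continuous_on_subset simp: compact_closure)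
  then have "bounded (f ` closure {x. f x \<noteq> 0})" by (rule compact_imp_bounded)
  then obtain b where b: "0 < b" "\<And>y. y \<in> f ` closure {x. f x \<noteq> 0} \<Longrightarrow> norm y \<le> b"
    unfolding bounded_pos by blast
  have "norm (f x) \<le> b" for x
  proof (cases "f x = 0")
    case False
    then have "x \<in> closure {x. f x \<noteq> 0}" using closure_subset[of "{x. f x \<noteq> 0}"] by auto
    then show ?thesis using b(2) by blast
  qed (use b in auto)
  with b(1) show ?thesis by (rule that)
qed

lemma Cc_cutoff:
  fixes C :: "'a::real_normed_vector set"
  assumes "bounded C"
  obtains \<theta> :: "'a \<Rightarrow> real" where "Cc \<theta>" "\<And>x. 0 \<le> \<theta> x" "\<And>x. \<theta> x \<le> 1" "\<And>x. x \<in> C \<Longrightarrow> \<theta> x = 1"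
proof -
  obtain r where r: "\<And>x. x \<in> C \<Longrightarrow> norm x < r" using assms by (meson bounded_pos_less)
  define \<theta> :: "'a \<Rightarrow> real" where "\<theta> x = max 0 (min 1 (r + 1 - norm x))" for x
  have "\<theta> x = 0" if "x \<notin> cball 0 (r + 1)" for x using that by (simp add: \<theta>_def)
  then have "{x. \<theta> x \<noteq> 0} \<subseteq> cball 0 (r + 1)" by blast
  then have "bounded {x. \<theta> x \<noteq> 0}" by (rule bounded_subset[OF bounded_cball])
  moreover have "continuous_on UNIV \<theta>" unfolding \<theta>_def by (intro continuous_intros)
  moreover have "\<theta> x = 1" if "x \<in> C" for x using r[OF that] by (simp add: \<theta>_def)
  moreover have "0 \<le> \<theta> x" "\<theta> x \<le> 1" for x by (simp_all add: \<theta>_def)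
  ultimately show ?thesis using that[of \<theta>] by (simp add: Cc_def)
qed

text \<open>The domain is a parameter since the notion is used both for continuous functions with
  bounded support and for test functions.\<close>

definition positive_functional :: "(('a \<Rightarrow> real) \<Rightarrow> bool) \<Rightarrow> (('a \<Rightarrow> real) \<Rightarrow> real) \<Rightarrow> bool" where
  "positive_functional P \<Lambda> \<longleftrightarrow>
     (\<forall>f g. P f \<longrightarrow> P g \<longrightarrow> \<Lambda> (\<lambda>x. f x + g x) = \<Lambda> f + \<Lambda> g) \<and>
     (\<forall>c f. P f \<longrightarrow> \<Lambda> (\<lambda>x. c * f x) = c * \<Lambda> f) \<and>
     (\<forall>f. P f \<longrightarrow> (\<forall>x. 0 \<le> f x) \<longrightarrow> 0 \<le> \<Lambda> f)"

context
  fixes \<Lambda> :: "('a::euclidean_space \<Rightarrow> real) \<Rightarrow> real"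
  assumes pf: "positive_functional Cc \<Lambda>"
begin

private lemma L_add: "Cc f \<Longrightarrow> Cc g \<Longrightarrow> \<Lambda> (\<lambda>x. f x + g x) = \<Lambda> f + \<Lambda> g"
  and L_cmult: "Cc f \<Longrightarrow> \<Lambda> (\<lambda>x. c * f x) = c * \<Lambda> f"
  and L_nonneg: "Cc f \<Longrightarrow> (\<And>x. 0 \<le> f x) \<Longrightarrow> 0 \<le> \<Lambda> f"
  using pf by (auto simp: positive_functional_def)

private lemma L_zero: "\<Lambda> (\<lambda>_. 0) = 0"
  using L_cmult[OF Cc_zero, of 0] by simp

private lemma L_diff: assumes "Cc f" "Cc g" shows "\<Lambda> (\<lambda>x. f x - g x) = \<Lambda> f - \<Lambda> g"
  using L_add[OF Cc_diff[OF assms] assms(2)] by simp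

private lemma L_sum: "(\<And>s. s \<in> I \<Longrightarrow> Cc (f s)) \<Longrightarrow> \<Lambda> (\<lambda>x. \<Sum>s\<in>I. f s x) = (\<Sum>s\<in>I. \<Lambda> (f s))"
  by (induction I rule: infinite_finite_induct) (auto simp: L_zero L_add Cc_sum)

private lemma L_mono: assumes "Cc f" "Cc g" "\<And>x. f x \<le> g x" shows "\<Lambda> f \<le> \<Lambda> g"
  using L_nonneg[OF Cc_diff[OF assms(2,1)]] assms by (simp add: L_diff)

text \<open>Daniell continuity, by a Dini argument on the compact support of \<open>g\<close>.\<close>

private lemma L_countable:
  assumes g: "Cc g" "\<And>x. 0 \<le> g x" and f: "\<And>n. Cc (f n)" "\<And>n x. 0 \<le> f n x"
    and le: "\<And>x. ennreal (g x) \<le> (\<Sum>n. ennreal (f n x))"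
  shows "ennreal (\<Lambda> g) \<le> (\<Sum>n. ennreal (\<Lambda> (f n)))"
proof -
  let ?K = "closure {x. g x \<noteq> 0}"
  have K: "compact ?K" using g by (simp add: Cc_def compact_closure)
  obtain \<theta> :: "'a \<Rightarrow> real" where \<theta>: "Cc \<theta>" "\<And>x. 0 \<le> \<theta> x" "\<And>x. \<theta> x \<le> 1" "\<And>x. x \<in> ?K \<Longrightarrow> \<theta> x = 1"
    by (rule Cc_cutoff[OF compact_imp_bounded[OF K]]) blast
  have fin: "\<exists>N. \<Lambda> g \<le> (\<Sum>n<N. \<Lambda> (f n)) + e * \<Lambda> \<theta>" if e: "0 < e" for e
  proof -
    \<comment> \<open>These open sets increase with N and cover the compact set, because the series
      of the \<open>f n\<close> dominates \<open>g\<close> and e is positive; so a single one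
      contains it.\<close>
    define V where "V N = {x. g x < (\<Sum>n<N. f n x) + e}" for N
    have "open (V N)" for N
      unfolding V_def using g f
      by (intro open_Collect_less continuous_intros) (auto simp: Cc_def)
    moreover have "?K \<subseteq> (\<Union>N. V N)"
    proof
      fix x
      have "\<exists>N. g x - e < (\<Sum>n<N. f n x)"
      proof (cases "g x - e < 0")
        case True then show ?thesis by (intro exI[of _ 0]) auto
      next
        case False
        then have "ennreal (g x - e) < ennreal (g x)" using e by (simp add: ennreal_lessI)
        also have "\<dots> \<le> (SUP N. \<Sum>n<N. ennreal (f n x))" using le[of x] by (simp add: suminf_eq_SUP)
        finally obtain N where "ennreal (g x - e) < (\<Sum>n<N. ennreal (f n x))"
          unfolding less_SUP_iff by blast
        also have "\<dots> = ennreal (\<Sum>n<N. f n x)" using f by simp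
        finally show ?thesis using False by (auto simp: ennreal_less_iff)
      qed
      then show "x \<in> (\<Union>N. V N)" by (auto simp: V_def algebra_simps)
    qed
    ultimately obtain D where D: "finite D" "?K \<subseteq> (\<Union>N\<in>D. V N)"
      by (rule compactE_image[OF K, of UNIV V]) auto
    define N where "N = Max (insert 0 D)"
    have "V n \<subseteq> V N" if "n \<in> D" for n
    proof -
      have "n \<le> N" using that D by (simp add: N_def)
      then have le: "(\<Sum>i<n. f i x) \<le> (\<Sum>i<N. f i x)" for x
        using f by (intro sum_mono2) auto
      show ?thesis
      proof
        fix x assume "x \<in> V n" then show "x \<in> V N" using le[of x] by (simp add: V_def)
      qed
    qed
    then have KV: "?K \<subseteq> V N" using D by blast
    have "\<Lambda> g \<le> \<Lambda> (\<lambda>x. (\<Sum>n<N. f n x) + e * \<theta> x)"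
    proof (rule L_mono)
      show "Cc (\<lambda>x. (\<Sum>n<N. f n x) + e * \<theta> x)"
        using f \<theta> by (intro Cc_add Cc_sum Cc_mult) auto
      show "g x \<le> (\<Sum>n<N. f n x) + e * \<theta> x" for x
      proof (cases "g x = 0")
        case True then show ?thesis using f \<theta> e by (simp add: sum_nonneg)
      next
        case False
        then have "x \<in> ?K" using closure_subset[of "{x. g x \<noteq> 0}"] by auto
        then have "x \<in> V N" "\<theta> x = 1" using KV \<theta>(4) by auto
          then show ?thesis by (simp add: V_def)
      qed
    qed (use g in auto)
    also have "\<dots> = (\<Sum>n<N. \<Lambda> (f n)) + e * \<Lambda> \<theta>"
      using f \<theta> by (simp add: L_add L_sum L_cmult Cc_sum Cc_mult)
    finally show ?thesis by blast
  qed
  show ?thesis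
  proof (rule ennreal_le_epsilon)
    fix e :: real assume e: "0 < e"
    have T: "0 \<le> \<Lambda> \<theta>" using \<theta> by (intro L_nonneg) auto
    \<comment> \<open>The summand 1 keeps the denominator positive when \<Lambda> \<theta> is
      0.\<close>
    with e fin[of "e / (\<Lambda> \<theta> + 1)"] obtain N where
      N: "\<Lambda> g \<le> (\<Sum>n<N. \<Lambda> (f n)) + e / (\<Lambda> \<theta> + 1) * \<Lambda> \<theta>" by auto
    have "e / (\<Lambda> \<theta> + 1) * \<Lambda> \<theta> \<le> e" using T e by (simp add: field_simps)
    with N have "\<Lambda> g \<le> (\<Sum>n<N. \<Lambda> (f n)) + e" by linarith
    then have "ennreal (\<Lambda> g) \<le> ennreal ((\<Sum>n<N. \<Lambda> (f n)) + e)" by (rule ennreal_leI)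
    also have "\<dots> = (\<Sum>n<N. ennreal (\<Lambda> (f n))) + ennreal e"
      using f e by (simp add: L_nonneg sum_nonneg)
    also have "\<dots> \<le> (\<Sum>n. ennreal (\<Lambda> (f n))) + ennreal e"
      by (intro add_right_mono sum_le_suminf) auto
    finally show "ennreal (\<Lambda> g) \<le> (\<Sum>n. ennreal (\<Lambda> (f n))) + ennreal e" .
  qed
qed

section \<open>The outer measure of a positive functional\<close>

private definition covers :: "(nat \<Rightarrow> 'a \<Rightarrow> real) \<Rightarrow> 'a set \<Rightarrow> bool" where
  "covers f E \<longleftrightarrow> (\<forall>n. Cc (f n) \<and> (\<forall>x. 0 \<le> f n x)) \<and> (\<forall>x\<in>E. 1 \<le> (\<Sum>n. ennreal (f n x)))"

text \<open>Daniell's construction: a set is covered by sums of functions rather than by open sets,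
  so countable subadditivity is a reindexing of double series.\<close>

private definition outer :: "'a set \<Rightarrow> ennreal" where
  "outer E = (INF f\<in>{f. covers f E}. \<Sum>n. ennreal (\<Lambda> (f n)))"

private lemma outer_le: "covers f E \<Longrightarrow> outer E \<le> (\<Sum>n. ennreal (\<Lambda> (f n)))"
  unfolding outer_def by (rule INF_lower) simp

private lemma outer_le_double:
  assumes f: "\<And>i j. Cc (f i j)" "\<And>i j x. 0 \<le> f i j x"
    and c: "\<And>x. x \<in> E \<Longrightarrow> 1 \<le> (\<Sum>i. \<Sum>j. ennreal (f i j x))"
  shows "outer E \<le> (\<Sum>i. \<Sum>j. ennreal (\<Lambda> (f i j)))"
proof -
  define g where "g k = f (fst (prod_decode k)) (snd (prod_decode k))" for k
  have *: "(\<Sum>k. h (fst (prod_decode k)) (snd (prod_decode k))) = (\<Sum>i. \<Sum>j. h i j)"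
    for h :: "nat \<Rightarrow> nat \<Rightarrow> ennreal"
    using suminf_ennreal_2dimen[of "\<lambda>i. \<Sum>j. h i j" "\<lambda>p. h (fst p) (snd p)"] by simp
  have "covers g E"
    unfolding covers_def
  proof (intro conjI allI ballI)
    fix x assume "x \<in> E"
    from c[OF this] show "1 \<le> (\<Sum>k. ennreal (g k x))"
      unfolding g_def by (subst *)
  qed (simp_all add: g_def f)
  from outer_le[OF this] show ?thesis
    unfolding g_def by (subst (asm) *)
qed

private lemma outer_cover:
  assumes "outer E \<noteq> \<infinity>" "0 < (e::real)"
  shows "\<exists>f. covers f E \<and> (\<Sum>n. ennreal (\<Lambda> (f n))) \<le> outer E + ennreal e"
proof -
  from INF_approx_ennreal[OF assms(2) outer_def assms(1)]
  obtain f where "covers f E" "(\<Sum>n. ennreal (\<Lambda> (f n))) < outer E + ennreal e" by auto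
  then show ?thesis by (intro exI[of _ f] conjI less_imp_le)
qed

private lemma suminf_eps:
  assumes "0 \<le> e" shows "(\<Sum>n. ennreal (e * (1 / 2) ^ Suc n)) = ennreal e"
proof (rule suminf_ennreal_eq)
  show "(\<lambda>n. e * (1 / 2) ^ Suc n) sums e" using sums_mult[OF power_half_series, of e] by simp
qed (use assms in simp)

private lemma outer_empty: "outer {} = 0"
proof -
  have "covers (\<lambda>_ _. 0) {}" by (simp add: covers_def Cc_zero)
  from outer_le[OF this] show ?thesis by (simp add: L_zero)
qed

private lemma outer_mono: "A \<subseteq> B \<Longrightarrow> outer A \<le> outer B"
  unfolding outer_def by (rule INF_superset_mono) (auto simp: covers_def)

private lemma outer_countably_subadditive: "outer (\<Union>i. A i) \<le> (\<Sum>i. outer (A i))"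
proof (rule ennreal_le_epsilon)
  fix e :: real assume e: "0 < e" and fin: "(\<Sum>i. outer (A i)) < top"
  have "outer (A i) \<noteq> \<infinity>" for i using ennreal_suminf_lessD[OF fin, of i] by simp
  moreover have "0 < e * (1 / 2) ^ Suc i" for i using e by simp
  ultimately have "\<exists>f. covers f (A i) \<and> (\<Sum>n. ennreal (\<Lambda> (f n))) \<le> outer (A i) + ennreal (e * (1 / 2) ^ Suc i)" for i
    by (rule outer_cover)
  then obtain f where f: "\<And>i. covers (f i) (A i)"
    "\<And>i. (\<Sum>n. ennreal (\<Lambda> (f i n))) \<le> outer (A i) + ennreal (e * (1 / 2) ^ Suc i)" by metis
  have "outer (\<Union>i. A i) \<le> (\<Sum>i. \<Sum>j. ennreal (\<Lambda> (f i j)))"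
  proof (rule outer_le_double)
    fix x assume "x \<in> (\<Union>i. A i)"
    then obtain k where "x \<in> A k" by blast
    then have "1 \<le> (\<Sum>j. ennreal (f k j x))" using f(1) by (simp add: covers_def)
    also have "\<dots> \<le> (\<Sum>i. \<Sum>j. ennreal (f i j x))"
      using sum_le_suminf[of "\<lambda>i. \<Sum>j. ennreal (f i j x)" "{k}"] by simp
    finally show "1 \<le> (\<Sum>i. \<Sum>j. ennreal (f i j x))" .
  qed (use f(1) in \<open>auto simp: covers_def\<close>)
  also have "\<dots> \<le> (\<Sum>i. outer (A i) + ennreal (e * (1 / 2) ^ Suc i))"
    by (intro suminf_le f(2)) auto
  also have "\<dots> = (\<Sum>i. outer (A i)) + ennreal e"
    using e by (simp only: suminf_add[OF summableI summableI, symmetric] suminf_eps less_imp_le half_gt_zero)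
  finally show "outer (\<Union>i. A i) \<le> (\<Sum>i. outer (A i)) + ennreal e" .
qed

text \<open>The functions \<open>h k\<close> vanish off \<open>U\<close> and increase to 1 on it.
  Each member f n of a nearly optimal cover of \<open>E\<close> is split into f n * h and f n - f n
  * h. The second parts still cover E - U. The first parts cover E \<inter> U only in the limit, so
  the index K n is taken so large that at most a geometric share of e / 2 is lost.\<close>

private lemma outer_open_split:
  assumes U: "open U" shows "outer (E \<inter> U) + outer (E - U) \<le> outer E"
\<comment> \<open>For U = UNIV the complement is empty and \<open>infdist\<close> to it is 0 by
  convention, so the functions \<open>h\<close> below would not increase to 1.\<close>
proof (cases "U = UNIV \<or> outer E = \<infinity>")
  case True then show ?thesis by (auto simp: outer_empty)
next
  case False
  then have fin: "outer E \<noteq> \<infinity>" and "U \<noteq> UNIV" by simp_all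
  then have cl: "closed (- U)" "- U \<noteq> {}"
    using closed_Compl[OF U] Compl_UNIV_eq double_complement by metis+
  define h where "h k x = min 1 (real k * infdist x (- U))" for k :: nat and x
  have h: "0 \<le> h k x" "h k x \<le> 1" "continuous_on UNIV (h k)" for k x
    unfolding h_def by (simp_all add: infdist_nonneg) (intro continuous_intros)
  have hmono: "h k x \<le> h (Suc k) x" for k x
    unfolding h_def by (intro min.mono mult_right_mono) (auto simp: infdist_nonneg)
  have h0: "h 0 = (\<lambda>_. 0)" by (auto simp: h_def)
  have hU: "h k x = 0" if "x \<notin> U" for k x
    using that by (simp add: h_def)
  define d where "d k x = h (Suc k) x - h k x" for k x
  have d: "0 \<le> d k x" "continuous_on UNIV (d k)" for k x
    unfolding d_def by (simp add: hmono, intro continuous_intros h(3))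
  have dsum: "(\<Sum>k<K. d k x) = h K x" for K x
    by (induction K) (simp_all add: d_def h0)
  have d1: "(\<Sum>k. ennreal (c * d k x)) = ennreal c" if "x \<in> U" "0 \<le> c" for c x
  proof -
    have pos: "0 < infdist x (- U)"
      using that(1) in_closed_iff_infdist_zero[OF cl, of x] infdist_nonneg[of x "- U"] by simp
    obtain K0 where K0: "1 < real K0 * infdist x (- U)" using reals_Archimedean3[OF pos] by blast
    have "\<forall>\<^sub>F K in sequentially. (\<Sum>k<K. c * d k x) = c"
      using eventually_ge_at_top[of K0]
    proof eventually_elim
      case (elim K)
      have "real K0 * infdist x (- U) \<le> real K * infdist x (- U)"
        using elim pos by (intro mult_right_mono) auto
      then have "1 \<le> real K * infdist x (- U)" using K0 by linarith
      then have "h K x = 1" unfolding h_def by (rule min_absorb1)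
      then show ?case using dsum[where K = K and x = x] sum_distrib_left[of c "\<lambda>k. d k x" "{..<K}"] by simp
    qed
    then have sums: "(\<lambda>k. c * d k x) sums c" unfolding sums_def by (rule tendsto_eventually)
    show ?thesis by (rule suminf_ennreal_eq[OF _ sums]) (intro mult_nonneg_nonneg that(2) d(1))
  qed
  show ?thesis
  proof (rule ennreal_le_epsilon)
    fix e :: real assume e: "0 < e"
    obtain f where f: "covers f E" "(\<Sum>n. ennreal (\<Lambda> (f n))) \<le> outer E + ennreal (e / 2)"
      using outer_cover[OF fin half_gt_zero[OF e]] by blast
    have fC: "Cc (f n)" and f0: "0 \<le> f n x" for n x using f(1) by (auto simp: covers_def)
    have fh: "Cc (\<lambda>x. f n x * h k x)" "Cc (\<lambda>x. f n x * d k x)" for n k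
      using Cc_mult[OF h(3) fC] Cc_mult[OF d(2) fC] by (simp_all add: mult.commute)
    have part: "(\<Sum>k<K. \<Lambda> (\<lambda>x. f n x * d k x)) = \<Lambda> (\<lambda>x. f n x * h K x)" for n K
      using fh by (subst L_sum[symmetric]) (auto simp: sum_distrib_left[symmetric] dsum)
    have "\<exists>K. (\<Sum>k. ennreal (\<Lambda> (\<lambda>x. f n x * d k x)))
        \<le> ennreal (\<Lambda> (\<lambda>x. f n x * h K x)) + ennreal (e / 2 * (1 / 2) ^ Suc n)" for n
    proof -
      \<comment> \<open>The partial sums telescope to \<Lambda> (f n * h K), which is bounded by
        \<Lambda> (f n); the series is thus finite, and a finite stage exhausts it up to the
        prescribed error.\<close>
      have eq: "(\<Sum>k. ennreal (\<Lambda> (\<lambda>x. f n x * d k x))) = (SUP K. ennreal (\<Lambda> (\<lambda>x. f n x * h K x)))"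
        unfolding suminf_eq_SUP part[symmetric] using fh(2) f0 d(1) by (simp add: L_nonneg)
      have "(SUP K. ennreal (\<Lambda> (\<lambda>x. f n x * h K x))) \<le> ennreal (\<Lambda> (f n))"
        by (intro SUP_least ennreal_leI L_mono fh(1) fC mult_left_le h(2) f0)
      also have "\<dots> < \<infinity>" by simp
      finally have "(\<Sum>k. ennreal (\<Lambda> (\<lambda>x. f n x * d k x))) \<noteq> \<infinity>"
        unfolding eq by (rule less_imp_neq)
      from SUP_approx_ennreal[OF _ _ eq this, of "e / 2 * (1 / 2) ^ Suc n"] e
      obtain K where "(\<Sum>k. ennreal (\<Lambda> (\<lambda>x. f n x * d k x)))
          < ennreal (\<Lambda> (\<lambda>x. f n x * h K x)) + ennreal (e / 2 * (1 / 2) ^ Suc n)" by auto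
      then show ?thesis by (intro exI[of _ K] less_imp_le)
    qed
    then obtain K where K: "\<And>n. (\<Sum>k. ennreal (\<Lambda> (\<lambda>x. f n x * d k x)))
        \<le> ennreal (\<Lambda> (\<lambda>x. f n x * h (K n) x)) + ennreal (e / 2 * (1 / 2) ^ Suc n)" by metis
    have "outer (E \<inter> U) \<le> (\<Sum>n. \<Sum>k. ennreal (\<Lambda> (\<lambda>x. f n x * d k x)))"
    proof (rule outer_le_double)
      fix x assume "x \<in> E \<inter> U"
      then show "1 \<le> (\<Sum>n. \<Sum>k. ennreal (f n x * d k x))"
        using f(1) f0 by (simp add: d1 covers_def)
    qed (use fh f0 d in auto)
    also have "\<dots> \<le> (\<Sum>n. ennreal (\<Lambda> (\<lambda>x. f n x * h (K n) x)) + ennreal (e / 2 * (1 / 2) ^ Suc n))"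
      by (intro suminf_le K) auto
    also have "\<dots> = (\<Sum>n. ennreal (\<Lambda> (\<lambda>x. f n x * h (K n) x))) + ennreal (e / 2)"
      using e by (simp only: suminf_add[OF summableI summableI, symmetric] suminf_eps less_imp_le half_gt_zero)
    finally have 1: "outer (E \<inter> U) \<le> (\<Sum>n. ennreal (\<Lambda> (\<lambda>x. f n x * h (K n) x))) + ennreal (e / 2)" .
    have fh1: "Cc (\<lambda>x. f n x - f n x * h (K n) x)" for n using Cc_diff[OF fC fh(1)] .
    have fh2: "0 \<le> f n x - f n x * h (K n) x" for n x
      using mult_left_le[OF h(2) f0] by simp
    have 2: "outer (E - U) \<le> (\<Sum>n. ennreal (\<Lambda> (\<lambda>x. f n x - f n x * h (K n) x)))"
      by (rule outer_le) (use f(1) fh1 fh2 in \<open>auto simp: covers_def hU\<close>)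
    have "outer (E \<inter> U) + outer (E - U)
        \<le> (\<Sum>n. ennreal (\<Lambda> (\<lambda>x. f n x * h (K n) x))) + ennreal (e / 2)
           + (\<Sum>n. ennreal (\<Lambda> (\<lambda>x. f n x - f n x * h (K n) x)))"
      by (intro add_mono 1 2)
    also have "\<dots> = (\<Sum>n. ennreal (\<Lambda> (\<lambda>x. f n x * h (K n) x)) + ennreal (\<Lambda> (\<lambda>x. f n x - f n x * h (K n) x)))
         + ennreal (e / 2)"
      by (subst suminf_add[symmetric]) (auto simp: add_ac)
    also have "\<dots> = (\<Sum>n. ennreal (\<Lambda> (f n))) + ennreal (e / 2)"
    proof -
      have "0 \<le> \<Lambda> (\<lambda>x. f n x * h (K n) x)" "0 \<le> \<Lambda> (\<lambda>x. f n x - f n x * h (K n) x)" for n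
        by (intro L_nonneg fh1 fh2 fh(1) mult_nonneg_nonneg f0 h(1))+
      then show ?thesis using fC fh(1) by (simp add: ennreal_plus[symmetric] L_diff del: ennreal_plus)
    qed
    also have "\<dots> \<le> outer E + ennreal (e / 2) + ennreal (e / 2)"
      using f(2) by (rule add_right_mono)
    also have "\<dots> = outer E + ennreal e"
      using e by (simp add: add.assoc ennreal_plus[symmetric] del: ennreal_plus)
    finally show "outer (E \<inter> U) + outer (E - U) \<le> outer E + ennreal e" .
  qed
qed

private definition riesz_measure :: "'a measure" where
  "riesz_measure = measure_of UNIV (sets borel) outer"

private lemma outer_measure_space: "measure_space UNIV (sets borel) outer"
proof -
  interpret P: sigma_algebra UNIV "Pow UNIV :: 'a set set" by (rule sigma_algebra_Pow)
  have "outer_measure_space (Pow UNIV) outer"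
    by (auto simp: outer_measure_space_def positive_def increasing_def countably_subadditive_def
        outer_empty outer_mono outer_countably_subadditive)
  from P.caratheodory_lemma[OF this]
  have ms: "measure_space UNIV (lambda_system UNIV (Pow UNIV) outer) outer" .
  then interpret L: sigma_algebra UNIV "lambda_system UNIV (Pow UNIV) outer"
    by (simp add: measure_space_def)
  have "U \<in> lambda_system UNIV (Pow UNIV) outer" if "open U" for U
  proof -
    have "outer E \<le> outer (E \<inter> U) + outer (E - U)" for E
    proof -
      \<comment> \<open>Padding with empty sets turns countable subadditivity into the binary
        one.\<close>
      define A where "A i = (if i = 0 then E \<inter> U else if i = 1 then E - U else {})" for i :: nat
      have "outer E \<le> outer (\<Union>i. A i)"
        by (rule outer_mono) (auto simp: A_def)
      also have "\<dots> \<le> (\<Sum>i. outer (A i))" by (rule outer_countably_subadditive)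
      also have "\<dots> = (\<Sum>i\<in>{0, 1}. outer (A i))"
        by (rule suminf_finite) (auto simp: A_def outer_empty)
      finally show ?thesis by (simp add: A_def)
    qed
    from antisym[OF outer_open_split[OF that] this] show ?thesis
      unfolding P.lambda_system_eq by simp
  qed
  then have "sigma_sets UNIV {S. open S} \<subseteq> lambda_system UNIV (Pow UNIV) outer"
    by (intro L.sigma_sets_subset subsetI) simp
  then have "sets borel \<subseteq> lambda_system UNIV (Pow UNIV) outer"
    by (simp add: borel_def)
  moreover have "sigma_algebra UNIV (sets (borel :: 'a measure))"
    using sets.sigma_algebra_axioms[of "borel :: 'a measure"] by simp
  ultimately show ?thesis using measure_down[OF ms] by blast
qed

private lemma sets_riesz: "sets riesz_measure = sets borel"
proof -
  have "sets riesz_measure = sigma_sets UNIV (sets (borel :: 'a measure))"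
    unfolding riesz_measure_def by (rule sets_measure_of) auto
  also have "\<dots> = sets borel" using sets.sigma_sets_eq[of "borel :: 'a measure"] by simp
  finally show ?thesis .
qed

private lemma emeasure_riesz: "E \<in> sets borel \<Longrightarrow> emeasure riesz_measure E = outer E"
  unfolding riesz_measure_def
  by (rule emeasure_measure_of_sigma) (use outer_measure_space in \<open>auto simp: measure_space_def\<close>)

private lemma emeasure_riesz_le:
  assumes "E \<in> sets borel" "Cc f" "\<And>x. 0 \<le> f x" "\<And>x. x \<in> E \<Longrightarrow> 1 \<le> f x"
  shows "emeasure riesz_measure E \<le> ennreal (\<Lambda> f)"
proof -
  have c: "covers (\<lambda>n. if n = 0 then f else (\<lambda>_. 0)) E"
    unfolding covers_def
  proof safe
    fix x assume "x \<in> E"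
    then have "1 \<le> ennreal (f x)" using assms by simp
    also have "\<dots> \<le> (\<Sum>n. ennreal ((if n = 0 then f else (\<lambda>_. 0)) x))"
      using sum_le_suminf[of "\<lambda>n. ennreal ((if n = 0 then f else (\<lambda>_. 0)) x)" "{0::nat}"] by simp
    finally show "1 \<le> (\<Sum>n. ennreal ((if n = 0 then f else (\<lambda>_. 0)) x))" .
  qed (use assms in \<open>auto simp: Cc_zero\<close>)
  have "(\<Sum>n. ennreal (\<Lambda> (if n = 0 then f else (\<lambda>_. 0)))) = (\<Sum>n\<in>{0::nat}. ennreal (\<Lambda> f))"
    by (subst suminf_finite[of "{0}"]) (auto simp: L_zero)
  with outer_le[OF c] emeasure_riesz[OF assms(1)] show ?thesis by simp
qed

text \<open>An arbitrary cover of \<open>E\<close> dominates \<open>f\<close>, which is at most 1 on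
  \<open>E\<close> and 0 elsewhere; Daniell continuity carries this over to the values of
  \<Lambda>.\<close>

private lemma emeasure_riesz_ge:
  assumes "E \<in> sets borel" "Cc f" "\<And>x. 0 \<le> f x" "\<And>x. f x \<le> 1" "\<And>x. x \<notin> E \<Longrightarrow> f x = 0"
  shows "ennreal (\<Lambda> f) \<le> emeasure riesz_measure E"
  unfolding emeasure_riesz[OF assms(1)] outer_def
proof (rule INF_greatest)
  fix g assume "g \<in> {g. covers g E}"
  then have g: "Cc (g n)" "0 \<le> g n x" "x \<in> E \<Longrightarrow> 1 \<le> (\<Sum>n. ennreal (g n x))" for n x
    by (auto simp: covers_def)
  show "ennreal (\<Lambda> f) \<le> (\<Sum>n. ennreal (\<Lambda> (g n)))"
  proof (rule L_countable[OF assms(2,3) g(1,2)])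
    fix x show "ennreal (f x) \<le> (\<Sum>n. ennreal (g n x))"
    proof (cases "x \<in> E")
      case True
      have "ennreal (f x) \<le> 1" using assms(4)[of x] by (simp add: ennreal_le_1)
      also note g(3)[OF True]
      finally show ?thesis .
    qed (simp add: assms)
  qed
qed

private lemma riesz_bounded_finite:
  assumes "bounded E" "E \<in> sets borel" shows "emeasure riesz_measure E < \<infinity>"
proof -
  obtain \<theta> :: "'a \<Rightarrow> real" where "Cc \<theta>" "\<And>x. 0 \<le> \<theta> x" "\<And>x. \<theta> x \<le> 1" "\<And>x. x \<in> E \<Longrightarrow> \<theta> x = 1"
    by (rule Cc_cutoff[OF assms(1)]) blast
  then have "emeasure riesz_measure E \<le> ennreal (\<Lambda> \<theta>)"
    by (intro emeasure_riesz_le[OF assms(2)]) auto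
  then show ?thesis using ennreal_less_top le_less_trans by (metis infinity_ennreal_def)
qed

private lemma riesz_integrable:
  fixes f :: "'a \<Rightarrow> real"
  assumes "Cc f" shows "integrable riesz_measure f"
proof -
  obtain b where b: "\<And>x. norm (f x) \<le> b" using Cc_bounded[OF assms] by metis
  let ?K = "closure {x. f x \<noteq> 0}"
  show ?thesis
  proof (rule integrableI_bounded_set[where A = ?K and B = b])
    show "f \<in> borel_measurable riesz_measure"
      using assms by (subst measurable_cong_sets[OF sets_riesz refl])
        (auto simp: Cc_def intro: borel_measurable_continuous_onI)
    show "emeasure riesz_measure ?K < \<infinity>"
      using assms by (intro riesz_bounded_finite) (auto simp: Cc_def)
    show "AE x in riesz_measure. x \<notin> ?K \<longrightarrow> f x = 0"
      using closure_subset[of "{x. f x \<noteq> 0}"] by auto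
  qed (use b in \<open>auto simp: sets_riesz\<close>)
qed

text \<open>Layer-cake decomposition: both sides lie between the lower and the upper Riemann sums of
  the distribution function of \<open>f\<close>.\<close>

private lemma riesz_nonneg:
  assumes f: "Cc f" "\<And>x. 0 \<le> f x" shows "\<Lambda> f = (\<integral>x. f x \<partial>riesz_measure)"
proof -
  let ?M = "riesz_measure"
  have fc: "continuous_on UNIV f" and fb: "bounded {x. f x \<noteq> 0}" using f(1) by (auto simp: Cc_def)
  obtain b where "0 < b" "\<And>x. norm (f x) \<le> b" using Cc_bounded[OF f(1)] by metis
  then have b: "0 < b" "\<And>x. f x \<le> b" by (simp_all add: abs_le_iff)
  define S where "S t = {x. t < f x}" for t
  have S: "S t \<in> sets borel" "emeasure ?M (S t) < \<infinity>" if "0 \<le> t" for t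
  proof -
    have "open (S t)" unfolding S_def using fc by (intro open_Collect_less continuous_intros)
    then show 1: "S t \<in> sets borel" by simp
    show "emeasure ?M (S t) < \<infinity>"
    proof (rule riesz_bounded_finite[OF _ 1], rule bounded_subset[OF fb])
      show "S t \<subseteq> {x. f x \<noteq> 0}" using that by (auto simp: S_def)
    qed
  qed
  define a where "a t = measure ?M (S t)" for t
  have bound: "\<bar>\<Lambda> f - (\<integral>x. f x \<partial>?M)\<bar> \<le> e * a 0" if e: "0 < e" for e
  proof -
    define m where "m = nat \<lceil>b / e\<rceil>"
    have m: "b \<le> m * e"
      using e real_nat_ceiling_ge[of "b / e"] by (simp add: m_def pos_divide_le_eq[symmetric] del: of_nat_nat)
    \<comment> \<open>\<open>g k\<close> is the slice of \<open>f\<close> between the heights k e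
      and (k + 1) e; divided by e it lies between the indicators of two consecutive superlevel
      sets.\<close>
    define g where "g k x = min (max (f x - k * e) 0) e" for k :: nat and x
    have gC: "Cc (g k)" for k
      unfolding g_def
    proof (rule Cc_subset[OF f(1)])
      show "continuous_on UNIV (\<lambda>x. min (max (f x - real k * e) 0) e)" by (intro continuous_intros fc)
    qed (use e in simp)
    have step: "min F t + min (max (F - t) 0) e = min F (t + e)" for F t
      using e by (simp add: min_def max_def)
    have "(\<Sum>k<K. g k x) = min (f x) (K * e)" for K x
    proof (induction K)
      case 0 show ?case using f(2)[of x] by simp
    next
      case (Suc K)
      have "real (Suc K) * e = K * e + e" by (simp add: algebra_simps)
      with Suc step[of "f x" "K * e"] show ?case by (simp add: g_def)
    qed
    then have gsum: "f x = (\<Sum>k<m. g k x)" for x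
      using m b(2)[of x] by (simp add: min_def)
    have G: "0 \<le> g k x" "g k x \<le> e" for k x using e by (simp_all add: g_def)
    have G0: "g k x = 0" if "x \<notin> S (k * e)" for k x
      using that e by (simp add: g_def S_def)
    have G1: "g k x = e" if "x \<in> S (Suc k * e)" for k x
    proof -
      have "real (Suc k) * e = k * e + e" by (simp add: algebra_simps)
      with that have "e \<le> f x - k * e" by (simp add: S_def)
      with e show ?thesis by (simp add: g_def)
    qed
    have gL: "e * a (Suc k * e) \<le> \<Lambda> (g k)" "\<Lambda> (g k) \<le> e * a (k * e)" for k
    proof -
      have gC': "Cc (\<lambda>x. (1 / e) * g k x)" by (intro Cc_mult gC continuous_intros)
      have g': "0 \<le> (1 / e) * g k x" "(1 / e) * g k x \<le> 1" "x \<notin> S (k * e) \<Longrightarrow> (1 / e) * g k x = 0"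
        "x \<in> S (Suc k * e) \<Longrightarrow> 1 \<le> (1 / e) * g k x" for x
        using e G[of k x] G0[of x k] G1[of x k] by simp_all
      have ge: "\<Lambda> (\<lambda>x. (1 / e) * g k x) = \<Lambda> (g k) / e" using L_cmult[OF gC, of "1 / e"] by simp
      have 0: "0 \<le> \<Lambda> (g k) / e" using L_nonneg[OF gC' g'(1)] ge by simp
      have k0: "0 \<le> k * e" "0 \<le> Suc k * e" using e by auto
      from emeasure_riesz_ge[OF S(1)[OF k0(1)] gC' g'(1,2,3)]
      have "\<Lambda> (g k) / e \<le> a (k * e)"
        using S(2)[OF k0(1)] 0 unfolding ge a_def
        by (simp add: emeasure_eq_ennreal_measure less_top[symmetric])
      then show "\<Lambda> (g k) \<le> e * a (k * e)" using e by (simp add: field_simps)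
      from emeasure_riesz_le[OF S(1)[OF k0(2)] gC' g'(1,4)]
      have "a (Suc k * e) \<le> \<Lambda> (g k) / e"
        using S(2)[OF k0(2)] 0 unfolding ge a_def
        by (simp add: emeasure_eq_ennreal_measure less_top[symmetric])
      then show "e * a (Suc k * e) \<le> \<Lambda> (g k)" using e by (simp add: field_simps)
    qed
    have gI: "e * a (Suc k * e) \<le> (\<integral>x. g k x \<partial>?M)" "(\<integral>x. g k x \<partial>?M) \<le> e * a (k * e)" for k
    proof -
      have k0: "0 \<le> k * e" "0 \<le> Suc k * e" using e by auto
      have i: "integrable ?M (\<lambda>x. e * indicator (S t) x)" "(\<integral>x. e * indicator (S t) x \<partial>?M) = e * a t" if "0 \<le> t" for t
        using S[OF that] by (auto simp: a_def sets_riesz)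
      show "e * a (Suc k * e) \<le> (\<integral>x. g k x \<partial>?M)"
        unfolding i(2)[OF k0(2), symmetric]
        by (rule integral_mono[OF i(1)[OF k0(2)] riesz_integrable[OF gC]])
           (use G G1 in \<open>simp add: indicator_def\<close>)
      show "(\<integral>x. g k x \<partial>?M) \<le> e * a (k * e)"
        unfolding i(2)[OF k0(1), symmetric]
        by (rule integral_mono[OF riesz_integrable[OF gC] i(1)[OF k0(1)]])
           (use G G0 in \<open>simp add: indicator_def\<close>)
    qed
    have "\<Lambda> f = (\<Sum>k<m. \<Lambda> (g k))" using L_sum[of "{..<m}" g] gC by (simp add: gsum[symmetric])
    moreover have "(\<integral>x. f x \<partial>?M) = (\<Sum>k<m. \<integral>x. g k x \<partial>?M)"
      unfolding gsum by (rule Bochner_Integration.integral_sum) (rule riesz_integrable[OF gC])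
    ultimately have "\<bar>\<Lambda> f - (\<integral>x. f x \<partial>?M)\<bar> = \<bar>\<Sum>k<m. \<Lambda> (g k) - (\<integral>x. g k x \<partial>?M)\<bar>"
      by (simp add: sum_subtractf)
    \<comment> \<open>Both numbers lie between the same lower and upper sums, whose difference
      telescopes.\<close>
    also have "\<dots> \<le> (\<Sum>k<m. e * (a (k * e) - a (Suc k * e)))"
    proof (rule order.trans[OF sum_abs], rule sum_mono)
      fix k
      show "\<bar>\<Lambda> (g k) - (\<integral>x. g k x \<partial>?M)\<bar> \<le> e * (a (k * e) - a (Suc k * e))"
        using gL[of k] gI[of k] by (simp add: right_diff_distrib abs_le_iff)
    qed
    also have "\<dots> = e * (a 0 - a (m * e))"
      using sum_lessThan_telescope'[of "\<lambda>k. a (k * e)" m] by (simp add: sum_distrib_left[symmetric])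
    also have "\<dots> \<le> e * a 0" using e by (simp add: a_def)
    finally show ?thesis .
  qed
  have "\<bar>\<Lambda> f - (\<integral>x. f x \<partial>?M)\<bar> \<le> 0"
  proof (rule field_le_epsilon)
    fix d :: real assume d: "0 < d"
    have a0: "0 \<le> a 0" by (simp add: a_def)
    have "\<bar>\<Lambda> f - (\<integral>x. f x \<partial>?M)\<bar> \<le> d / (a 0 + 1) * a 0"
      using d a0 by (intro bound) auto
    also have "\<dots> \<le> d" using d a0 by (simp add: field_simps)
    finally show "\<bar>\<Lambda> f - (\<integral>x. f x \<partial>?M)\<bar> \<le> 0 + d" by simp
  qed
  then show ?thesis by simp
qed

lemma riesz_representation_Cc:
  "\<exists>M. sets M = sets borel \<and> (\<forall>C. compact C \<longrightarrow> emeasure M C < \<infinity>) \<and>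
     (\<forall>f. Cc f \<longrightarrow> \<Lambda> f = (\<integral>x. f x \<partial>M))"
proof (intro exI[of _ riesz_measure] conjI allI impI)
  fix f :: "'a \<Rightarrow> real" assume f: "Cc f"
  define p where "p x = max (f x) 0" for x
  define q where "q x = max (- f x) 0" for x
  have fc: "continuous_on UNIV f" using f by (simp add: Cc_def)
  have p: "Cc p" unfolding p_def
    by (rule Cc_subset[OF f]) (intro continuous_intros fc, simp)
  have q: "Cc q" unfolding q_def
    by (rule Cc_subset[OF f]) (intro continuous_intros fc, simp)
  have pq: "f = (\<lambda>x. p x - q x)" by (auto simp: p_def q_def)
  have "\<Lambda> p = (\<integral>x. p x \<partial>riesz_measure)" "\<Lambda> q = (\<integral>x. q x \<partial>riesz_measure)"
    by (rule riesz_nonneg[OF p], simp add: p_def) (rule riesz_nonneg[OF q], simp add: q_def)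
  then show "\<Lambda> f = (\<integral>x. f x \<partial>riesz_measure)"
    by (subst (1 2) pq) (simp add: L_diff p q riesz_integrable)
next
  fix C :: "'a set" assume "compact C"
  then show "emeasure riesz_measure C < \<infinity>"
    by (intro riesz_bounded_finite compact_imp_bounded borel_compact)
qed (rule sets_riesz)

end

section \<open>Integration against Radon measures\<close>

lemma radon_integrable:
  fixes f :: "real^'n::finite \<Rightarrow> real"
  assumes M: "radon_measure M" and f: "Cc f" shows "integrable M f"
proof -
  obtain b where b: "\<And>x. norm (f x) \<le> b" using Cc_bounded[OF f] by metis
  let ?K = "closure {x. f x \<noteq> 0}"
  have s: "sets M = sets borel" using M by (simp add: radon_measure_def)
  show ?thesis
  proof (rule integrableI_bounded_set[where A = ?K and B = b])
    show "?K \<in> sets M" unfolding s by simp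
    show "f \<in> borel_measurable M"
      using f by (subst measurable_cong_sets[OF s refl])
        (simp add: Cc_def borel_measurable_continuous_onI)
    show "emeasure M ?K < \<infinity>"
      using M f by (simp add: radon_measure_def Cc_def compact_closure)
    show "AE x in M. x \<notin> ?K \<longrightarrow> f x = 0"
      using closure_subset[of "{x. f x \<noteq> 0}"] by auto
    show "AE x in M. x \<in> ?K \<longrightarrow> norm (f x) \<le> b" using b by simp
  qed
qed

lemma radon_bounded_finite:
  assumes M: "radon_measure M" and "bounded E" "E \<in> sets borel" shows "emeasure M E < \<infinity>"
proof -
  have "emeasure M E \<le> emeasure M (closure E)"
    using M by (intro emeasure_mono closure_subset) (simp add: radon_measure_def)
  also have "\<dots> < \<infinity>" using M assms(2) by (simp add: radon_measure_def compact_closure)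
  finally show ?thesis .
qed

lemma radon_uniform_limit:
  fixes f :: "real^'n::finite \<Rightarrow> real"
  assumes M: "radon_measure M" and fj: "\<And>j. Cc (fj j)" and f: "Cc f"
    and r: "\<And>j x. fj j x \<noteq> 0 \<Longrightarrow> norm x \<le> r" "\<And>x. f x \<noteq> 0 \<Longrightarrow> norm x \<le> r"
    and lim: "uniform_limit UNIV fj f sequentially"
  shows "(\<lambda>j. \<integral>x. fj j x \<partial>M) \<longlonglongrightarrow> (\<integral>x. f x \<partial>M)"
proof (rule tendstoI)
  fix e :: real assume e: "0 < e"
  let ?B = "cball (0::real^'n) r"
  have s: "sets M = sets borel" using M by (simp add: radon_measure_def)
  have fin: "emeasure M ?B < \<infinity>" using M by (simp add: radon_measure_def)
  define m where "m = measure M ?B"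
  have m: "0 \<le> m" by (simp add: m_def)
  define d where "d = e / (m + 1)"
  have d: "0 < d" "d * m < e" using e m by (simp_all add: d_def field_simps)
  from uniform_limitD[OF lim d(1)]
  show "\<forall>\<^sub>F j in sequentially. dist (\<integral>x. fj j x \<partial>M) (\<integral>x. f x \<partial>M) < e"
  proof eventually_elim
    case (elim j)
    have i: "integrable M (fj j)" "integrable M f" using radon_integrable[OF M] fj f by blast+
    have "(\<integral>x. fj j x \<partial>M) - (\<integral>x. f x \<partial>M) = (\<integral>x. fj j x - f x \<partial>M)" using i by simp
    then have "\<bar>(\<integral>x. fj j x \<partial>M) - (\<integral>x. f x \<partial>M)\<bar> \<le> (\<integral>x. \<bar>fj j x - f x\<bar> \<partial>M)"
      by (metis integral_abs_bound)
    also have "\<dots> \<le> (\<integral>x. d * indicator ?B x \<partial>M)"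
    proof (rule integral_mono)
      show "integrable M (\<lambda>x. \<bar>fj j x - f x\<bar>)" using i by simp
      show "integrable M (\<lambda>x. d * indicator ?B x)" using fin s by simp
      fix x
      have "\<bar>fj j x - f x\<bar> < d" using elim by (simp add: dist_real_def)
      moreover have "fj j x - f x = 0" if "x \<notin> ?B" using that r(1)[of j x] r(2)[of x]
        by (cases "fj j x = 0"; cases "f x = 0") simp_all
      ultimately show "\<bar>fj j x - f x\<bar> \<le> d * indicator ?B x"
        by (cases "x \<in> ?B") simp_all
    qed
    also have "\<dots> = d * m" using fin s by (simp add: m_def)
    finally show ?case using d by (simp add: dist_real_def)
  qed
qed

lemma Cc_conv_moll: "Cc v \<Longrightarrow> test_fun (conv v (moll j))"
  unfolding Cc_def by (intro test_fun_conv test_fun_moll) auto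

lemma radon_moll_limit:
  fixes f :: "real^'n::finite \<Rightarrow> real"
  assumes M: "radon_measure M" and f: "Cc f"
  shows "(\<lambda>j. \<integral>x. conv f (moll j) x \<partial>M) \<longlonglongrightarrow> (\<integral>x. f x \<partial>M)"
proof -
  have f': "continuous_on UNIV f" "bounded {x. f x \<noteq> 0}" using f by (auto simp: Cc_def)
  obtain r where r: "\<And>j x. conv f (moll j) x \<noteq> 0 \<Longrightarrow> norm x \<le> r" "\<And>x. f x \<noteq> 0 \<Longrightarrow> norm x \<le> r"
    by (rule conv_moll_common_support[OF f'(2)]) blast
  show ?thesis
    by (rule radon_uniform_limit[OF M test_fun_Cc[OF Cc_conv_moll[OF f]] f r conv_moll_uniform_limit[OF f']])
qed

section \<open>From test functions to continuous functions\<close>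

context
  fixes \<Lambda> :: "(real^'n::finite \<Rightarrow> real) \<Rightarrow> real"
  assumes pf: "positive_functional test_fun \<Lambda>"
begin

private lemma test_L_add: "test_fun f \<Longrightarrow> test_fun g \<Longrightarrow> \<Lambda> (\<lambda>x. f x + g x) = \<Lambda> f + \<Lambda> g"
  and test_L_cmult: "test_fun f \<Longrightarrow> \<Lambda> (\<lambda>x. c * f x) = c * \<Lambda> f"
  and test_L_nonneg: "test_fun f \<Longrightarrow> (\<And>x. 0 \<le> f x) \<Longrightarrow> 0 \<le> \<Lambda> f"
  using pf by (auto simp: positive_functional_def)

private lemma test_diff: "test_fun f \<Longrightarrow> test_fun g \<Longrightarrow> test_fun (\<lambda>x. f x - g x)"
  using test_fun_add[of f "\<lambda>x. (-1) * g x"] test_fun_mult[OF smooth_const, of g "-1"] by simp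

private lemma test_L_diff: assumes "test_fun f" "test_fun g" shows "\<Lambda> (\<lambda>x. f x - g x) = \<Lambda> f - \<Lambda> g"
  using test_L_add[OF test_diff[OF assms] assms(2)] by simp

text \<open>Positivity forces order zero: \<open>f\<close> lies between - e \<theta> and e \<theta>
  for a cutoff \<theta> equal to 1 on the ball, so C = \<Lambda> \<theta> works.\<close>

private lemma L_bound:
  obtains C where "0 \<le> C"
    "\<And>f e. test_fun f \<Longrightarrow> (\<And>x. f x \<noteq> 0 \<Longrightarrow> norm x \<le> r) \<Longrightarrow> (\<And>x. \<bar>f x\<bar> \<le> e) \<Longrightarrow> \<bar>\<Lambda> f\<bar> \<le> C * e"
proof -
  obtain \<theta> U where \<theta>: "test_fun \<theta>" "\<And>x. 0 \<le> \<theta> x" "\<And>x. \<theta> x \<le> 1" "open U"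
      "cball (0::real^'n) r \<subseteq> U" "\<And>x. x \<in> U \<Longrightarrow> \<theta> x = 1"
    by (rule cutoff_exists[OF bounded_cball]) blast
  have "\<bar>\<Lambda> f\<bar> \<le> \<Lambda> \<theta> * e"
    if f: "test_fun f" "\<And>x. f x \<noteq> 0 \<Longrightarrow> norm x \<le> r" "\<And>x. \<bar>f x\<bar> \<le> e" for f e
  proof -
    have e\<theta>: "test_fun (\<lambda>x. e * \<theta> x)" by (intro test_fun_mult smooth_const \<theta>)
    have e: "0 \<le> e" using f(3)[of 0] by linarith
    have b: "\<bar>f x\<bar> \<le> e * \<theta> x" for x
    proof (cases "f x = 0")
      case True then show ?thesis using e \<theta>(2)[of x] by simp
    next
      case False
      then have "x \<in> U" using f(2) \<theta>(5) by auto
      then show ?thesis using f(3)[of x] by (simp add: \<theta>(6))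
    qed
    have "0 \<le> \<Lambda> (\<lambda>x. e * \<theta> x - f x)"
      by (intro test_L_nonneg test_diff e\<theta> f(1)) (use b in \<open>simp add: abs_le_iff\<close>)
    moreover have "0 \<le> \<Lambda> (\<lambda>x. e * \<theta> x + f x)"
    proof (intro test_L_nonneg test_fun_add e\<theta> f(1))
      fix x show "0 \<le> e * \<theta> x + f x" using b[of x] by linarith
    qed
    ultimately show ?thesis
      by (simp add: test_L_diff test_L_add e\<theta> f(1) test_L_cmult \<theta>(1) abs_le_iff mult.commute)
  qed
  then show ?thesis using that test_L_nonneg[OF \<theta>(1,2)] by blast
qed

private lemma L_limit:
  assumes f: "Cc f"
  shows "convergent (\<lambda>j. \<Lambda> (conv f (moll j)))"
    and "test_fun f \<Longrightarrow> (\<lambda>j. \<Lambda> (conv f (moll j))) \<longlonglongrightarrow> \<Lambda> f"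
proof -
  have f': "continuous_on UNIV f" "bounded {x. f x \<noteq> 0}" using f by (auto simp: Cc_def)
  obtain r where r: "\<And>j x. conv f (moll j) x \<noteq> 0 \<Longrightarrow> norm x \<le> r" "\<And>x. f x \<noteq> 0 \<Longrightarrow> norm x \<le> r"
    by (rule conv_moll_common_support[OF f'(2)]) blast
  obtain C where C: "0 \<le> C" "\<And>f e. test_fun f \<Longrightarrow> (\<And>x. f x \<noteq> 0 \<Longrightarrow> norm x \<le> r) \<Longrightarrow>
      (\<And>x. \<bar>f x\<bar> \<le> e) \<Longrightarrow> \<bar>\<Lambda> f\<bar> \<le> C * e"
    by (rule L_bound[of r]) blast
  note t = Cc_conv_moll[OF f]
  \<comment> \<open>This d satisfies 2 (C (2 d)) + 2 d = e, hence C (2 d) < e, also when C =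
    0.\<close>
  have d: "\<exists>N. \<forall>j\<ge>N. \<forall>x. \<bar>conv f (moll j) x - f x\<bar> \<le> d \<and> C * (2 * d) < e" if e: "0 < e" and "d = e / (4 * C + 2)" for d e
  proof -
    have d0: "0 < d" unfolding that(2) using e C(1) by simp
    have "d * (4 * C + 2) = e" unfolding that(2) using C(1) by simp
    then have "2 * (C * (2 * d)) + 2 * d = e" by (simp add: algebra_simps)
    with d0 e have d1: "C * (2 * d) < e" by linarith
    from uniform_limitD[OF conv_moll_uniform_limit[OF f'] d0] show ?thesis
      unfolding eventually_sequentially using d1 by (auto simp: dist_real_def intro: less_imp_le)
  qed
  have "Cauchy (\<lambda>j. \<Lambda> (conv f (moll j)))"
  proof (rule metric_CauchyI)
    fix e :: real assume e: "0 < e"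
    define d where "d = e / (4 * C + 2)"
    obtain N where N: "\<And>j x. N \<le> j \<Longrightarrow> \<bar>conv f (moll j) x - f x\<bar> \<le> d" "C * (2 * d) < e"
      using d[OF e d_def] by blast
    show "\<exists>N. \<forall>i\<ge>N. \<forall>j\<ge>N. dist (\<Lambda> (conv f (moll i))) (\<Lambda> (conv f (moll j))) < e"
    proof (intro exI[of _ N] allI impI)
      fix i j assume ij: "N \<le> i" "N \<le> j"
      have "\<bar>\<Lambda> (\<lambda>x. conv f (moll i) x - conv f (moll j) x)\<bar> \<le> C * (2 * d)"
      proof (rule C(2)[OF test_diff[OF t t]])
        show "conv f (moll i) x - conv f (moll j) x \<noteq> 0 \<Longrightarrow> norm x \<le> r" for x
          using r(1)[of i x] r(1)[of j x] by (cases "conv f (moll i) x = 0") auto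
        show "\<bar>conv f (moll i) x - conv f (moll j) x\<bar> \<le> 2 * d" for x
          using N(1)[OF ij(1), of x] N(1)[OF ij(2), of x] by linarith
      qed
      then show "dist (\<Lambda> (conv f (moll i))) (\<Lambda> (conv f (moll j))) < e"
        using N(2) by (simp add: dist_real_def test_L_diff t)
    qed
  qed
  then show "convergent (\<lambda>j. \<Lambda> (conv f (moll j)))" by (rule Cauchy_convergent)
  show "(\<lambda>j. \<Lambda> (conv f (moll j))) \<longlonglongrightarrow> \<Lambda> f" if tf: "test_fun f"
  proof (rule metric_LIMSEQ_I)
    fix e :: real assume e: "0 < e"
    define d where "d = e / (4 * C + 2)"
    obtain N where N: "\<And>j x. N \<le> j \<Longrightarrow> \<bar>conv f (moll j) x - f x\<bar> \<le> d" "C * (2 * d) < e"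
      using d[OF e d_def] by blast
    show "\<exists>N. \<forall>i\<ge>N. dist (\<Lambda> (conv f (moll i))) (\<Lambda> f) < e"
    proof (intro exI[of _ N] allI impI)
      fix i assume ij: "N \<le> i"
      have "\<bar>\<Lambda> (\<lambda>x. conv f (moll i) x - f x)\<bar> \<le> C * (2 * d)"
      proof (rule C(2)[OF test_diff[OF t tf]])
        show "conv f (moll i) x - f x \<noteq> 0 \<Longrightarrow> norm x \<le> r" for x
          using r(1)[of i x] r(2)[of x] by (cases "f x = 0") auto
        show "\<bar>conv f (moll i) x - f x\<bar> \<le> 2 * d" for x
          using N(1)[OF ij(1), of x] by linarith
      qed
      then show "dist (\<Lambda> (conv f (moll i))) (\<Lambda> f) < e"
        using N(2) by (simp add: dist_real_def test_L_diff t tf)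
    qed
  qed
qed

private lemma conv_add:
  fixes f g :: "real^'n \<Rightarrow> real"
  assumes "Cc f" "Cc g"
  shows "conv (\<lambda>x. f x + g x) (moll j) = (\<lambda>x. conv f (moll j) x + conv g (moll j) x)"
proof
  fix x
  have "integrable lborel (\<lambda>y. h y * moll j (x - y))" if "Cc h" for h :: "real^'n \<Rightarrow> real"
  proof -
    have "Cc (\<lambda>y. h y * moll j (x - y))"
      using that by (intro Cc_subset[OF that])
        (auto intro!: continuous_intros continuous_on_compose2[OF continuous_moll] simp: Cc_def)
    then show ?thesis by (simp add: Cc_def integrable_continuous_bounded_support)
  qed
  from this[OF assms(1)] this[OF assms(2)]
  show "conv (\<lambda>x. f x + g x) (moll j) x = conv f (moll j) x + conv g (moll j) x"
    by (simp add: conv_def distrib_right)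
qed

private lemma conv_cmult: "conv (\<lambda>x. c * f x) (moll j) = (\<lambda>x. c * conv f (moll j) x)"
  unfolding conv_def mult.assoc by (rule ext, rule Bochner_Integration.integral_mult_right_zero)

text \<open>The functional extends to continuous functions as the limit of its values on
  mollifications, which form a Cauchy sequence by order zero. The extension is positive and agrees
  with \<Lambda> on test functions, so its measure represents \<Lambda>.\<close>

theorem riesz_representation:
  "\<exists>M. radon_measure M \<and> (\<forall>f. test_fun f \<longrightarrow> \<Lambda> f = (\<integral>x. f x \<partial>M))"
proof -
  define L where "L f = lim (\<lambda>j. \<Lambda> (conv f (moll j)))" for f
  have L: "(\<lambda>j. \<Lambda> (conv f (moll j))) \<longlonglongrightarrow> L f" if "Cc f" for f
    using L_limit(1)[OF that] by (simp add: L_def convergent_LIMSEQ_iff)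
  have "positive_functional Cc L"
    unfolding positive_functional_def
  proof (intro conjI allI impI)
    fix f g :: "real^'n \<Rightarrow> real" assume fg: "Cc f" "Cc g"
    have "(\<lambda>j. \<Lambda> (conv (\<lambda>x. f x + g x) (moll j))) \<longlonglongrightarrow> L f + L g"
      unfolding conv_add[OF fg] test_L_add[OF Cc_conv_moll[OF fg(1)] Cc_conv_moll[OF fg(2)]]
      by (intro tendsto_add L fg)
    from LIMSEQ_unique[OF L[OF Cc_add[OF fg]] this] show "L (\<lambda>x. f x + g x) = L f + L g" .
  next
    fix c and f :: "real^'n \<Rightarrow> real" assume f: "Cc f"
    have cf: "Cc (\<lambda>x. c * f x)" by (intro Cc_mult f continuous_intros)
    have "(\<lambda>j. \<Lambda> (conv (\<lambda>x. c * f x) (moll j))) \<longlonglongrightarrow> c * L f"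
      unfolding conv_cmult test_L_cmult[OF Cc_conv_moll[OF f]] by (intro tendsto_mult_left L f)
    from LIMSEQ_unique[OF L[OF cf] this] show "L (\<lambda>x. c * f x) = c * L f" .
  next
    fix f :: "real^'n \<Rightarrow> real" assume f: "Cc f" "\<forall>x. 0 \<le> f x"
    have "0 \<le> \<Lambda> (conv f (moll j))" for j
      by (intro test_L_nonneg Cc_conv_moll f conv_nonneg moll_nonneg) (use f in blast)
    then show "0 \<le> L f" by (intro LIMSEQ_le_const[OF L[OF f(1)]]) blast
  qed
  from riesz_representation_Cc[OF this] obtain M where
    M: "sets M = sets borel" "\<And>C. compact C \<Longrightarrow> emeasure M C < \<infinity>"
      "\<And>f. Cc f \<Longrightarrow> L f = (\<integral>x. f x \<partial>M)" by blast
  have "\<Lambda> f = (\<integral>x. f x \<partial>M)" if t: "test_fun f" for f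
    using LIMSEQ_unique[OF L_limit(2)[OF test_fun_Cc[OF t] t] L[OF test_fun_Cc[OF t]]]
      M(3)[OF test_fun_Cc[OF t]] by simp
  then show ?thesis using M(1,2) unfolding radon_measure_def by blast
qed

end

section \<open>Exterior algebra\<close>

text \<open>Forms at a point become vectors indexed by pairs of index sets. This makes the exterior
  algebra a Euclidean space, where spans, linear maps and uniform limits are available.\<close>

type_synonym 'n ext = "real^('n set \<times> 'n set)"

definition form_at :: "'n::finite form \<Rightarrow> real^'n \<Rightarrow> 'n ext" where
  "form_at \<alpha> x = (\<chi> KL. \<alpha> (fst KL) (snd KL) x)"

definition to_form :: "(real^'n::finite \<Rightarrow> 'n ext) \<Rightarrow> 'n form" where
  "to_form F K L = (\<lambda>x. F x $ (K, L))"

text \<open>Multiplication by the (1,1)-element whose coefficient at dx_i \<and> d\<xi>_j is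
  \<open>m $ i $ j\<close>. Every product needed has such a factor, so commutation and nilpotency of
  these operators replace the general laws of the wedge product.\<close>

definition lmul :: "real^'n::{finite,linorder}^'n::{finite,linorder} \<Rightarrow> 'n::{finite,linorder} ext \<Rightarrow> 'n ext" where
  "lmul m c = (\<chi> KL. \<Sum>i\<in>fst KL. \<Sum>j\<in>snd KL.
     super_sign {i} {j} (fst KL - {i}) (snd KL - {j}) * m $ i $ j * c $ (fst KL - {i}, snd KL - {j}))"

definition one_ext :: "'n::finite ext" where
  "one_ext = (\<chi> KL. if KL = ({}, {}) then 1 else 0)"

definition pw :: "real^'n::{finite,linorder}^'n::{finite,linorder} \<Rightarrow> nat \<Rightarrow> 'n::{finite,linorder} ext" where
  "pw m q = (lmul m ^^ q) one_ext"

definition rank1 :: "real^'n \<Rightarrow> real^'n^'n" where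
  "rank1 v = (\<chi> i j. v $ i * v $ j)"

definition mat_of :: "'n::finite form \<Rightarrow> real^'n \<Rightarrow> real^'n^'n" where
  "mat_of \<omega> x = (\<chi> i j. \<omega> {i} {j} x)"

lemma pw_0: "pw m 0 = one_ext" and pw_Suc: "pw m (Suc q) = lmul m (pw m q)"
  by (simp_all add: pw_def)

lemma bilinear_lmul: "bilinear lmul"
  unfolding bilinear_def linear_iff lmul_def
  by (simp add: vec_eq_iff sum.distrib algebra_simps sum_distrib_left)

lemma bounded_bilinear_lmul: "bounded_bilinear lmul"
  using bilinear_lmul by (simp add: bilinear_conv_bounded_bilinear)

interpretation lmul: bounded_bilinear lmul by (rule bounded_bilinear_lmul)

lemma sum_Pow_singletons:
  fixes g :: "'a::finite set \<Rightarrow> 'b::comm_monoid_add"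
  assumes "\<And>A. A \<subseteq> K \<Longrightarrow> card A \<noteq> 1 \<Longrightarrow> g A = 0"
  shows "(\<Sum>A\<in>Pow K. g A) = (\<Sum>i\<in>K. g {i})"
proof -
  have "(\<Sum>A\<in>Pow K. g A) = (\<Sum>A\<in>(\<lambda>i. {i}) ` K. g A)"
  proof (rule sum.mono_neutral_right)
    show "\<forall>A\<in>Pow K - (\<lambda>i. {i}) ` K. g A = 0"
    proof
      fix A assume A: "A \<in> Pow K - (\<lambda>i. {i}) ` K"
      have "card A \<noteq> 1"
      proof
        assume "card A = 1"
        then obtain i where "A = {i}" by (auto simp: card_1_singleton_iff)
        with A show False by auto
      qed
      with A assms show "g A = 0" by auto
    qed
  qed auto
  also have "\<dots> = (\<Sum>i\<in>K. g {i})" by (subst sum.reindex) (auto simp: inj_on_def)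
  finally show ?thesis .
qed

lemma form_at_wedge:
  fixes \<omega> \<beta> :: "'n::{finite,linorder} form"
  assumes "bidegree_form 1 1 \<omega>"
  shows "form_at (wedge \<omega> \<beta>) x = lmul (mat_of \<omega> x) (form_at \<beta> x)"
proof -
  have z: "\<omega> A B = (\<lambda>_. 0)" if "card A \<noteq> 1 \<or> card B \<noteq> 1" for A B
    using assms that unfolding bidegree_form_def by blast
  have "wedge \<omega> \<beta> K L x = (\<Sum>i\<in>K. \<Sum>j\<in>L. super_sign {i} {j} (K - {i}) (L - {j}) * \<omega> {i} {j} x * \<beta> (K - {i}) (L - {j}) x)"
    for K L
    unfolding wedge_def
    by (subst sum_Pow_singletons, simp add: z, rule sum.cong[OF refl], subst sum_Pow_singletons)
       (simp_all add: z)
  then show ?thesis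
    by (simp add: form_at_def lmul_def mat_of_def vec_eq_iff)
qed

lemma form_at_zero_form_1: "form_at (zero_form (\<lambda>_. 1)) x = one_ext"
  by (simp add: form_at_def zero_form_def one_ext_def vec_eq_iff prod_eq_iff)

lemma form_at_wedge_pow:
  assumes "bidegree_form 1 1 \<omega>"
  shows "form_at (wedge_pow \<omega> q) x = pw (mat_of \<omega> x) q"
  by (induction q) (simp_all add: pw_0 pw_Suc form_at_zero_form_1 form_at_wedge[OF assms])

section \<open>Signs, and the laws of multiplication by (1,1)-elements\<close>

lemma shuffle_sign_Un:
  fixes A :: "'n::{finite,linorder} set"
  assumes "B \<inter> C = {}"
  shows "shuffle_sign A (B \<union> C) = shuffle_sign A B * shuffle_sign A C"
    and "shuffle_sign (B \<union> C) A = shuffle_sign B A * shuffle_sign C A"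
proof -
  have "{(a, b). a \<in> A \<and> b \<in> B \<union> C \<and> b < a} =
      {(a, b). a \<in> A \<and> b \<in> B \<and> b < a} \<union> {(a, b). a \<in> A \<and> b \<in> C \<and> b < a}" by auto
  moreover have "{(a, b). a \<in> A \<and> b \<in> B \<and> b < a} \<inter> {(a, b). a \<in> A \<and> b \<in> C \<and> b < a} = {}"
    using assms by auto
  ultimately show "shuffle_sign A (B \<union> C) = shuffle_sign A B * shuffle_sign A C"
    unfolding shuffle_sign_def by (simp add: card_Un_disjoint power_add)
  have "{(a, b). a \<in> B \<union> C \<and> b \<in> A \<and> b < a} =
      {(a, b). a \<in> B \<and> b \<in> A \<and> b < a} \<union> {(a, b). a \<in> C \<and> b \<in> A \<and> b < a}" by auto
  moreover have "{(a, b). a \<in> B \<and> b \<in> A \<and> b < a} \<inter> {(a, b). a \<in> C \<and> b \<in> A \<and> b < a} = {}"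
    using assms by auto
  ultimately show "shuffle_sign (B \<union> C) A = shuffle_sign B A * shuffle_sign C A"
    unfolding shuffle_sign_def by (simp add: card_Un_disjoint power_add)
qed

lemma shuffle_sign_square: "shuffle_sign A B * shuffle_sign A B = 1"
  by (simp add: shuffle_sign_def power_mult_distrib[symmetric])

text \<open>Each pair with one entry in \<open>A\<close> and one in \<open>B\<close> is an inversion
  in exactly one of the two orders, so the two counts add up to card A * card B.\<close>

lemma shuffle_sign_swap:
  fixes A :: "'n::{finite,linorder} set"
  assumes "A \<inter> B = {}"
  shows "shuffle_sign A B = (-1) ^ (card A * card B) * shuffle_sign B A"
proof -
  let ?P = "{(a, b). a \<in> A \<and> b \<in> B \<and> b < a}" and ?Q = "{(b, a). b \<in> B \<and> a \<in> A \<and> a < b}"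
  have "card (A \<times> B) = card (?P \<union> prod.swap ` ?Q)"
    using assms by (intro arg_cong[of _ _ card]) (auto simp: image_iff)
  also have "\<dots> = card ?P + card (prod.swap ` ?Q)"
    by (rule card_Un_disjoint) auto
  also have "card (prod.swap ` ?Q) = card ?Q" by (rule card_image) (simp add: inj_on_def)
  finally have "card A * card B = card ?P + card ?Q" by (simp add: card_cartesian_product)
  then have "(-1) ^ (card A * card B) * shuffle_sign B A
      = (-1) ^ card ?P * ((-1) ^ card ?Q * (-1) ^ card ?Q :: real)"
    by (simp add: shuffle_sign_def power_add mult.assoc)
  also have "(-1) ^ card ?Q * (-1) ^ card ?Q = (1::real)" by (simp add: power_mult_distrib[symmetric])
  finally show ?thesis by (simp add: shuffle_sign_def)
qed

lemma shuffle_sign_empty [simp]: "shuffle_sign {} A = 1" "shuffle_sign A {} = 1"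
  by (simp_all add: shuffle_sign_def)

text \<open>For distinct i and j in K this is the sign in dx_i \<and> dx_j \<and> dx_(K - {i, j}) =
  tau K i j dx_K.\<close>

definition tau :: "'n::{finite,linorder} set \<Rightarrow> 'n \<Rightarrow> 'n \<Rightarrow> real" where
  "tau K i j = shuffle_sign {i} (K - {i}) * shuffle_sign {j} (K - {i, j})"

lemma tau_antisym:
  assumes "i \<in> K" "j \<in> K" "i \<noteq> j" shows "tau K j i = - tau K i j"
proof -
  have eq: "K - {i} = {j} \<union> (K - {i, j})" "K - {j} = {i} \<union> (K - {i, j})" using assms by auto
  have "shuffle_sign {i} (K - {i}) = shuffle_sign {i} {j} * shuffle_sign {i} (K - {i, j})"
    by (subst eq(1), rule shuffle_sign_Un(1)) simp
  moreover have "shuffle_sign {j} (K - {j}) = shuffle_sign {j} {i} * shuffle_sign {j} (K - {i, j})"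
    by (subst eq(2), rule shuffle_sign_Un(1)) simp
  moreover have "shuffle_sign {i} {j} = - shuffle_sign {j} {i}"
    using shuffle_sign_swap[of "{i}" "{j}"] assms(3) by simp
  ultimately show ?thesis by (simp add: tau_def insert_commute)
qed

text \<open>The signs of the x and the \<xi> variables separate into two factors \<open>tau\<close>;
  the remaining -1 is the cost of moving dx_i' past d\<xi>_j. This form exposes the antisymmetry
  behind commutation and nilpotency.\<close>

lemma lmul_lmul:
  "lmul m (lmul m' c) $ (K, L) = (\<Sum>i\<in>K. \<Sum>j\<in>L. \<Sum>i'\<in>K. \<Sum>j'\<in>L.
     of_bool (i \<noteq> i' \<and> j \<noteq> j') * (- tau K i i' * tau L j j') * (m $ i $ j * m' $ i' $ j')
       * c $ (K - {i, i'}, L - {j, j'}))"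
  (is "_ = (\<Sum>i\<in>K. \<Sum>j\<in>L. ?R i j)")
proof -
  have "super_sign {i} {j} (K - {i}) (L - {j}) * m $ i $ j * lmul m' c $ (K - {i}, L - {j}) = ?R i j"
    if ij: "i \<in> K" "j \<in> L" for i j
  proof -
    have *: "super_sign {i} {j} (K - {i}) (L - {j}) * m $ i $ j *
       (super_sign {i'} {j'} (K - {i} - {i'}) (L - {j} - {j'}) * m' $ i' $ j' * c $ (K - {i} - {i'}, L - {j} - {j'}))
       = (- tau K i i' * tau L j j') * (m $ i $ j * m' $ i' $ j') * c $ (K - {i, i'}, L - {j, j'})"
      if "i' \<in> K" "i \<noteq> i'" for i' j'
    proof -
      have "K - {i} - {i'} = K - {i, i'}" "L - {j} - {j'} = L - {j, j'}" by auto
      moreover have "card (K - {i}) = Suc (card (K - {i, i'}))"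
        using card_Suc_Diff1[of "K - {i}" i'] that by (simp add: \<open>K - {i} - {i'} = K - {i, i'}\<close>)
      moreover have "(-1) ^ k * (-1) ^ k = (1::real)" for k by (simp add: power_mult_distrib[symmetric])
      ultimately show ?thesis
        by (simp add: super_sign_def tau_def mult_ac)
    qed
    have "super_sign {i} {j} (K - {i}) (L - {j}) * m $ i $ j * lmul m' c $ (K - {i}, L - {j})
      = (\<Sum>i'\<in>K - {i}. \<Sum>j'\<in>L - {j}. (- tau K i i' * tau L j j') * (m $ i $ j * m' $ i' $ j') * c $ (K - {i, i'}, L - {j, j'}))"
      unfolding lmul_def[of m' c] by (simp add: sum_distrib_left) (intro sum.cong refl, use * in auto)
    also have "\<dots> = ?R i j"
      by (intro sum.mono_neutral_cong_left) (auto intro!: sum.mono_neutral_cong_left sum.neutral)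
    finally show ?thesis .
  qed
  then show ?thesis by (simp add: lmul_def[of m "lmul m' c"])
qed

text \<open>Exchanging the pairs (i, j) and (i', j') changes the sign of both factors
  \<open>tau\<close>, so their product is unchanged.\<close>

lemma lmul_commute: "lmul m (lmul m' c) = lmul m' (lmul m c)"
proof -
  have "lmul m (lmul m' c) $ (K, L) = lmul m' (lmul m c) $ (K, L)" for K L
  proof -
    define P where "P i j i' j' = of_bool (i \<noteq> i' \<and> j \<noteq> j') * (- tau K i i' * tau L j j') * (m $ i $ j * m' $ i' $ j')
       * c $ (K - {i, i'}, L - {j, j'})" for i j i' j'
    have cart: "(\<Sum>i\<in>K. \<Sum>j\<in>L. F i j) = (\<Sum>p\<in>K \<times> L. F (fst p) (snd p))" for F :: "'a \<Rightarrow> 'a \<Rightarrow> real"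
      by (simp add: sum.cartesian_product case_prod_beta)
    have "(\<Sum>i\<in>K. \<Sum>j\<in>L. \<Sum>i'\<in>K. \<Sum>j'\<in>L. P i j i' j') = (\<Sum>i'\<in>K. \<Sum>j'\<in>L. \<Sum>i\<in>K. \<Sum>j\<in>L. P i j i' j')"
      unfolding cart by (rule sum.swap)
    also have "\<dots> = lmul m' (lmul m c) $ (K, L)"
      unfolding lmul_lmul
    proof (intro sum.cong refl)
      fix i' j' i j assume "i' \<in> K" "j' \<in> L" "i \<in> K" "j \<in> L"
      then show "P i j i' j' = of_bool (i' \<noteq> i \<and> j' \<noteq> j) * (- tau K i' i * tau L j' j)
          * (m' $ i' $ j' * m $ i $ j) * c $ (K - {i', i}, L - {j', j})"
        using tau_antisym[of i K i'] tau_antisym[of j L j'] by (auto simp: P_def insert_commute mult_ac)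
    qed
    finally show ?thesis unfolding lmul_lmul P_def .
  qed
  then show ?thesis by (simp add: vec_eq_iff)
qed

text \<open>Exchanging only i and i' changes the sign of one \<open>tau\<close>, while the
  coefficient v_i v_j v_i' v_j' stays the same; the sum equals its own negative.\<close>

lemma lmul_rank1_square: "lmul (rank1 v) (lmul (rank1 v) c) = 0"
proof -
  have "lmul (rank1 v) (lmul (rank1 v) c) $ (K, L) = 0" for K L
  proof -
    define P where "P i j i' j' = of_bool (i \<noteq> i' \<and> j \<noteq> j') * (- tau K i i' * tau L j j') * (rank1 v $ i $ j * rank1 v $ i' $ j')
       * c $ (K - {i, i'}, L - {j, j'})" for i j i' j'
    have eq: "lmul (rank1 v) (lmul (rank1 v) c) $ (K, L) = (\<Sum>i\<in>K. \<Sum>i'\<in>K. \<Sum>j\<in>L. \<Sum>j'\<in>L. P i j i' j')"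
      unfolding lmul_lmul P_def by (rule sum.cong[OF refl], rule sum.swap)
    have "(\<Sum>i\<in>K. \<Sum>i'\<in>K. \<Sum>j\<in>L. \<Sum>j'\<in>L. P i j i' j') = (\<Sum>i'\<in>K. \<Sum>i\<in>K. \<Sum>j\<in>L. \<Sum>j'\<in>L. P i j i' j')"
      by (rule sum.swap)
    also have "\<dots> = (\<Sum>i'\<in>K. \<Sum>i\<in>K. \<Sum>j\<in>L. \<Sum>j'\<in>L. - P i' j i j')"
    proof (intro sum.cong refl)
      fix i' j' i j assume "i' \<in> K" "j' \<in> L" "i \<in> K" "j \<in> L"
      then show "P i j i' j' = - P i' j i j'"
        using tau_antisym[of i K i'] by (auto simp: P_def rank1_def insert_commute mult_ac)
    qed
    also have "\<dots> = - (\<Sum>i\<in>K. \<Sum>i'\<in>K. \<Sum>j\<in>L. \<Sum>j'\<in>L. P i j i' j')" by (simp add: sum_negf)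
    finally show ?thesis unfolding eq by simp
  qed
  then show ?thesis by (simp add: vec_eq_iff)
qed

text \<open>The binomial expansion stops at the linear term because rank one elements square to
  zero.\<close>

lemma pw_add_rank1:
  "pw (m + rank1 v) q = pw m q + real q *\<^sub>R lmul (rank1 v) (pw m (q - 1))"
proof (induction q)
  case (Suc q)
  show ?case
  proof (cases q)
    case 0 then show ?thesis by (simp add: pw_0 pw_Suc lmul.add_left)
  next
    case (Suc k)
    have "pw (m + rank1 v) (Suc q) = lmul m (pw m q) + lmul (rank1 v) (pw m q)
       + real q *\<^sub>R (lmul m (lmul (rank1 v) (pw m (q - 1))) + lmul (rank1 v) (lmul (rank1 v) (pw m (q - 1))))"
      unfolding pw_Suc Suc.IH by (simp add: lmul.add_left lmul.add_right lmul.scaleR_right scaleR_add_right)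
    also have "lmul m (lmul (rank1 v) (pw m (q - 1))) = lmul (rank1 v) (pw m q)"
      using Suc by (simp add: lmul_commute[of m] pw_Suc)
    finally show ?thesis
      by (simp add: lmul_rank1_square pw_Suc scaleR_left_distrib)
  qed
qed (simp add: pw_0)

lemma pw_scaleR: "pw (c *\<^sub>R m) q = c ^ q *\<^sub>R pw m q"
  by (induction q) (simp_all add: pw_0 pw_Suc lmul.scaleR_left lmul.scaleR_right)

text \<open>The same expansion read backwards. It is meant for the matrix m of
  \<open>2 \<phi> \<omega> - d\<phi> \<and> d\<^sup>#\<phi>\<close>, for which m + rank1 v is a
  multiple of the Hessian of \<phi>.\<close>

lemma pw_add_rank1_diff:
  assumes "1 \<le> q"
  shows "pw m q = pw (m + rank1 v) q - real q *\<^sub>R lmul (rank1 v) (pw (m + rank1 v) (q - 1))"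
  unfolding pw_add_rank1 lmul.add_right lmul.scaleR_right lmul_rank1_square by simp

subsection \<open>The cone of strongly positive elements\<close>

primrec sp :: "(nat \<Rightarrow> real^'n::{finite,linorder}) \<Rightarrow> nat \<Rightarrow> 'n::{finite,linorder} ext" where
  "sp a 0 = one_ext"
| "sp a (Suc k) = lmul (rank1 (a k)) (sp a k)"

lemma sp_cong: "(\<And>i. i < k \<Longrightarrow> a i = b i) \<Longrightarrow> sp a k = sp b k"
  by (induction k) simp_all

inductive_set spcone :: "nat \<Rightarrow> 'n::{finite,linorder} ext set" for k where
  spcone_zero: "0 \<in> spcone k"
| spcone_add: "c \<in> spcone k \<Longrightarrow> 0 \<le> t \<Longrightarrow> c + t *\<^sub>R sp a k \<in> spcone k"

lemma spcone_plus: "d \<in> spcone k \<Longrightarrow> c \<in> spcone k \<Longrightarrow> c + d \<in> spcone k"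
  by (induction rule: spcone.induct) (auto simp: add.assoc[symmetric] intro: spcone.intros)

lemma spcone_scaleR: "c \<in> spcone k \<Longrightarrow> 0 \<le> t \<Longrightarrow> t *\<^sub>R c \<in> spcone k"
  by (induction rule: spcone.induct) (auto simp: scaleR_add_right intro: spcone.intros)

lemma one_in_spcone: "one_ext \<in> spcone 0"
  using spcone_add[OF spcone_zero, of 1 _ 0] by simp

lemma lmul_rank1_spcone: "c \<in> spcone k \<Longrightarrow> lmul (rank1 v) c \<in> spcone (Suc k)"
proof (induction rule: spcone.induct)
  case (spcone_add c t a)
  have "sp a k = sp (a(k := v)) k" by (rule sp_cong) simp
  then have "lmul (rank1 v) (sp a k) = sp (a(k := v)) (Suc k)" by simp
  with spcone.spcone_add[OF spcone_add.IH spcone_add.hyps(2), of "a(k := v)"]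
  show ?case by (simp only: lmul.add_right lmul.scaleR_right)
qed (simp add: lmul.zero_right spcone_zero)

definition psd :: "real^'n^'n \<Rightarrow> bool" where
  "psd m \<longleftrightarrow> (\<forall>i j. m $ i $ j = m $ j $ i) \<and> (\<forall>v. 0 \<le> v \<bullet> (m *v v))"

lemma inner_matrix_sym:
  fixes m :: "real^'n^'n"
  assumes "\<And>i j. m $ i $ j = m $ j $ i" shows "x \<bullet> (m *v y) = y \<bullet> (m *v x)"
proof -
  have "x \<bullet> (m *v y) = (\<Sum>i\<in>UNIV. \<Sum>j\<in>UNIV. x $ i * (m $ i $ j * y $ j))"
    by (simp add: inner_vec_def matrix_vector_mult_def sum_distrib_left)
  also have "\<dots> = (\<Sum>j\<in>UNIV. \<Sum>i\<in>UNIV. x $ i * (m $ i $ j * y $ j))" by (rule sum.swap)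
  also have "\<dots> = (\<Sum>j\<in>UNIV. \<Sum>i\<in>UNIV. y $ j * (m $ j $ i * x $ i))"
    by (intro sum.cong refl) (simp add: assms[of _ j for j] mult_ac)
  also have "\<dots> = y \<bullet> (m *v x)"
    by (simp add: inner_vec_def matrix_vector_mult_def sum_distrib_left)
  finally show ?thesis .
qed

lemma inner_matrix_axis:
  fixes m :: "real^'n^'n"
  shows "axis i 1 \<bullet> (m *v x) = m $ i \<bullet> x" "axis i 1 \<bullet> (m *v axis j 1) = m $ i $ j"
  by (simp_all add: inner_axis' matrix_vector_mul_component inner_axis)

lemma psd_diag:
  fixes m :: "real^'n^'n"
  assumes "psd m" shows "0 \<le> m $ i $ i" "m $ i $ i = 0 \<Longrightarrow> m $ i $ j = 0"
proof -
  have sym: "m $ i $ j = m $ j $ i" for i j using assms by (simp add: psd_def)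
  have q: "0 \<le> v \<bullet> (m *v v)" for v using assms by (simp add: psd_def)
  show "0 \<le> m $ i $ i" using q[of "axis i 1"] by (simp only: inner_matrix_axis(2))
  assume 0: "m $ i $ i = 0"
  have val: "(s *\<^sub>R axis i 1 + axis j 1) \<bullet> (m *v (s *\<^sub>R axis i 1 + axis j 1)) = m $ j $ j + 2 * s * m $ i $ j" for s
    by (simp add: matrix_vector_right_distrib matrix_vector_mult_scaleR inner_add_left inner_add_right
        inner_matrix_axis inner_axis 0 sym[of j i])
  show "m $ i $ j = 0"
  proof (rule ccontr)
    assume n: "m $ i $ j \<noteq> 0"
    have "0 \<le> m $ j $ j + 2 * s * m $ i $ j" for s using q[of "s *\<^sub>R axis i 1 + axis j 1"] unfolding val .
    \<comment> \<open>This s gives the affine function of s the value -1.\<close>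
    from this[of "- (m $ j $ j + 1) / (2 * m $ i $ j)"] n show False by (simp add: field_simps)
  qed
qed

lemma rank1_mult_vec: "rank1 v *v w = (v \<bullet> w) *\<^sub>R v"
  by (simp add: vec_eq_iff rank1_def matrix_vector_mult_def inner_vec_def sum_distrib_left mult_ac)

text \<open>Symmetric elimination: for a positive diagonal entry d' of row i, subtracting the rank
  one matrix of that row divided by sqrt d' leaves a positive semidefinite matrix. Its row i
  vanishes and zero rows stay zero, so the number of nonzero rows drops.\<close>

lemma psd_rank1_sum:
  fixes m :: "real^'n^'n"
  assumes "psd m" shows "\<exists>V::(real^'n) list. m = (\<Sum>v\<leftarrow>V. rank1 v)"
  using assms
proof (induction "card {i. m $ i \<noteq> 0}" arbitrary: m rule: less_induct)
  case less
  have sym: "m $ i $ j = m $ j $ i" for i j using less.prems by (simp add: psd_def)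
  show ?case
  proof (cases "m = 0")
    case True then show ?thesis by (intro exI[of _ "[]"]) simp
  next
    case False
    then obtain i where i: "m $ i \<noteq> 0" by (auto simp: vec_eq_iff)
    then obtain j where "m $ i $ j \<noteq> 0" by (auto simp: vec_eq_iff)
    with psd_diag[OF less.prems, of i] have d: "0 < m $ i $ i" by (metis less_eq_real_def)
    define d' where "d' = m $ i $ i"
    have d': "0 < d'" using d by (simp add: d'_def)
    define v where "v = (1 / sqrt d') *\<^sub>R m $ i"
    define m' where "m' = m - rank1 v"
    have vv: "v $ k * v $ l = m $ i $ k * m $ i $ l / d'" for k l
      using d' by (simp add: v_def)
    have m': "m' $ k $ l = m $ k $ l - m $ i $ k * m $ i $ l / d'" for k l
      by (simp add: m'_def rank1_def vv)
    have "psd m'"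
      unfolding psd_def
    proof (intro conjI allI)
      show "m' $ k $ l = m' $ l $ k" for k l by (simp add: m' sym mult.commute)
      fix w :: "real^'n"
      define t where "t = m $ i \<bullet> w"
      \<comment> \<open>Completing the square: u minimizes the form of m along w + span of axis i,
        and the minimum is the form of m' at w.\<close>
      define u where "u = w - (t / d') *\<^sub>R axis i 1"
      have "0 \<le> u \<bullet> (m *v u)" using less.prems by (simp add: psd_def)
      also have "u \<bullet> (m *v u) = w \<bullet> (m *v w) - t * t / d'"
        using d' inner_matrix_sym[OF sym, of w "axis i 1"]
        by (simp add: u_def matrix_vector_mult_diff_distrib matrix_vector_mult_scaleR inner_diff_left
          inner_diff_right inner_matrix_axis inner_axis t_def[symmetric] d'_def[symmetric])
      also have "t * t / d' = (v \<bullet> w) * (v \<bullet> w)"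
        using d' by (simp add: v_def t_def)
      also have "w \<bullet> (m *v w) - (v \<bullet> w) * (v \<bullet> w) = w \<bullet> (m' *v w)"
        by (simp add: m'_def matrix_vector_mult_diff_rdistrib rank1_mult_vec inner_diff_right inner_commute)
      finally show "0 \<le> w \<bullet> (m' *v w)" .
    qed
    moreover have "card {k. m' $ k \<noteq> 0} < card {k. m $ k \<noteq> 0}"
    proof (rule psubset_card_mono)
      have "m' $ k = 0" if "m $ k = 0" for k
        using that sym[of i k] by (simp add: vec_eq_iff m')
      moreover have "m' $ i = 0" using d' by (simp add: vec_eq_iff m' d'_def)
      ultimately show "{k. m' $ k \<noteq> 0} \<subset> {k. m $ k \<noteq> 0}" using i by auto
    qed simp
    ultimately obtain V where "m' = (\<Sum>v\<leftarrow>V. rank1 v)" using less.hyps by blast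
    then show ?thesis by (intro exI[of _ "v # V"]) (simp add: m'_def algebra_simps)
  qed
qed

lemma lmul_psd_spcone:
  assumes "psd m" "c \<in> spcone k" shows "lmul m c \<in> spcone (Suc k)"
proof -
  obtain V where V: "m = (\<Sum>v\<leftarrow>V. rank1 v)" using psd_rank1_sum[OF assms(1)] by blast
  have "lmul (\<Sum>v\<leftarrow>V. rank1 v) c \<in> spcone (Suc k)"
    by (induction V) (auto simp: lmul.zero_left lmul.add_left spcone_zero intro!: spcone_plus lmul_rank1_spcone assms(2))
  then show ?thesis by (simp add: V)
qed

lemma pw_spcone: "psd m \<Longrightarrow> pw m q \<in> spcone q"
  by (induction q) (simp_all add: pw_0 pw_Suc one_in_spcone lmul_psd_spcone)

lemma spcone_span: "c \<in> spcone k \<Longrightarrow> c \<in> span (range (\<lambda>a. sp a k))"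
proof (induction rule: spcone.induct)
  case (spcone_add c t a)
  show ?case by (rule span_add[OF spcone_add.IH span_scale[OF span_base[OF rangeI]]])
qed (rule span_zero)

text \<open>Polarization writes a symmetric matrix as a combination of \<open>rank1\<close> matrices
  with arbitrary signs. The smooth approximations of \<omega> need not be positive, so stability of
  the span, not only of the cone, is required.\<close>

lemma lmul_sym_span:
  fixes m :: "real^'n::{finite,linorder}^'n::{finite,linorder}"
  assumes sym: "\<And>i j. m $ i $ j = m $ j $ i" and c: "c \<in> span (range (\<lambda>a. sp a k))"
  shows "lmul m c \<in> span (range (\<lambda>a. sp a (Suc k)))"
proof -
  have r: "lmul (rank1 v) c \<in> span (range (\<lambda>a. sp a (Suc k)))" for v
    using c
  proof (rule span_induct_alt)
    fix t and x y :: "'n ext" assume x: "x \<in> range (\<lambda>a. sp a k)" and y: "lmul (rank1 v) y \<in> span (range (\<lambda>a. sp a (Suc k)))"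
    from x obtain a where "x = sp a k" by blast
    then have "x \<in> spcone k" using spcone_add[OF spcone_zero, of 1 a k] by simp
    from spcone_span[OF lmul_rank1_spcone[OF this, of v]] y
    show "lmul (rank1 v) (t *\<^sub>R x + y) \<in> span (range (\<lambda>a. sp a (Suc k)))"
      by (simp add: lmul.add_right lmul.scaleR_right span_add span_scale)
  qed (simp add: lmul.zero_right span_zero)
  have "m = (\<Sum>i\<in>UNIV. \<Sum>j\<in>UNIV. (m $ i $ j / 2) *\<^sub>R (rank1 (axis i 1 + axis j 1) - rank1 (axis i 1) - rank1 (axis j 1)))"
  proof -
    have delta: "(\<Sum>j\<in>UNIV. f j * of_bool (l = j)) = f l" for f :: "'n \<Rightarrow> real" and l
      using sum.mono_neutral_right[of UNIV "{l}" "\<lambda>j. f j * of_bool (l = j)"] by simp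
    have D: "(rank1 (axis i 1 + axis j 1) - rank1 (axis i 1) - rank1 (axis j 1)) $ k $ l
      = of_bool (k = i) * of_bool (l = j) + of_bool (l = i) * (of_bool (k = j) :: real)" for i j k l :: 'n
      by (simp add: rank1_def axis_def)
    have "(\<Sum>i\<in>UNIV. \<Sum>j\<in>UNIV. m $ i $ j / 2 * (of_bool (k = i) * of_bool (l = j) + of_bool (l = i) * of_bool (k = j)))
        = m $ k $ l" for k l
    proof -
      have "(\<Sum>j\<in>UNIV. m $ i $ j / 2 * (of_bool (k = i) * of_bool (l = j) + of_bool (l = i) * of_bool (k = j)))
        = m $ i $ l / 2 * of_bool (k = i) + m $ i $ k / 2 * of_bool (l = i)" for i
        using delta[of "\<lambda>j. m $ i $ j / 2 * of_bool (k = i)" l] delta[of "\<lambda>j. m $ i $ j / 2 * of_bool (l = i)" k]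
        by (simp add: distrib_left sum.distrib mult.assoc)
      then show ?thesis
        using delta[of "\<lambda>i. m $ i $ l / 2" k] delta[of "\<lambda>i. m $ i $ k / 2" l] sym[of l k]
        by (simp add: sum.distrib)
    qed
    then show ?thesis
      unfolding vec_eq_iff sum_component vector_scaleR_component D real_scaleR_def by simp
  qed
  from arg_cong[OF this, of "\<lambda>u. lmul u c"]
  have "lmul m c = (\<Sum>i\<in>UNIV. \<Sum>j\<in>UNIV. (m $ i $ j / 2) *\<^sub>R (lmul (rank1 (axis i 1 + axis j 1)) c
     - lmul (rank1 (axis i 1)) c - lmul (rank1 (axis j 1)) c))"
    by (simp only: lmul.sum_left lmul.scaleR_left lmul.diff_left)
  also have "\<dots> \<in> span (range (\<lambda>a. sp a (Suc k)))"
    by (intro span_sum span_scale span_diff r)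
  finally show ?thesis .
qed

lemma pw_sym_span:
  "(\<And>i j. m $ i $ j = m $ j $ i) \<Longrightarrow> pw m q \<in> span (range (\<lambda>a. sp a q))"
proof (induction q)
  case 0 show ?case unfolding pw_0 by (rule spcone_span[OF one_in_spcone])
next
  case (Suc q)
  show ?case unfolding pw_Suc by (rule lmul_sym_span[OF Suc.prems Suc.IH[OF Suc.prems]])
qed

section \<open>The order zero extension of a weakly positive current\<close>

lemma distribution_add: "distribution u \<Longrightarrow> test_fun f \<Longrightarrow> test_fun g \<Longrightarrow> u (\<lambda>x. f x + g x) = u f + u g"
  and distribution_cmult: "distribution u \<Longrightarrow> test_fun f \<Longrightarrow> u (\<lambda>x. c * f x) = c * u f"
  unfolding distribution_def by blast+

lemma distribution_zero: "distribution u \<Longrightarrow> u (\<lambda>_. 0) = 0"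
  using distribution_cmult[OF _ test_fun_zero, of u 0] by simp

definition test_ext :: "(real^'n::finite \<Rightarrow> 'n ext) \<Rightarrow> bool" where
  "test_ext \<alpha> \<longleftrightarrow> (\<forall>KL. test_fun (\<lambda>x. \<alpha> x $ KL))"

lemma test_ext_test_form: "test_ext \<alpha> \<Longrightarrow> test_form (to_form \<alpha>)"
  by (simp add: test_ext_def test_form_def to_form_def)

lemma test_ext_scaleR: "test_fun f \<Longrightarrow> test_ext (\<lambda>x. f x *\<^sub>R c)"
  by (simp add: test_ext_def test_fun_mult' smooth_const)

lemma test_ext_add: "test_ext \<alpha> \<Longrightarrow> test_ext \<beta> \<Longrightarrow> test_ext (\<lambda>x. \<alpha> x + \<beta> x)"
  by (simp add: test_ext_def test_fun_add)

lemma test_ext_sum: "(\<And>s. s \<in> I \<Longrightarrow> test_ext (\<alpha> s)) \<Longrightarrow> test_ext (\<lambda>x. \<Sum>s\<in>I. \<alpha> s x)"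
  by (simp add: test_ext_def test_fun_sum)

lemma pairing_add:
  assumes "\<And>K L. distribution (T K L)" "test_ext \<alpha>" "test_ext \<beta>"
  shows "pairing T (to_form (\<lambda>x. \<alpha> x + \<beta> x)) = pairing T (to_form \<alpha>) + pairing T (to_form \<beta>)"
proof -
  have "T A B (\<lambda>x. \<alpha> x $ (- A, - B) + \<beta> x $ (- A, - B)) = T A B (\<lambda>x. \<alpha> x $ (- A, - B)) + T A B (\<lambda>x. \<beta> x $ (- A, - B))" for A B
    by (rule distribution_add[OF assms(1)]) (use assms(2,3) in \<open>simp_all add: test_ext_def\<close>)
  then show ?thesis by (simp add: pairing_def to_form_def distrib_left sum.distrib)
qed

lemma pairing_cmult:
  assumes "\<And>K L. distribution (T K L)" "test_ext \<alpha>"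
  shows "pairing T (to_form (\<lambda>x. c *\<^sub>R \<alpha> x)) = c * pairing T (to_form \<alpha>)"
proof -
  have "T A B (\<lambda>x. c * \<alpha> x $ (- A, - B)) = c * T A B (\<lambda>x. \<alpha> x $ (- A, - B))" for A B
    by (rule distribution_cmult[OF assms(1)]) (use assms(2) in \<open>simp add: test_ext_def\<close>)
  then show ?thesis by (simp add: pairing_def to_form_def sum_distrib_left mult_ac)
qed

lemma pairing_zero:
  assumes "\<And>K L. distribution (T K L)" shows "pairing T (to_form (\<lambda>x. 0)) = 0"
  using assms by (simp add: pairing_def to_form_def distribution_zero)

lemma pairing_sum:
  assumes T: "\<And>K L. distribution (T K L)" and a: "\<And>s. s \<in> I \<Longrightarrow> test_ext (\<alpha> s)"
  shows "pairing T (to_form (\<lambda>x. \<Sum>s\<in>I. \<alpha> s x)) = (\<Sum>s\<in>I. pairing T (to_form (\<alpha> s)))"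
  using a
proof (induction I rule: infinite_finite_induct)
  case (insert s I)
  then show ?case using pairing_add[OF T, where \<alpha> = "\<alpha> s" and \<beta> = "\<lambda>x. \<Sum>s\<in>I. \<alpha> s x"]
    by (simp add: test_ext_sum)
qed (simp_all add: pairing_zero[OF T])

subsection \<open>Constant strongly positive forms\<close>

definition vform :: "real^'n::finite \<Rightarrow> 'n form" where
  "vform v K L = (\<lambda>_. \<Sum>i\<in>UNIV. if K = {i} \<and> L = {} then v $ i else 0)"

lemma vform_singleton: "vform v {i} {} x = v $ i"
  by (simp add: vform_def)

lemma vform_zero: "card K \<noteq> 1 \<or> L \<noteq> {} \<Longrightarrow> vform v K L x = 0"
  unfolding vform_def by (rule sum.neutral) auto

lemma smooth_vform: "smooth_form (vform v)"
  by (simp add: smooth_form_def vform_def smooth_const)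

lemma bidegree_vform: "bidegree_form 1 0 (vform v)"
  unfolding bidegree_form_def by (auto simp: fun_eq_iff intro!: vform_zero)

lemma wedge_vform_J:
  "wedge (vform v) (J_form (vform v)) K L x = (if card K = 1 \<and> card L = 1 then v $ the_elem K * v $ the_elem L else 0)"
proof -
  let ?W = "wedge (vform v) (J_form (vform v)) K L x"
  have 1: "?W = (\<Sum>i\<in>K. super_sign {i} {} (K - {i}) L * v $ i * J_form (vform v) (K - {i}) L x)"
  proof -
    have "(\<Sum>B\<in>Pow L. super_sign A B (K - A) (L - B) * vform v A B x * J_form (vform v) (K - A) (L - B) x)
      = super_sign A {} (K - A) L * vform v A {} x * J_form (vform v) (K - A) L x" for A
      using sum.mono_neutral_right[of "Pow L" "{{}}" "\<lambda>B. super_sign A B (K - A) (L - B) * vform v A B x * J_form (vform v) (K - A) (L - B) x"]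
      by (simp add: vform_zero)
    then have "?W = (\<Sum>A\<in>Pow K. super_sign A {} (K - A) L * vform v A {} x * J_form (vform v) (K - A) L x)"
      by (simp add: wedge_def)
    also have "\<dots> = (\<Sum>i\<in>K. super_sign {i} {} (K - {i}) L * vform v {i} {} x * J_form (vform v) (K - {i}) L x)"
      by (rule sum_Pow_singletons) (simp add: vform_zero)
    finally show ?thesis by (simp add: vform_singleton)
  qed
  show ?thesis
  proof (cases "card K = 1 \<and> card L = 1")
    case True
    then obtain i j where "K = {i}" "L = {j}" by (auto simp: card_1_singleton_iff)
    then show ?thesis unfolding 1 by (simp add: super_sign_def J_form_def vform_singleton)
  next
    case False
    have "super_sign {i} {} (K - {i}) L * v $ i * J_form (vform v) (K - {i}) L x = 0" if "i \<in> K" for i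
    proof (cases "K = {i}")
      case True
      then have "card L \<noteq> 1" using False by simp
      then show ?thesis by (simp add: J_form_def vform_zero)
    next
      case K: False
      then have "K - {i} \<noteq> {}" using that by auto
      then show ?thesis by (simp add: J_form_def)
    qed
    then have "?W = 0" unfolding 1 by (intro sum.neutral) blast
    then show ?thesis unfolding if_not_P[OF False] .
  qed
qed

lemma super_sign_swap_singletons:
  fixes K L :: "'n::{finite,linorder} set"
  assumes "i \<in> K" "j \<in> L"
  shows "super_sign (K - {i}) (L - {j}) {i} {j} = super_sign {i} {j} (K - {i}) (L - {j})"
proof -
  have s: "(-1) ^ k * ((-1) ^ k * t) = (t::real)" for k t
    by (simp add: mult.assoc[symmetric] power_mult_distrib[symmetric])
  show ?thesis
    using shuffle_sign_swap[of "K - {i}" "{i}"] shuffle_sign_swap[of "L - {j}" "{j}"]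
    by (simp add: super_sign_def mult_ac s)
qed

text \<open>\<open>J_product\<close> multiplies by (1,1)-forms from the right. They commute with
  every form, because dx_i and d\<xi>_j moved together past a factor leave no sign.\<close>

lemma form_at_wedge_right:
  fixes \<omega> \<beta> :: "'n::{finite,linorder} form"
  assumes "bidegree_form 1 1 \<omega>"
  shows "form_at (wedge \<beta> \<omega>) x = lmul (mat_of \<omega> x) (form_at \<beta> x)"
proof -
  have z: "\<omega> A B = (\<lambda>_. 0)" if "card A \<noteq> 1 \<or> card B \<noteq> 1" for A B
    using assms that unfolding bidegree_form_def by blast
  have flip: "(\<Sum>A\<in>Pow K. g A) = (\<Sum>A\<in>Pow K. g (K - A))" for g :: "'n set \<Rightarrow> real" and K
    by (rule sum.reindex_bij_witness[of _ "\<lambda>A. K - A" "\<lambda>A. K - A"]) (auto simp: double_diff)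
  have "wedge \<beta> \<omega> K L x = (\<Sum>i\<in>K. \<Sum>j\<in>L. super_sign {i} {j} (K - {i}) (L - {j}) * \<omega> {i} {j} x * \<beta> (K - {i}) (L - {j}) x)"
    for K L
  proof -
    have "wedge \<beta> \<omega> K L x = (\<Sum>A\<in>Pow K. \<Sum>B\<in>Pow L. super_sign (K - A) (L - B) A B * \<beta> (K - A) (L - B) x * \<omega> A B x)"
      unfolding wedge_def
      by (subst flip, rule sum.cong[OF refl], subst flip, rule sum.cong[OF refl]) (simp add: double_diff)
    also have "\<dots> = (\<Sum>i\<in>K. \<Sum>j\<in>L. super_sign (K - {i}) (L - {j}) {i} {j} * \<beta> (K - {i}) (L - {j}) x * \<omega> {i} {j} x)"
      by (subst sum_Pow_singletons, simp add: z, rule sum.cong[OF refl], subst sum_Pow_singletons)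
         (simp_all add: z)
    also have "\<dots> = (\<Sum>i\<in>K. \<Sum>j\<in>L. super_sign {i} {j} (K - {i}) (L - {j}) * \<omega> {i} {j} x * \<beta> (K - {i}) (L - {j}) x)"
      by (intro sum.cong refl) (simp add: super_sign_swap_singletons)
    finally show ?thesis .
  qed
  then show ?thesis by (simp add: form_at_def lmul_def mat_of_def vec_eq_iff)
qed

lemma form_at_J_product:
  fixes a :: "nat \<Rightarrow> real^'n::{finite,linorder}"
  shows "form_at (J_product (\<lambda>i. vform (a i)) k) x = sp a k"
proof (induction k)
  case (Suc k)
  have "bidegree_form 1 1 (wedge (vform v) (J_form (vform v)))" for v :: "real^'n::{finite,linorder}"
    unfolding bidegree_form_def by (auto simp: fun_eq_iff wedge_vform_J)
  moreover have "mat_of (wedge (vform v) (J_form (vform v))) x = rank1 v" for v :: "real^'n::{finite,linorder}"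
    by (simp add: mat_of_def rank1_def wedge_vform_J)
  ultimately show ?case by (simp add: form_at_wedge_right Suc)
qed (simp add: form_at_zero_form_1)

lemma strongly_positive_sp:
  assumes "smooth f" "\<And>x. 0 \<le> f x"
  shows "strongly_positive_form k (to_form (\<lambda>x. f x *\<^sub>R sp a k))"
proof -
  have "to_form (\<lambda>x. f x *\<^sub>R sp a k) K L x = f x * J_product (\<lambda>i. vform (a i)) k K L x" for K L x
    using form_at_J_product[of a k x] by (simp add: to_form_def form_at_def vec_eq_iff)
  then show ?thesis
    unfolding strongly_positive_form_def
    by (intro exI[of _ "1::nat"] exI[of _ "\<lambda>_. f"] exI[of _ "\<lambda>_ i. vform (a i)"])
       (auto simp: assms smooth_vform bidegree_vform[unfolded One_nat_def] fun_eq_iff)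
qed

lemma weakly_positive_distribution: "weakly_positive p T \<Longrightarrow> distribution (T K L)"
  by (simp add: weakly_positive_def is_current_def)

lemma pairing_spcone_nonneg:
  assumes T: "weakly_positive p T" and f: "test_fun f" "\<And>x. 0 \<le> f x" and c: "c \<in> spcone p"
  shows "0 \<le> pairing T (to_form (\<lambda>x. f x *\<^sub>R c))"
  using c
proof (induction rule: spcone.induct)
  case spcone_zero
  then show ?case using pairing_zero[OF weakly_positive_distribution[OF T]] by simp
next
  case (spcone_add c t a)
  have D: "\<And>K L. distribution (T K L)" using weakly_positive_distribution[OF T] .
  have "0 \<le> pairing T (to_form (\<lambda>x. f x *\<^sub>R sp a p))"
    using T test_ext_test_form[OF test_ext_scaleR[OF f(1)]] strongly_positive_sp[OF test_fun_smooth[OF f(1)] f(2)]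
    unfolding weakly_positive_def by blast
  moreover have "pairing T (to_form (\<lambda>x. f x *\<^sub>R (c + t *\<^sub>R sp a p)))
     = pairing T (to_form (\<lambda>x. f x *\<^sub>R c)) + t * pairing T (to_form (\<lambda>x. f x *\<^sub>R sp a p))"
    using pairing_add[OF D test_ext_scaleR[OF f(1), of c] test_ext_scaleR[OF f(1), of "t *\<^sub>R sp a p"]]
      pairing_cmult[OF D test_ext_scaleR[OF f(1), of "sp a p"], where c = t]
    by (simp add: scaleR_add_right mult.commute)
  ultimately show ?case using spcone_add by simp
qed

lemma Cc_linear:
  fixes l :: "'b::euclidean_space \<Rightarrow> 'c::real_normed_vector"
  assumes "linear l" "Cc \<alpha>" shows "Cc (\<lambda>x. l (\<alpha> x))"
proof -
  have "continuous_on UNIV (\<lambda>x. l (\<alpha> x))"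
    by (rule continuous_on_compose2[OF linear_continuous_on[OF linear_conv_bounded_linear[THEN iffD1, OF assms(1)]]])
       (use assms in \<open>auto simp: Cc_def\<close>)
  moreover have "bounded {x. l (\<alpha> x) \<noteq> 0}"
    by (rule bounded_subset[of "{x. \<alpha> x \<noteq> 0}"]) (use assms in \<open>auto simp: Cc_def linear_0\<close>)
  ultimately show ?thesis by (simp add: Cc_def)
qed

lemma test_ext_Cc: assumes "test_ext \<alpha>" shows "Cc \<alpha>"
proof -
  have t: "Cc (\<lambda>x. \<alpha> x $ KL)" for KL using assms unfolding test_ext_def by (intro test_fun_Cc) blast
  have "continuous_on UNIV (\<lambda>x. \<chi> KL. \<alpha> x $ KL)"
    by (rule continuous_on_vec_lambda) (use t in \<open>simp add: Cc_def\<close>)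
  moreover have "{x. \<alpha> x \<noteq> 0} \<subseteq> (\<Union>KL. {x. \<alpha> x $ KL \<noteq> 0})" by (auto simp: vec_eq_iff)
  moreover have "bounded (\<Union>KL. {x. \<alpha> x $ KL \<noteq> 0})"
    by (rule bounded_UN) (use t in \<open>auto simp: Cc_def\<close>)
  ultimately show ?thesis by (simp add: Cc_def bounded_subset)
qed

text \<open>Strongly positive elements do not span all symmetric forms, so only their span \<open>V\<close> has
  coefficients that are measures. Expanding along a basis of \<open>V\<close> of strongly positive elements
  makes the extension a finite sum of integrals against Radon measures.\<close>

lemma basis_expansion_spcone:
  fixes S :: "'b::euclidean_space set"
  obtains B l where "finite B" "B \<subseteq> S" "\<And>b. b \<in> B \<Longrightarrow> linear (l b :: 'b \<Rightarrow> real)"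
    "\<And>c. c \<in> span S \<Longrightarrow> c = (\<Sum>b\<in>B. l b c *\<^sub>R b)"
proof -
  obtain B where B: "B \<subseteq> S" "independent B" "S \<subseteq> span B"
    using maximal_independent_subset[of S] by blast
  have fin: "finite B" using B(2) by (rule independent_imp_finite)
  have "\<exists>g::'b \<Rightarrow> real. linear g \<and> (\<forall>x\<in>B. g x = (if x = b then 1 else 0))" for b
    using linear_independent_extend[OF B(2), of "\<lambda>x. if x = b then 1 else 0"] .
  then obtain l :: "'b \<Rightarrow> 'b \<Rightarrow> real" where l: "\<And>b. linear (l b)" "\<And>b x. x \<in> B \<Longrightarrow> l b x = (if x = b then 1 else 0)"
    by metis
  have "c = (\<Sum>b\<in>B. l b c *\<^sub>R b)" if "c \<in> span S" for c
  proof -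
    have "span S \<subseteq> span B" using B(3) by (simp add: span_minimal)
    with that have "c \<in> span B" by blast
    then obtain u where u: "c = (\<Sum>v\<in>B. u v *\<^sub>R v)" unfolding span_finite[OF fin] by auto
    have "l b c = u b" if "b \<in> B" for b
    proof -
      have "l b c = (\<Sum>v\<in>B. u v * (if v = b then 1 else 0))"
        unfolding u using l(2) by (simp add: linear_sum[OF l(1)] linear_cmul[OF l(1)])
      also have "\<dots> = u b" using fin that by (simp add: if_distrib cong: if_cong)
      finally show ?thesis .
    qed
    with u show ?thesis by simp
  qed
  with fin B(1) l(1) show ?thesis by (rule that)
qed

text \<open>By Lindelof's theorem countably many of the null balls cover \<open>S\<close>.\<close>

lemma radon_null_open:
  fixes M :: "(real^'n::finite) measure"
  assumes M: "radon_measure M" and "open S" and loc: "\<And>x. x \<in> S \<Longrightarrow> \<exists>r>0. emeasure M (ball x r) = 0"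
  shows "emeasure M S = 0"
proof -
  have s: "sets M = sets borel" using M by (simp add: radon_measure_def)
  obtain r where r: "\<And>x. x \<in> S \<Longrightarrow> 0 < r x \<and> emeasure M (ball x (r x)) = 0" using loc by metis
  obtain \<F> where F: "\<F> \<subseteq> (\<lambda>x. ball x (r x)) ` S" "countable \<F>" "\<Union>\<F> = \<Union>((\<lambda>x. ball x (r x)) ` S)"
    by (rule Lindelof[of "(\<lambda>x. ball x (r x)) ` S"]) auto
  have "S \<subseteq> \<Union>\<F>" unfolding F(3) using r by force
  moreover have "\<Union>\<F> \<in> null_sets M"
  proof -
    have "(\<Union>A\<in>\<F>. A) \<in> null_sets M"
      by (rule null_sets_UN'[OF F(2)]) (use F(1) r s in \<open>auto simp: null_sets_def\<close>)
    then show ?thesis by simp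
  qed
  ultimately show ?thesis
    using null_sets_subset[of "\<Union>\<F>" M S] s \<open>open S\<close> by (auto simp: null_sets_def)
qed

lemma radon_null_test:
  fixes M :: "(real^'n::finite) measure"
  assumes M: "radon_measure M" and S: "open S"
    and z: "\<And>f. test_fun f \<Longrightarrow> closure {x. f x \<noteq> 0} \<subseteq> S \<Longrightarrow> (\<integral>x. f x \<partial>M) = 0"
  shows "emeasure M S = 0"
proof (rule radon_null_open[OF M S])
  have s: "sets M = sets borel" using M by (simp add: radon_measure_def)
  fix c assume "c \<in> S"
  then obtain r where r: "0 < r" "cball c r \<subseteq> S" using S open_contains_cball by blast
  define g where "g x = max 0 (r / 2 - dist c x)" for x
  have g0: "g x = 0" if "x \<notin> cball c (r / 2)" for x using that by (simp add: g_def)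
  have gb: "{x. g x \<noteq> 0} \<subseteq> cball c (r / 2)" using g0 by blast
  have gc: "continuous_on UNIV g" unfolding g_def by (intro continuous_intros)
  have g: "Cc g" using gc bounded_subset[OF bounded_cball gb] by (simp add: Cc_def)
  \<comment> \<open>From N on, the mollified tents stay inside \<open>cball c r\<close>, so their
    integrals vanish by hypothesis. In the limit the tent itself has integral 0, and it is positive
    on the ball of radius r / 2.\<close>
  obtain N where N: "1 / Suc N < r / 2" using r(1) nat_approx_posE[of "r / 2"] by auto
  have 0: "(\<integral>x. conv g (moll j) x \<partial>M) = 0" if "N \<le> j" for j
  proof -
    have "1 / Suc j \<le> 1 / Suc N" using that by (simp add: frac_le)
    then have j: "1 / Suc j < r / 2" using N by linarith
    have "{x. conv g (moll j) x \<noteq> 0} \<subseteq> cball c r"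
    proof
      fix x assume "x \<in> {x. conv g (moll j) x \<noteq> 0}"
      then have "conv g (moll j) x \<noteq> 0" by simp
      then obtain y where y: "g y \<noteq> 0" "dist x y < 1 / Suc j" by (rule conv_moll_support)
      then have "dist c y \<le> r / 2" using gb by auto
      then show "x \<in> cball c r" using y(2) j dist_triangle[of c x y] by (simp add: dist_commute)
    qed
    then have "closure {x. conv g (moll j) x \<noteq> 0} \<subseteq> S"
      using r(2) closure_minimal[OF _ closed_cball] by (metis order.trans)
    then show ?thesis by (rule z[OF Cc_conv_moll[OF g]])
  qed
  have "(\<lambda>j. \<integral>x. conv g (moll j) x \<partial>M) \<longlonglongrightarrow> 0"
    by (rule tendsto_eventually, rule eventually_sequentiallyI[of N]) (rule 0)
  from LIMSEQ_unique[OF radon_moll_limit[OF M g] this] have "(\<integral>x. g x \<partial>M) = 0" .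
  moreover have "AE x in M. 0 \<le> g x" by (simp add: g_def)
  ultimately have "AE x in M. g x = 0"
    using integral_nonneg_eq_0_iff_AE[OF radon_integrable[OF M g]] by simp
  then have "AE x in M. x \<notin> ball c (r / 2)"
    by eventually_elim (simp add: g_def max_def split: if_splits)
  then have "emeasure M (ball c (r / 2)) = 0"
    using AE_iff_measurable[of "ball c (r / 2)" M "\<lambda>x. x \<notin> ball c (r / 2)"] s
      sets_eq_imp_space_eq[OF s] by (simp add: ball_def)
  then show "\<exists>r>0. emeasure M (ball c r) = 0" using r(1) by (intro exI[of _ "r / 2"]) auto
qed

text \<open>Makes the extension local: its measures do not charge the complement of the support,
  which permits identities that hold on the support only.\<close>

lemma radon_null_complement_support:
  assumes T: "weakly_positive p T" and M: "radon_measure M"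
    and eq: "\<And>f. test_fun f \<Longrightarrow> pairing T (to_form (\<lambda>x. f x *\<^sub>R b)) = (\<integral>x. f x \<partial>M)"
  shows "emeasure M (- current_support T) = 0"
proof -
  let ?N = "{U. open U \<and> (\<forall>K L f. test_fun f \<longrightarrow> closure {x. f x \<noteq> 0} \<subseteq> U \<longrightarrow> T K L f = 0)}"
  have D: "\<And>K L. distribution (T K L)" using weakly_positive_distribution[OF T] .
  have s: "sets M = sets borel" using M by (simp add: radon_measure_def)
  have X: "- current_support T = \<Union>?N" by (simp add: current_support_def)
  show ?thesis unfolding X
  proof (rule radon_null_open[OF M])
    show "open (\<Union>?N)" by auto
    fix c assume "c \<in> \<Union>?N"
    then obtain U where U: "open U" "c \<in> U"
      "\<And>K L f. test_fun f \<Longrightarrow> closure {x. f x \<noteq> 0} \<subseteq> U \<Longrightarrow> T K L f = 0" by auto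
    have "emeasure M U = 0"
    proof (rule radon_null_test[OF M U(1)])
      fix f assume f: "test_fun f" "closure {x. f x \<noteq> 0} \<subseteq> U"
      have "T K L (\<lambda>x. f x * t) = 0" for K L t
        using distribution_cmult[OF D f(1), of K L t] U(3)[OF f] by (simp add: mult.commute)
      then have "pairing T (to_form (\<lambda>x. f x *\<^sub>R b)) = 0" by (simp add: pairing_def to_form_def)
      with eq[OF f(1)] show "(\<integral>x. f x \<partial>M) = 0" by simp
    qed
    moreover obtain r where "0 < r" "ball c r \<subseteq> U" using U(1,2) open_contains_ball by blast
    ultimately have "emeasure M (ball c r) = 0"
      using emeasure_mono[of "ball c r" U M] U(1) s by simp
    with \<open>0 < r\<close> show "\<exists>r>0. emeasure M (ball c r) = 0" by blast
  qed
qed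

text \<open>A partition of unity by small balls on which \<alpha> varies by less than e. The weights
  are normalized by max (D x) m, with m the minimum of D on the ball of radius r: they are
  continuous everywhere and add up to 1 wherever \<alpha> is nonzero. Since \<eta> s multiplies the
  constant \<alpha> s, cone-valued functions are reduced to constant elements of the cone.\<close>

lemma partition_approximation:
  fixes \<alpha> :: "'a::euclidean_space \<Rightarrow> 'b::real_normed_vector"
  assumes \<alpha>: "Cc \<alpha>" and r: "\<And>x. \<alpha> x \<noteq> 0 \<Longrightarrow> norm x \<le> r" and r0: "0 \<le> r" and e: "0 < e"
  obtains S and \<eta> :: "'a \<Rightarrow> 'a \<Rightarrow> real" where "finite S" "\<And>s. Cc (\<eta> s)" "\<And>s x. 0 \<le> \<eta> s x"
    "\<And>s x. s \<in> S \<Longrightarrow> \<eta> s x \<noteq> 0 \<Longrightarrow> norm x \<le> r + 1" "\<And>x. norm ((\<Sum>s\<in>S. \<eta> s x *\<^sub>R \<alpha> s) - \<alpha> x) \<le> e"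
proof -
  have "uniformly_continuous_on UNIV \<alpha>"
    using \<alpha> by (intro uniformly_continuous_bounded_support) (auto simp: Cc_def)
  then obtain d0 where d0: "0 < d0" "\<And>x y. dist y x < d0 \<Longrightarrow> dist (\<alpha> y) (\<alpha> x) < e"
    unfolding uniformly_continuous_on_def using e by (metis UNIV_I)
  define d where "d = min d0 1"
  have d: "0 < d" "d \<le> 1" "\<And>x y. dist y x < d \<Longrightarrow> dist (\<alpha> y) (\<alpha> x) < e"
    using d0 by (auto simp: d_def)
  let ?C = "cball (0::'a) r"
  obtain S where S: "S \<subseteq> ?C" "finite S" "?C \<subseteq> (\<Union>s\<in>S. ball s d)"
    by (rule compactE_image[OF compact_cball, of ?C "\<lambda>s. ball s d" 0 r]) (use d(1) in auto)
  define w where "w s x = max 0 (d - dist s x)" for s x :: 'a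
  define D where "D x = (\<Sum>s\<in>S. w s x)" for x
  have w0: "0 \<le> w s x" for s x by (simp add: w_def)
  have wc: "continuous_on UNIV (w s)" for s unfolding w_def by (intro continuous_intros)
  have Dc: "continuous_on A D" for A
    unfolding D_def by (intro continuous_on_sum continuous_on_subset[OF wc]) auto
  have Dpos: "0 < D x" if x: "x \<in> ?C" for x
  proof -
    obtain s where s: "s \<in> S" "x \<in> ball s d" using S(3) x by blast
    then have "0 < w s x" by (simp add: w_def)
    also have "w s x \<le> D x" unfolding D_def using S(2) s(1) w0 by (intro member_le_sum) auto
    finally show ?thesis .
  qed
  have "?C \<noteq> {}" using r0 by simp
  then obtain x0 where x0: "x0 \<in> ?C" "\<And>x. x \<in> ?C \<Longrightarrow> D x0 \<le> D x"
    using continuous_attains_inf[OF compact_cball _ Dc] by blast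
  define m where "m = D x0"
  have m: "0 < m" using Dpos x0(1) by (simp add: m_def)
  define \<eta> where "\<eta> s x = w s x / max (D x) m" for s x
  have \<eta>0: "0 \<le> \<eta> s x" for s x using w0 m by (simp add: \<eta>_def)
  have \<eta>w: "dist s x < d" if "\<eta> s x \<noteq> 0" for s x
  proof (rule ccontr)
    assume "\<not> dist s x < d"
    then have "w s x = 0" by (simp add: w_def)
    with that show False by (simp add: \<eta>_def)
  qed
  have \<eta>sum: "(\<Sum>s\<in>S. \<eta> s x) = D x / max (D x) m" for x
    unfolding \<eta>_def D_def by (rule sum_divide_distrib[symmetric])
  have \<eta>1: "(\<Sum>s\<in>S. \<eta> s x) \<le> 1" for x unfolding \<eta>sum using m by (simp add: divide_le_eq)
  have \<eta>C: "(\<Sum>s\<in>S. \<eta> s x) = 1" if "x \<in> ?C" for x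
    unfolding \<eta>sum using x0(2)[OF that] m by (simp add: m_def max_def)
  have \<eta>Cc: "Cc (\<eta> s)" for s
  proof -
    have "{x. \<eta> s x \<noteq> 0} \<subseteq> ball s d" using \<eta>w by auto
    moreover have "max (D x) m \<noteq> 0" for x using m by linarith
    then have "continuous_on UNIV (\<eta> s)"
      unfolding \<eta>_def by (intro continuous_intros wc Dc ballI)
    ultimately show ?thesis unfolding Cc_def using bounded_subset[OF bounded_ball] by simp
  qed
  show ?thesis
  proof (rule that[of S \<eta>])
    fix s x assume s: "s \<in> S" "\<eta> s x \<noteq> 0"
    then have "norm s \<le> r" "dist s x < 1" using S(1) \<eta>w[OF s(2)] d(2) by auto
    then show "norm x \<le> r + 1" using norm_triangle_sub[of x s] by (simp add: dist_norm norm_minus_commute)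
  next
    fix x
    have "(\<Sum>s\<in>S. \<eta> s x *\<^sub>R \<alpha> s) - \<alpha> x = (\<Sum>s\<in>S. \<eta> s x *\<^sub>R (\<alpha> s - \<alpha> x))"
    proof -
      have "(\<Sum>s\<in>S. \<eta> s x) *\<^sub>R \<alpha> x = \<alpha> x"
        using \<eta>C[of x] r[of x] by (cases "\<alpha> x = 0") simp_all
      then show ?thesis by (simp add: scaleR_diff_right sum_subtractf scaleR_sum_left[symmetric])
    qed
    also have "norm \<dots> \<le> (\<Sum>s\<in>S. \<eta> s x * e)"
    proof (rule order.trans[OF norm_sum sum_mono])
      fix s
      show "norm (\<eta> s x *\<^sub>R (\<alpha> s - \<alpha> x)) \<le> \<eta> s x * e"
        using d(3)[OF \<eta>w[of s x]] \<eta>0[of s x]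
        by (cases "\<eta> s x = 0") (auto simp: dist_norm intro!: mult_left_mono)
    qed
    also have "\<dots> \<le> e" using \<eta>1[of x] e by (simp add: sum_distrib_right[symmetric] mult_left_le_one_le sum_nonneg \<eta>0)
    finally show "norm ((\<Sum>s\<in>S. \<eta> s x *\<^sub>R \<alpha> s) - \<alpha> x) \<le> e" .
  qed (use S(2) \<eta>Cc \<eta>0 in auto)
qed

text \<open>Off the span of the strongly positive elements the extension built below depends on the
  choice of a basis, so agreement with \<open>T\<close> is demanded on the span only. The fourth
  clause is continuity under uniform limits in one ball, the last one is locality.\<close>

definition order_zero_extension ::
  "nat \<Rightarrow> 'n::{finite,linorder} current \<Rightarrow> ((real^'n::{finite,linorder} \<Rightarrow> 'n ext) \<Rightarrow> real) \<Rightarrow> bool" where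
  "order_zero_extension p T LL \<longleftrightarrow>
     (\<forall>\<alpha> \<beta>. Cc \<alpha> \<longrightarrow> Cc \<beta> \<longrightarrow> LL (\<lambda>x. \<alpha> x + \<beta> x) = LL \<alpha> + LL \<beta>) \<and>
     (\<forall>c \<alpha>. Cc \<alpha> \<longrightarrow> LL (\<lambda>x. c *\<^sub>R \<alpha> x) = c * LL \<alpha>) \<and>
     (\<forall>\<alpha>. test_ext \<alpha> \<longrightarrow> (\<forall>x. \<alpha> x \<in> span (range (\<lambda>a. sp a p))) \<longrightarrow> LL \<alpha> = pairing T (to_form \<alpha>)) \<and>
     (\<forall>\<alpha>j \<alpha> r. (\<forall>j. Cc (\<alpha>j j)) \<longrightarrow> Cc \<alpha> \<longrightarrow> (\<forall>j x. \<alpha>j j x \<noteq> 0 \<longrightarrow> norm x \<le> r) \<longrightarrow>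
        (\<forall>x. \<alpha> x \<noteq> 0 \<longrightarrow> norm x \<le> r) \<longrightarrow> uniform_limit UNIV \<alpha>j \<alpha> sequentially \<longrightarrow>
        (\<lambda>j. LL (\<alpha>j j)) \<longlonglongrightarrow> LL \<alpha>) \<and>
     (\<forall>\<alpha>. Cc \<alpha> \<longrightarrow> (\<forall>x\<in>current_support T. \<alpha> x = 0) \<longrightarrow> LL \<alpha> = 0)"

lemma order_zero_extensionD:
  assumes "order_zero_extension p T LL"
  shows "Cc \<alpha> \<Longrightarrow> Cc \<beta> \<Longrightarrow> LL (\<lambda>x. \<alpha> x + \<beta> x) = LL \<alpha> + LL \<beta>"
    and "Cc \<alpha> \<Longrightarrow> LL (\<lambda>x. c *\<^sub>R \<alpha> x) = c * LL \<alpha>"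
    and "test_ext \<alpha> \<Longrightarrow> (\<And>x. \<alpha> x \<in> span (range (\<lambda>a. sp a p))) \<Longrightarrow> LL \<alpha> = pairing T (to_form \<alpha>)"
    and "(\<And>j. Cc (\<alpha>j j)) \<Longrightarrow> Cc \<alpha> \<Longrightarrow> (\<And>j x. \<alpha>j j x \<noteq> 0 \<Longrightarrow> norm x \<le> r) \<Longrightarrow>
        (\<And>x. \<alpha> x \<noteq> 0 \<Longrightarrow> norm x \<le> r) \<Longrightarrow> uniform_limit UNIV \<alpha>j \<alpha> sequentially \<Longrightarrow> (\<lambda>j. LL (\<alpha>j j)) \<longlonglongrightarrow> LL \<alpha>"
    and "Cc \<alpha> \<Longrightarrow> (\<And>x. x \<in> current_support T \<Longrightarrow> \<alpha> x = 0) \<Longrightarrow> LL \<alpha> = 0"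
  using assms unfolding order_zero_extension_def by blast+

lemma order_zero_extension_sum:
  assumes LL: "order_zero_extension p T LL" and "\<And>s. Cc (\<alpha> s)"
  shows "LL (\<lambda>x. \<Sum>s\<in>I. \<alpha> s x) = (\<Sum>s\<in>I. LL (\<alpha> s))"
  by (induction I rule: infinite_finite_induct)
     (simp_all add: order_zero_extensionD[OF LL] Cc_zero Cc_sum assms(2))

lemma order_zero_extension_exists:
  fixes T :: "'n::{finite,linorder} current"
  assumes T: "weakly_positive p T" shows "\<exists>LL. order_zero_extension p T LL"
proof -
  have D: "\<And>K L. distribution (T K L)" using weakly_positive_distribution[OF T] .
  let ?S = "range (\<lambda>a. sp a p) :: 'n ext set"
  obtain B and l :: "'n ext \<Rightarrow> 'n ext \<Rightarrow> real" where B: "finite B" "B \<subseteq> ?S" "\<And>b. b \<in> B \<Longrightarrow> linear (l b)"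
    "\<And>c. c \<in> span ?S \<Longrightarrow> c = (\<Sum>b\<in>B. l b c *\<^sub>R b)"
    by (rule basis_expansion_spcone[of ?S]) blast
  have "\<exists>M. radon_measure M \<and> (\<forall>f. test_fun f \<longrightarrow> pairing T (to_form (\<lambda>x. f x *\<^sub>R b)) = (\<integral>x. f x \<partial>M))"
    if b: "b \<in> B" for b
  proof (rule riesz_representation)
    obtain a where "b = sp a p" using B(2) b by blast
    then have bc: "b \<in> spcone p" using spcone_add[OF spcone_zero, of 1 a p] by simp
    show "positive_functional test_fun (\<lambda>f. pairing T (to_form (\<lambda>x. f x *\<^sub>R b)))"
      unfolding positive_functional_def
    proof (intro conjI allI impI)
      fix f g :: "real^'n::{finite,linorder} \<Rightarrow> real" assume "test_fun f" "test_fun g"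
      from pairing_add[OF D test_ext_scaleR[OF this(1), of b] test_ext_scaleR[OF this(2), of b]]
      show "pairing T (to_form (\<lambda>x. (f x + g x) *\<^sub>R b)) = pairing T (to_form (\<lambda>x. f x *\<^sub>R b)) + pairing T (to_form (\<lambda>x. g x *\<^sub>R b))"
        by (simp add: scaleR_left_distrib)
    next
      fix c and f :: "real^'n::{finite,linorder} \<Rightarrow> real" assume "test_fun f"
      from pairing_cmult[OF D test_ext_scaleR[OF this, of b], where c = c]
      show "pairing T (to_form (\<lambda>x. (c * f x) *\<^sub>R b)) = c * pairing T (to_form (\<lambda>x. f x *\<^sub>R b))"
        by simp
    qed (use pairing_spcone_nonneg[OF T _ _ bc] in blast)
  qed
  then obtain M where M: "\<And>b. b \<in> B \<Longrightarrow> radon_measure (M b)"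
    "\<And>b f. b \<in> B \<Longrightarrow> test_fun f \<Longrightarrow> pairing T (to_form (\<lambda>x. f x *\<^sub>R b)) = (\<integral>x. f x \<partial>M b)"
    by metis
  \<comment> \<open>Each basis element lies in the cone, so the pairing of \<open>T\<close> with its
    multiples is a positive functional, with a Radon measure \<open>M b\<close>; the
    \<open>l b\<close> are the coordinates in this basis.\<close>
  define LL where "LL \<alpha> = (\<Sum>b\<in>B. \<integral>x. l b (\<alpha> x) \<partial>M b)" for \<alpha>
  have int: "integrable (M b) (\<lambda>x. l b (\<alpha> x))" if "b \<in> B" "Cc \<alpha>" for b \<alpha>
    by (rule radon_integrable[OF M(1)[OF that(1)] Cc_linear[OF B(3)[OF that(1)] that(2)]])
  have "order_zero_extension p T LL"
    unfolding order_zero_extension_def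
  proof (intro conjI allI impI)
    fix \<alpha> \<beta> :: "real^'n::{finite,linorder} \<Rightarrow> 'n ext" assume "Cc \<alpha>" "Cc \<beta>"
    then show "LL (\<lambda>x. \<alpha> x + \<beta> x) = LL \<alpha> + LL \<beta>"
      unfolding LL_def sum.distrib[symmetric]
      by (intro sum.cong refl) (simp add: linear_add[OF B(3)] int)
  next
    fix c and \<alpha> :: "real^'n::{finite,linorder} \<Rightarrow> 'n ext" assume "Cc \<alpha>"
    then show "LL (\<lambda>x. c *\<^sub>R \<alpha> x) = c * LL \<alpha>"
      unfolding LL_def sum_distrib_left
      by (intro sum.cong refl) (simp add: linear_cmul[OF B(3)])
  next
    fix \<alpha> :: "real^'n::{finite,linorder} \<Rightarrow> 'n ext" assume a: "test_ext \<alpha>" "\<forall>x. \<alpha> x \<in> span ?S"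
    have t: "test_fun (\<lambda>x. l b (\<alpha> x))" if b: "b \<in> B" for b
    proof -
      have "l b (\<alpha> x) = (\<Sum>KL\<in>UNIV. \<alpha> x $ KL * l b (axis KL 1))" for x
      proof -
        have "l b (\<alpha> x) = l b (\<Sum>KL\<in>UNIV. \<alpha> x $ KL *\<^sub>R axis KL 1)"
          using basis_expansion[of "\<alpha> x"] by (simp add: scalar_mult_eq_scaleR)
        then show ?thesis by (simp add: linear_sum[OF B(3)[OF b]] linear_cmul[OF B(3)[OF b]])
      qed
      moreover have "test_fun (\<lambda>x. \<Sum>KL\<in>UNIV. \<alpha> x $ KL * l b (axis KL 1))"
        using a(1) unfolding test_ext_def by (intro test_fun_sum test_fun_mult' smooth_const) blast
      ultimately show ?thesis by simp
    qed
    have "\<alpha> = (\<lambda>x. \<Sum>b\<in>B. l b (\<alpha> x) *\<^sub>R b)" using B(4) a(2) by blast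
    then have "pairing T (to_form \<alpha>) = pairing T (to_form (\<lambda>x. \<Sum>b\<in>B. l b (\<alpha> x) *\<^sub>R b))" by metis
    also have "\<dots> = (\<Sum>b\<in>B. pairing T (to_form (\<lambda>x. l b (\<alpha> x) *\<^sub>R b)))"
      by (intro pairing_sum D test_ext_scaleR t)
    also have "\<dots> = LL \<alpha>" unfolding LL_def by (intro sum.cong refl M(2) t)
    finally show "LL \<alpha> = pairing T (to_form \<alpha>)" by simp
  next
    fix \<alpha>j and \<alpha> :: "real^'n::{finite,linorder} \<Rightarrow> 'n ext" and r
    assume a: "\<forall>j. Cc (\<alpha>j j)" "Cc \<alpha>" "\<forall>j x. \<alpha>j j x \<noteq> 0 \<longrightarrow> norm x \<le> r" "\<forall>x. \<alpha> x \<noteq> 0 \<longrightarrow> norm x \<le> r"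
      "uniform_limit UNIV \<alpha>j \<alpha> sequentially"
    show "(\<lambda>j. LL (\<alpha>j j)) \<longlonglongrightarrow> LL \<alpha>"
      unfolding LL_def
    proof (rule tendsto_sum)
      fix b assume b: "b \<in> B"
      note bl = linear_conv_bounded_linear[THEN iffD1, OF B(3)[OF b]]
      show "(\<lambda>j. \<integral>x. l b (\<alpha>j j x) \<partial>M b) \<longlonglongrightarrow> (\<integral>x. l b (\<alpha> x) \<partial>M b)"
      proof (rule radon_uniform_limit[OF M(1)[OF b]])
        show "Cc (\<lambda>x. l b (\<alpha>j j x))" "Cc (\<lambda>x. l b (\<alpha> x))" for j
          using a(1,2) B(3)[OF b] by (auto intro: Cc_linear)
        show "l b (\<alpha>j j x) \<noteq> 0 \<Longrightarrow> norm x \<le> r" for j x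
          using a(3) linear_0[OF B(3)[OF b]] by metis
        show "l b (\<alpha> x) \<noteq> 0 \<Longrightarrow> norm x \<le> r" for x
          using a(4) linear_0[OF B(3)[OF b]] by metis
        show "uniform_limit UNIV (\<lambda>j x. l b (\<alpha>j j x)) (\<lambda>x. l b (\<alpha> x)) sequentially"
          by (rule bounded_linear.uniform_limit[OF bl a(5)])
      qed
    qed
  next
    fix \<alpha> :: "real^'n::{finite,linorder} \<Rightarrow> 'n ext" assume a: "Cc \<alpha>" "\<forall>x\<in>current_support T. \<alpha> x = 0"
    have "(\<integral>x. l b (\<alpha> x) \<partial>M b) = 0" if b: "b \<in> B" for b
    proof -
      have s: "sets (M b) = sets borel" using M(1)[OF b] by (simp add: radon_measure_def)
      have "open (- current_support T)" unfolding current_support_def by auto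
      then have "- current_support T \<in> null_sets (M b)"
        using radon_null_complement_support[OF T M(1)[OF b] M(2)[OF b]] s by (auto simp: null_sets_def)
      then have "AE x in M b. x \<notin> - current_support T" by (rule AE_not_in)
      then have "AE x in M b. l b (\<alpha> x) = 0"
        by eventually_elim (use a(2) linear_0[OF B(3)[OF b]] in auto)
      then show ?thesis by (rule integral_eq_zero_AE)
    qed
    then show "LL \<alpha> = 0" by (simp add: LL_def)
  qed
  then show ?thesis by blast
qed

text \<open>The coordinates of a cone element in a basis may be negative, so positivity cannot be
  read off a representation by integrals. It holds for \<eta> times a constant of the cone, by
  mollifying \<eta>, hence for the sums given by \<open>partition_approximation\<close>, and it
  passes to their uniform limit.\<close>

lemma order_zero_extension_nonneg:
  fixes T :: "'n::{finite,linorder} current"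
  assumes T: "weakly_positive p T" and LL: "order_zero_extension p T LL"
    and \<alpha>: "Cc \<alpha>" "\<And>x. \<alpha> x \<in> spcone p"
  shows "0 \<le> LL \<alpha>"
proof -
  note pair = order_zero_extensionD(3)[OF LL] and lim = order_zero_extensionD(4)[OF LL]
  have CcS: "Cc (\<lambda>x. f x *\<^sub>R c)" if "Cc f" for f :: "real^'n::{finite,linorder} \<Rightarrow> real" and c :: "'n ext"
  proof -
    have "linear (\<lambda>t::real. t *\<^sub>R c)" by (simp add: linear_iff scaleR_left_distrib)
    from Cc_linear[OF this that] show ?thesis .
  qed
  have pos: "0 \<le> LL (\<lambda>x. \<eta> x *\<^sub>R c)" if \<eta>: "Cc \<eta>" "\<And>x. 0 \<le> \<eta> x" and c: "c \<in> spcone p" for \<eta> c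
  proof -
    have \<eta>': "continuous_on UNIV \<eta>" "bounded {x. \<eta> x \<noteq> 0}" using \<eta> by (auto simp: Cc_def)
    obtain r where r: "\<And>j x. conv \<eta> (moll j) x \<noteq> 0 \<Longrightarrow> norm x \<le> r" "\<And>x. \<eta> x \<noteq> 0 \<Longrightarrow> norm x \<le> r"
      by (rule conv_moll_common_support[OF \<eta>'(2)]) blast
    have t: "test_fun (conv \<eta> (moll j))" for j by (rule Cc_conv_moll[OF \<eta>(1)])
    have bl: "bounded_linear (\<lambda>t::real. t *\<^sub>R c)" by (rule bounded_linear_scaleR_left)
    have "(\<lambda>j. LL (\<lambda>x. conv \<eta> (moll j) x *\<^sub>R c)) \<longlonglongrightarrow> LL (\<lambda>x. \<eta> x *\<^sub>R c)"
    proof (rule lim[where r = r])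
      show "uniform_limit UNIV (\<lambda>j x. conv \<eta> (moll j) x *\<^sub>R c) (\<lambda>x. \<eta> x *\<^sub>R c) sequentially"
        by (rule bounded_linear.uniform_limit[OF bl conv_moll_uniform_limit[OF \<eta>']])
    qed (use r in \<open>auto intro: CcS \<eta> test_fun_Cc t\<close>)
    moreover have "0 \<le> LL (\<lambda>x. conv \<eta> (moll j) x *\<^sub>R c)" for j
    proof -
      have "LL (\<lambda>x. conv \<eta> (moll j) x *\<^sub>R c) = pairing T (to_form (\<lambda>x. conv \<eta> (moll j) x *\<^sub>R c))"
        by (intro pair test_ext_scaleR t span_scale spcone_span c)
      also have "\<dots> \<ge> 0"
        by (intro pairing_spcone_nonneg[OF T] t c conv_nonneg \<eta> moll_nonneg)
      finally show ?thesis .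
    qed
    ultimately show ?thesis by (intro LIMSEQ_le_const) auto
  qed
  have sum0: "0 \<le> LL (\<lambda>x. \<Sum>s\<in>S. \<eta> s x *\<^sub>R \<alpha> s)" if "\<And>s. Cc (\<eta> s)" "\<And>s x. 0 \<le> \<eta> s x" for S \<eta>
    unfolding order_zero_extension_sum[OF LL CcS[OF that(1)]]
    by (intro sum_nonneg pos that \<alpha>(2))
  obtain r0 where r0: "\<And>x. \<alpha> x \<noteq> 0 \<Longrightarrow> norm x \<le> r0" using \<alpha>(1) by (auto simp: Cc_def bounded_iff)
  define r where "r = max r0 0"
  have r: "\<And>x. \<alpha> x \<noteq> 0 \<Longrightarrow> norm x \<le> r" "0 \<le> r" using r0 by (auto simp: r_def max.coboundedI1)
  have "\<exists>\<beta>. Cc \<beta> \<and> 0 \<le> LL \<beta> \<and> (\<forall>x. \<beta> x \<noteq> 0 \<longrightarrow> norm x \<le> r + 1) \<and> (\<forall>x. norm (\<beta> x - \<alpha> x) \<le> 1 / Suc j)" for j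
  proof -
    obtain S and \<eta> :: "real^'n::{finite,linorder} \<Rightarrow> real^'n::{finite,linorder} \<Rightarrow> real" where
      S: "finite S" "\<And>s. Cc (\<eta> s)" "\<And>s x. 0 \<le> \<eta> s x" "\<And>s x. s \<in> S \<Longrightarrow> \<eta> s x \<noteq> 0 \<Longrightarrow> norm x \<le> r + 1"
        "\<And>x. norm ((\<Sum>s\<in>S. \<eta> s x *\<^sub>R \<alpha> s) - \<alpha> x) \<le> 1 / Suc j"
      by (rule partition_approximation[OF \<alpha>(1) r, of "1 / Suc j"]) auto
    have "norm x \<le> r + 1" if nz: "(\<Sum>s\<in>S. \<eta> s x *\<^sub>R \<alpha> s) \<noteq> 0" for x
    proof -
      obtain s where "s \<in> S" "\<eta> s x *\<^sub>R \<alpha> s \<noteq> 0" using nz by (meson sum.neutral)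
      then show ?thesis using S(4)[of s x] by auto
    qed
    then show ?thesis
      using S sum0[OF S(2,3), where S = S]
      by (intro exI[of _ "\<lambda>x. \<Sum>s\<in>S. \<eta> s x *\<^sub>R \<alpha> s"]) (auto intro!: Cc_sum CcS)
  qed
  then obtain \<beta> where \<beta>: "\<And>j. Cc (\<beta> j)" "\<And>j. 0 \<le> LL (\<beta> j)" "\<And>j x. \<beta> j x \<noteq> 0 \<Longrightarrow> norm x \<le> r + 1"
    "\<And>j x. norm (\<beta> j x - \<alpha> x) \<le> 1 / Suc j" by metis
  have "(\<lambda>j. LL (\<beta> j)) \<longlonglongrightarrow> LL \<alpha>"
  proof (rule lim[where r = "r + 1"])
    show "norm x \<le> r + 1" if "\<alpha> x \<noteq> 0" for x using r(1)[OF that] by simp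
    show "uniform_limit UNIV \<beta> \<alpha> sequentially"
    proof (rule uniform_limitI)
      fix e :: real assume "0 < e"
      then obtain N where N: "1 / Suc N < e" using nat_approx_posE by blast
      show "\<forall>\<^sub>F j in sequentially. \<forall>x\<in>UNIV. dist (\<beta> j x) (\<alpha> x) < e"
      proof (rule eventually_sequentiallyI[of N], rule ballI)
        fix j x assume "N \<le> j"
        then have "1 / Suc j \<le> 1 / Suc N" by (simp add: frac_le)
        with \<beta>(4)[of j x] N show "dist (\<beta> j x) (\<alpha> x) < e" by (simp add: dist_norm)
      qed
    qed
  qed (use \<beta> \<alpha> in auto)
  then show ?thesis using \<beta>(2) by (intro LIMSEQ_le_const) auto
qed

section \<open>Products with powers of a continuous form\<close>

definition unit_mat :: "'n::finite \<Rightarrow> 'n \<Rightarrow> real^'n^'n" where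
  "unit_mat i j = (\<chi> k l. if k = i \<and> l = j then 1 else 0)"

lemma mat_expand: "m = (\<Sum>i\<in>UNIV. \<Sum>j\<in>UNIV. m $ i $ j *\<^sub>R unit_mat i j)"
proof -
  have delta: "(\<Sum>j\<in>UNIV. (if j = l then f j else 0)) = f l" for f :: "'a \<Rightarrow> real" and l by simp
  have "(\<Sum>j\<in>UNIV. m $ i $ j * (if k = i \<and> l = j then 1 else 0)) = (if i = k then m $ i $ l else 0)" for i k l
    using delta[of l "\<lambda>j. if i = k then m $ i $ j else 0"]
    by (cases "i = k") (auto simp: if_distrib[of "(*) _"] eq_commute cong: if_cong)
  then show ?thesis
    by (simp add: vec_eq_iff unit_mat_def)
qed

lemma lmul_unit_mat:
  "lmul (unit_mat i j) c $ (K, L) =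
     (if i \<in> K \<and> j \<in> L then super_sign {i} {j} (K - {i}) (L - {j}) * c $ (K - {i}, L - {j}) else 0)"
proof -
  define t where "t k l = super_sign {k} {l} (K - {k}) (L - {l}) * c $ (K - {k}, L - {l})" for k l
  have "lmul (unit_mat i j) c $ (K, L) = (\<Sum>k\<in>K. \<Sum>l\<in>L. if k = i then (if l = j then t k l else 0) else 0)"
    unfolding lmul_def vec_lambda_beta fst_conv snd_conv
    by (intro sum.cong refl) (simp add: unit_mat_def t_def)
  also have "\<dots> = (\<Sum>k\<in>K. if k = i then (\<Sum>l\<in>L. if l = j then t k l else 0) else 0)"
    by (intro sum.cong refl) simp
  also have "\<dots> = (if i \<in> K \<and> j \<in> L then t i j else 0)" by simp
  finally show ?thesis by (simp only: t_def)
qed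

lemma card_Compl_singleton: "card (- {i}) = CARD('n) - 1" for i :: "'n::finite"
  by (simp add: Compl_eq_Diff_UNIV card_Diff_singleton)

lemma pairing_zero_form:
  fixes U :: "'n::{finite,linorder} current"
  assumes "\<And>A B. U A B (\<lambda>_. 0) = 0"
  shows "pairing U (zero_form f) = vol_sign TYPE('n) * U UNIV UNIV f"
proof -
  have "super_sign A B (- A) (- B) * U A B (zero_form f (- A) (- B))
      = (if A = UNIV \<and> B = UNIV then U UNIV UNIV f else 0)" for A B
  proof (cases "A = UNIV \<and> B = UNIV")
    case True then show ?thesis by (simp add: zero_form_def super_sign_def)
  next
    case False
    then have "\<not> (- A = {} \<and> - B = {})" by auto
    then have "zero_form f (- A) (- B) = (\<lambda>_. 0)" by (auto simp: zero_form_def)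
    then show ?thesis unfolding if_not_P[OF False] using assms by simp
  qed
  note eqn = this
  have "(\<Sum>A\<in>UNIV. \<Sum>B\<in>UNIV. super_sign A B (- A) (- B) * U A B (zero_form f (- A) (- B)))
    = (\<Sum>A\<in>(UNIV :: 'n set set). \<Sum>B\<in>(UNIV :: 'n set set). if A = UNIV \<and> B = UNIV then U UNIV UNIV f else 0)"
    by (rule sum.cong[OF refl], rule sum.cong[OF refl], rule eqn)
  also have "\<dots> = (\<Sum>A\<in>(UNIV :: 'n set set). if A = UNIV then \<Sum>B\<in>(UNIV :: 'n set set). if B = UNIV then U UNIV UNIV f else 0 else 0)"
    by (intro sum.cong refl) simp
  also have "\<dots> = U UNIV UNIV f" by simp
  finally show ?thesis by (simp add: pairing_def)
qed

lemma current_wedge_top: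
  fixes T :: "'n::{finite,linorder} current"
  shows "vol_sign TYPE('n) * current_wedge T \<alpha> UNIV UNIV f = pairing T (to_form (\<lambda>x. f x *\<^sub>R form_at \<alpha> x))"
  by (simp add: current_wedge_def pairing_def to_form_def form_at_def Compl_eq_Diff_UNIV mult.commute)

text \<open>Equal to \<open>super_sign {i} {j} (- {i}) (- {j})\<close>, the sign of dx_i \<and>
  d\<xi>_j against the complementary element. It is also the sign with which \<open>dd_sharp\<close>
  lets the component (- {i}, - {j}) contribute to the top one.\<close>

definition kap :: "'n::{finite,linorder} \<Rightarrow> 'n \<Rightarrow> real" where
  "kap i j = (-1) ^ (CARD('n) - 1) * shuffle_sign {i} (- {i}) * shuffle_sign {j} (- {j})"

lemma kap_commute: "kap i j = kap j i" by (simp add: kap_def)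

text \<open>The sign comparison between pairing with (dx_i \<and> d\<xi>_j) \<and> \<alpha> and
  taking the component (- {i}, - {j}) of a product with \<alpha>: the same three factors are brought
  to increasing order in two ways.\<close>

lemma super_sign_kap:
  fixes A B :: "'n::{finite,linorder} set"
  assumes "i \<notin> A" "j \<notin> B"
  shows "super_sign A B (- A) (- B) * super_sign {i} {j} (- A - {i}) (- B - {j})
     = kap i j * super_sign A B (- {i} - A) (- {j} - B)"
proof -
  define A' B' where "A' = - A - {i}" and "B' = - B - {j}"
  have A: "- A = {i} \<union> A'" "- {i} - A = A'" "- {i} = A \<union> A'" "i \<notin> A'" "A \<inter> A' = {}"
    and B: "- B = {j} \<union> B'" "- {j} - B = B'" "- {j} = B \<union> B'" "j \<notin> B'" "B \<inter> B' = {}"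
    using assms by (auto simp: A'_def B'_def)
  have n: "CARD('n) - 1 = card A + card A'"
  proof -
    have "card (- {i}) = card A + card A'" unfolding A(3) by (rule card_Un_disjoint) (use A(5) in auto)
    moreover have "card (- {i}) = CARD('n) - 1" by (rule card_Compl_singleton)
    ultimately show ?thesis by simp
  qed
  have s: "(-1) ^ k * ((-1) ^ k * t) = (t::real)" for k t
    by (simp add: mult.assoc[symmetric] power_mult_distrib[symmetric])
  have sA: "shuffle_sign A (- A) = (-1) ^ card A * shuffle_sign {i} A * shuffle_sign A A'"
    "shuffle_sign {i} (- {i}) = shuffle_sign {i} A * shuffle_sign {i} A'"
    unfolding A(1,3) using shuffle_sign_Un(1)[of "{i}" A' A] shuffle_sign_Un(1)[OF A(5), of "{i}"]
      shuffle_sign_swap[of A "{i}"] A(4) assms(1) by (simp_all add: mult_ac)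
  have sB: "shuffle_sign B (- B) = (-1) ^ card B * shuffle_sign {j} B * shuffle_sign B B'"
    "shuffle_sign {j} (- {j}) = shuffle_sign {j} B * shuffle_sign {j} B'"
    unfolding B(1,3) using shuffle_sign_Un(1)[of "{j}" B' B] shuffle_sign_Un(1)[OF B(5), of "{j}"]
      shuffle_sign_swap[of B "{j}"] B(4) assms(2) by (simp_all add: mult_ac)
  have cA: "card (- A) = Suc (card A')" unfolding A(1) using A(4) by simp
  show ?thesis
    unfolding super_sign_def kap_def sA sB n A(2) B(2) cA A'_def[symmetric] B'_def[symmetric]
    by (simp add: power_add mult_ac s)
qed

text \<open>A component of T \<and> \<alpha> that misses i and j is read off by multiplying with the
  missing factor dx_i \<and> d\<xi>_j.\<close>

lemma current_wedge_codim1: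
  fixes T :: "'n::{finite,linorder} current"
  assumes D: "\<And>K L. distribution (T K L)" and sm: "\<And>K L. smooth (\<alpha> K L)" and f: "test_fun f"
  shows "vol_sign TYPE('n) * (kap i j * current_wedge T \<alpha> (- {i}) (- {j}) f)
     = pairing T (to_form (\<lambda>x. f x *\<^sub>R lmul (unit_mat i j) (form_at \<alpha> x)))"
proof -
  have "super_sign A B (- A) (- B) * T A B (\<lambda>x. f x * lmul (unit_mat i j) (form_at \<alpha> x) $ (- A, - B))
    = (if i \<notin> A \<and> j \<notin> B then kap i j * (super_sign A B (- {i} - A) (- {j} - B)
        * T A B (\<lambda>x. \<alpha> (- {i} - A) (- {j} - B) x * f x)) else 0)" for A B
  proof (cases "i \<notin> A \<and> j \<notin> B")
    case True
    have eq: "- A - {i} = - {i} - A" "- B - {j} = - {j} - B" by auto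
    have "T A B (\<lambda>x. f x * lmul (unit_mat i j) (form_at \<alpha> x) $ (- A, - B))
      = T A B (\<lambda>x. super_sign {i} {j} (- A - {i}) (- B - {j}) * (\<alpha> (- {i} - A) (- {j} - B) x * f x))"
      using True by (simp add: lmul_unit_mat form_at_def eq mult_ac)
    also have "\<dots> = super_sign {i} {j} (- A - {i}) (- B - {j}) * T A B (\<lambda>x. \<alpha> (- {i} - A) (- {j} - B) x * f x)"
      by (intro distribution_cmult D test_fun_mult sm f)
    finally show ?thesis
      using True super_sign_kap[of i A j B] by (simp add: mult.assoc[symmetric])
  next
    case False
    then have "lmul (unit_mat i j) (form_at \<alpha> x) $ (- A, - B) = 0" for x
      unfolding lmul_unit_mat by auto
    then show ?thesis using False distribution_zero[OF D, of A B] by auto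
  qed
  then have "pairing T (to_form (\<lambda>x. f x *\<^sub>R lmul (unit_mat i j) (form_at \<alpha> x)))
    = vol_sign TYPE('n) * (\<Sum>A\<in>UNIV. \<Sum>B\<in>UNIV. if i \<notin> A \<and> j \<notin> B then
        kap i j * (super_sign A B (- {i} - A) (- {j} - B)
        * T A B (\<lambda>x. \<alpha> (- {i} - A) (- {j} - B) x * f x)) else 0)"
    by (simp add: pairing_def to_form_def)
  also have "(\<Sum>A\<in>UNIV. \<Sum>B\<in>UNIV. if i \<notin> A \<and> j \<notin> B then
        kap i j * (super_sign A B (- {i} - A) (- {j} - B)
        * T A B (\<lambda>x. \<alpha> (- {i} - A) (- {j} - B) x * f x)) else 0)
     = (\<Sum>A\<in>Pow (- {i}). \<Sum>B\<in>Pow (- {j}). kap i j * (super_sign A B (- {i} - A) (- {j} - B)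
        * T A B (\<lambda>x. \<alpha> (- {i} - A) (- {j} - B) x * f x)))"
    by (rule sum.mono_neutral_cong_right) (auto intro!: sum.mono_neutral_cong_right sum.neutral)
  finally show ?thesis by (simp add: current_wedge_def sum_distrib_left)
qed

text \<open>Transposing the index sets exchanges the two shuffle signs. The factor (-1) ^ (card B *
  card A') of \<open>super_sign\<close> survives because the complementary sets also have equal
  cardinalities.\<close>

lemma current_wedge_symmetric:
  fixes T :: "'n::{finite,linorder} current"
  assumes T: "is_current a a T" "symmetric_current T" and sm: "\<And>K L. smooth (\<alpha> K L)"
    and \<alpha>: "\<And>K L. \<alpha> K L = \<alpha> L K" and f: "test_fun f" and c: "card K = card L"
  shows "current_wedge T \<alpha> K L f = current_wedge T \<alpha> L K f"
proof -
  have "current_wedge T \<alpha> L K f = (\<Sum>B\<in>Pow K. \<Sum>A\<in>Pow L. super_sign A B (L - A) (K - B) * T A B (\<lambda>x. \<alpha> (L - A) (K - B) x * f x))"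
    unfolding current_wedge_def by (rule sum.swap)
  also have "\<dots> = current_wedge T \<alpha> K L f"
    unfolding current_wedge_def
  proof (intro sum.cong refl)
    fix A B assume AB: "A \<in> Pow K" "B \<in> Pow L"
    have t: "test_fun (\<lambda>x. \<alpha> (K - A) (L - B) x * f x)" by (intro test_fun_mult sm f)
    show "super_sign B A (L - B) (K - A) * T B A (\<lambda>x. \<alpha> (L - B) (K - A) x * f x)
      = super_sign A B (K - A) (L - B) * T A B (\<lambda>x. \<alpha> (K - A) (L - B) x * f x)"
    proof (cases "card A = a \<and> card B = a")
      case True
      then have "card (K - A) = card (L - B)" using AB c by (simp add: card_Diff_subset finite_subset)
      then have "super_sign B A (L - B) (K - A) = super_sign A B (K - A) (L - B)"
        using True by (simp add: super_sign_def mult_ac)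
      moreover have "T B A (\<lambda>x. \<alpha> (K - A) (L - B) x * f x) = T A B (\<lambda>x. \<alpha> (K - A) (L - B) x * f x)"
        using T(2) t by (simp add: symmetric_current_def)
      ultimately show ?thesis by (simp add: \<alpha>[of "L - B"])
    next
      case False
      then have "T A B (\<lambda>x. \<alpha> (K - A) (L - B) x * f x) = 0" "T B A (\<lambda>x. \<alpha> (K - A) (L - B) x * f x) = 0"
        using T(1) t unfolding is_current_def by blast+
      then show ?thesis by (simp add: \<alpha>[of "L - B"])
    qed
  qed
  finally show ?thesis by simp
qed

lemma smooth_zero_form: "smooth f \<Longrightarrow> smooth (zero_form f K L)"
  by (simp add: zero_form_def smooth_const)

lemma smooth_wedge: "(\<And>K L. smooth (\<alpha> K L)) \<Longrightarrow> (\<And>K L. smooth (\<beta> K L)) \<Longrightarrow> smooth (wedge \<alpha> \<beta> K L)"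
  unfolding wedge_def by (intro smooth_sum smooth_mult smooth_const)

lemma smooth_wedge_pow: "(\<And>K L. smooth (\<omega> K L)) \<Longrightarrow> smooth (wedge_pow \<omega> q K L)"
  by (induction q arbitrary: K L) (simp_all add: smooth_zero_form smooth_const smooth_wedge)

lemma bidegree_wedge_pow_symmetric:
  assumes "bidegree_form 1 1 \<omega>" "symmetric_form \<omega>"
  shows "wedge_pow \<omega> q K L = wedge_pow \<omega> q L K"
proof -
  have z: "\<omega> A B = (\<lambda>_. 0)" if "card A \<noteq> 1 \<or> card B \<noteq> 1" for A B
    using assms(1) that unfolding bidegree_form_def by blast
  \<comment> \<open>Components with unequal cardinalities vanish, which leaves the case where
    transposition preserves the sign.\<close>
  have b: "wedge_pow \<omega> q K L = (\<lambda>_. 0)" if "card K \<noteq> card L" for K L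
    using that
  proof (induction q arbitrary: K L)
    case 0 then show ?case by (auto simp: zero_form_def)
  next
    case (Suc q)
    have "\<omega> A B x * wedge_pow \<omega> q (K - A) (L - B) x = 0" if "A \<subseteq> K" "B \<subseteq> L" for A B x
    proof (cases "card A = 1 \<and> card B = 1")
      case True
      have "card A \<le> card K" "card B \<le> card L" using that by (simp_all add: card_mono)
      then have "card (K - A) \<noteq> card (L - B)" using True Suc.prems that by (auto simp: card_Diff_subset finite_subset)
      then show ?thesis by (simp add: Suc.IH)
    qed (auto simp: z)
    then show ?case by (auto simp: wedge_def fun_eq_iff mult.assoc intro!: sum.neutral)
  qed
  show ?thesis
  proof (cases "card K = card L")
    case True
    then show ?thesis
    proof (induction q arbitrary: K L)
      case 0 then show ?case by (auto simp: zero_form_def)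
    next
      case (Suc q)
      have "wedge_pow \<omega> (Suc q) L K x = wedge_pow \<omega> (Suc q) K L x" for x
      proof -
        have "wedge_pow \<omega> (Suc q) L K x = (\<Sum>B\<in>Pow K. \<Sum>A\<in>Pow L. super_sign A B (L - A) (K - B) * \<omega> A B x * wedge_pow \<omega> q (L - A) (K - B) x)"
          by (simp add: wedge_def) (rule sum.swap)
        also have "\<dots> = wedge_pow \<omega> (Suc q) K L x"
          unfolding wedge_pow.simps wedge_def
        proof (intro sum.cong refl)
          fix A B assume AB: "A \<in> Pow K" "B \<in> Pow L"
          show "super_sign B A (L - B) (K - A) * \<omega> B A x * wedge_pow \<omega> q (L - B) (K - A) x
             = super_sign A B (K - A) (L - B) * \<omega> A B x * wedge_pow \<omega> q (K - A) (L - B) x"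
          proof (cases "card A = 1 \<and> card B = 1")
            case True
            then have cc: "card (K - A) = card (L - B)" using AB Suc.prems by (simp add: card_Diff_subset finite_subset)
            then have "super_sign B A (L - B) (K - A) = super_sign A B (K - A) (L - B)"
              using True by (simp add: super_sign_def mult_ac)
            moreover have "\<omega> B A = \<omega> A B" using assms(2) by (simp add: symmetric_form_def)
            ultimately show ?thesis by (simp add: Suc.IH[OF cc])
          qed (auto simp: z)
        qed
        finally show ?thesis .
      qed
      then show ?case by auto
    qed
  qed (simp add: b)
qed

section \<open>Limits along smooth approximations\<close>

lemma continuous_pw:
  assumes "continuous_on S (\<lambda>x. m x)" shows "continuous_on S (\<lambda>x. pw (m x) q)"
  by (induction q) (simp_all add: pw_0 pw_Suc bounded_bilinear.continuous_on[OF bounded_bilinear_lmul] assms)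

text \<open>Products preserve uniform convergence when the limits are bounded; compactness and
  continuity provide this at each step of the induction.\<close>

lemma uniform_limit_pw:
  assumes m: "uniform_limit C mk m sequentially" "continuous_on C m" and C: "compact C"
  shows "uniform_limit C (\<lambda>k x. pw (mk k x) q) (\<lambda>x. pw (m x) q) sequentially"
proof (induction q)
  case (Suc q)
  have "bounded (m ` C)" "bounded ((\<lambda>x. pw (m x) q) ` C)"
    using compact_imp_bounded[OF compact_continuous_image] m(2) C continuous_pw by blast+
  with Suc show ?case
    unfolding pw_Suc by (intro bounded_bilinear.bounded_uniform_limit[OF bounded_bilinear_lmul] m(1))
qed (simp add: pw_0 uniform_limit_const)

lemma uniform_limit_sum':
  fixes f :: "'i \<Rightarrow> 'b \<Rightarrow> 'c \<Rightarrow> 'd::real_normed_vector"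
  assumes "\<And>i. i \<in> I \<Longrightarrow> uniform_limit X (f i) (l i) F"
  shows "uniform_limit X (\<lambda>n x. \<Sum>i\<in>I. f i n x) (\<lambda>x. \<Sum>i\<in>I. l i x) F"
  using assms
  by (induction I rule: infinite_finite_induct) (auto intro!: uniform_limit_const uniform_limit_add)

lemma uniform_limit_mat_of:
  assumes "\<And>i j. uniform_limit C (\<lambda>k. \<omega>' k {i} {j}) (\<omega> {i} {j}) sequentially"
  shows "uniform_limit C (\<lambda>k x. mat_of (\<omega>' k) x) (mat_of \<omega>) sequentially"
proof -
  have c: "mat_of \<alpha> x $ i $ j = \<alpha> {i} {j} x" for \<alpha> x i j by (simp add: mat_of_def)
  have e: "mat_of \<alpha> = (\<lambda>x. \<Sum>i\<in>UNIV. \<Sum>j\<in>UNIV. \<alpha> {i} {j} x *\<^sub>R unit_mat i j)" for \<alpha>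
    using mat_expand[of "mat_of \<alpha> x" for x] by (intro ext) (simp only: c)
  show ?thesis unfolding e
    by (intro uniform_limit_sum' bounded_linear.uniform_limit[OF bounded_linear_scaleR_left] assms)
qed

lemma smooth_approx:
  fixes v :: "real^'n::finite \<Rightarrow> real"
  assumes "Cc v" shows "\<exists>g. smooth g \<and> (\<forall>x. \<bar>g x - v x\<bar> \<le> 1 / Suc k)"
proof -
  have "uniform_limit UNIV (\<lambda>j. conv v (moll j)) v sequentially"
    by (rule conv_moll_uniform_limit) (use assms in \<open>auto simp: Cc_def\<close>)
  from uniform_limitD[OF this, of "1 / Suc k"] obtain j where "\<forall>x. dist (conv v (moll j) x) (v x) < 1 / Suc k"
    unfolding eventually_sequentially by auto
  then show ?thesis
    using test_fun_smooth[OF Cc_conv_moll[OF assms, of j]]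
    by (intro exI[of _ "conv v (moll j)"]) (auto simp: dist_real_def less_imp_le)
qed

text \<open>Names the sequences over which the description in \<open>current_wedge_pow\<close>
  ranges.\<close>

definition admissible :: "'n::finite form \<Rightarrow> (nat \<Rightarrow> 'n form) \<Rightarrow> bool" where
  "admissible \<omega> \<omega>' \<longleftrightarrow>
     (\<forall>k. smooth_form (\<omega>' k) \<and> bidegree_form 1 1 (\<omega>' k) \<and> symmetric_form (\<omega>' k)) \<and>
     (\<forall>A B C. compact C \<longrightarrow> uniform_limit C (\<lambda>k. \<omega>' k A B) (\<omega> A B) sequentially)"

text \<open>Without an admissible sequence every number would satisfy the description in
  \<open>current_wedge_pow\<close> vacuously.\<close>

lemma admissible_exists:
  fixes \<omega> :: "'n::{finite,linorder} form"
  assumes c: "\<And>A B. continuous_on UNIV (\<omega> A B)" and b: "bidegree_form 1 1 \<omega>" and s: "symmetric_form \<omega>"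
  shows "\<exists>\<omega>'. admissible \<omega> \<omega>'"
proof -
  have "\<exists>\<theta>::real^'n::{finite,linorder} \<Rightarrow> real. Cc \<theta> \<and> (\<forall>x\<in>cball 0 (real k). \<theta> x = 1)" for k
    using Cc_cutoff[OF bounded_cball[of "0::real^'n::{finite,linorder}" "real k"]] by metis
  then obtain \<theta> where \<theta>: "\<And>k. Cc (\<theta> k :: real^'n::{finite,linorder} \<Rightarrow> real)" "\<And>k x. norm x \<le> real k \<Longrightarrow> \<theta> k x = 1"
    by (metis mem_cball_0)
  \<comment> \<open>The choice depends on v and k, not on A and B. Equal coefficients thus get equal
    approximations, and \<omega>' inherits the symmetry of \<omega>.\<close>
  define F where "F v k = (SOME g. smooth g \<and> (\<forall>x. \<bar>g x - v x\<bar> \<le> 1 / Suc k))"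
    for v :: "real^'n::{finite,linorder} \<Rightarrow> real" and k
  have F: "smooth (F v k) \<and> (\<forall>x. \<bar>F v k x - v x\<bar> \<le> 1 / Suc k)" if "Cc v" for v k
    unfolding F_def by (rule someI_ex[OF smooth_approx[OF that]])
  define \<omega>' where "\<omega>' k A B = (if card A = 1 \<and> card B = 1 then F (\<lambda>x. \<theta> k x * \<omega> A B x) k else (\<lambda>_. 0))" for k A B
  have Cv: "Cc (\<lambda>x. \<theta> k x * \<omega> A B x)" for k A B
    using Cc_mult[OF c \<theta>(1), of A B k] by (simp add: mult.commute)
  have "smooth_form (\<omega>' k)" for k
    using F[OF Cv] by (auto simp: smooth_form_def \<omega>'_def smooth_const)
  moreover have "bidegree_form 1 1 (\<omega>' k)" for k
    by (auto simp: bidegree_form_def \<omega>'_def)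
  moreover have "symmetric_form (\<omega>' k)" for k
    using s by (auto simp: symmetric_form_def \<omega>'_def)
  moreover have "uniform_limit C (\<lambda>k. \<omega>' k A B) (\<omega> A B) sequentially" if C: "compact C" for A B C
  proof (cases "card A = 1 \<and> card B = 1")
    case True
    obtain r where r: "\<And>x. x \<in> C \<Longrightarrow> norm x \<le> r" using compact_imp_bounded[OF C] by (auto simp: bounded_iff)
    show ?thesis
    proof (rule uniform_limitI)
      fix e :: real assume "0 < e"
      then obtain N where N: "1 / Suc N < e" using nat_approx_posE by blast
      show "\<forall>\<^sub>F k in sequentially. \<forall>x\<in>C. dist (\<omega>' k A B x) (\<omega> A B x) < e"
      proof (rule eventually_sequentiallyI[of "max N (nat \<lceil>r\<rceil>)"], rule ballI)
        fix k x assume k: "max N (nat \<lceil>r\<rceil>) \<le> k" and x: "x \<in> C"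
        have "r \<le> real k" using k by linarith
        with r[OF x] have "\<theta> k x = 1" by (intro \<theta>(2)) simp
        have "\<bar>F (\<lambda>x. \<theta> k x * \<omega> A B x) k x - \<theta> k x * \<omega> A B x\<bar> \<le> 1 / Suc k"
          using F[OF Cv] by blast
        then have "\<bar>\<omega>' k A B x - \<omega> A B x\<bar> \<le> 1 / Suc k"
          unfolding \<open>\<theta> k x = 1\<close> using True by (simp add: \<omega>'_def)
        also have "\<dots> \<le> 1 / Suc N" using k by (simp add: frac_le)
        finally show "dist (\<omega>' k A B x) (\<omega> A B x) < e" using N by (simp add: dist_real_def)
      qed
    qed
  next
    case False
    then have "\<omega> A B = (\<lambda>_. 0)" using b unfolding bidegree_form_def by blast
    moreover have "(\<lambda>k. \<omega>' k A B) = (\<lambda>_ _. 0)" using False by (auto simp: \<omega>'_def)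
    ultimately show ?thesis by (simp add: uniform_limit_const)
  qed
  ultimately show ?thesis unfolding admissible_def by blast
qed

lemma current_wedge_pow_eqI:
  assumes ex: "\<exists>\<omega>'. admissible \<omega> \<omega>'"
    and lim: "\<And>\<omega>'. admissible \<omega> \<omega>' \<Longrightarrow> (\<lambda>k. current_wedge T (wedge_pow (\<omega>' k) q) K L f) \<longlonglongrightarrow> l"
  shows "current_wedge_pow T \<omega> q K L f = l"
proof -
  have "current_wedge_pow T \<omega> q K L f
    = (THE l. \<forall>\<omega>'. admissible \<omega> \<omega>' \<longrightarrow> (\<lambda>k. current_wedge T (wedge_pow (\<omega>' k) q) K L f) \<longlonglongrightarrow> l)"
    unfolding current_wedge_pow_def admissible_def imp_conjL ..
  also have "\<dots> = l"
  proof (rule the_equality)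
    obtain \<omega>' where w: "admissible \<omega> \<omega>'" using ex by blast
    fix l' assume "\<forall>\<omega>'. admissible \<omega> \<omega>' \<longrightarrow> (\<lambda>k. current_wedge T (wedge_pow (\<omega>' k) q) K L f) \<longlonglongrightarrow> l'"
    with w have "(\<lambda>k. current_wedge T (wedge_pow (\<omega>' k) q) K L f) \<longlonglongrightarrow> l'" by blast
    from LIMSEQ_unique[OF this lim[OF w]] show "l' = l" .
  qed (use lim in blast)
  finally show ?thesis .
qed

lemma current_wedge_pow_zero:
  assumes D: "\<And>K L. distribution (T K L)" and ex: "\<exists>\<omega>'. admissible \<omega> \<omega>'"
  shows "current_wedge_pow T \<omega> q K L (\<lambda>_. 0) = 0"
  by (rule current_wedge_pow_eqI[OF ex]) (simp add: current_wedge_def distribution_zero[OF D])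

lemma lmul_smooth:
  assumes "\<And>KL. smooth (\<lambda>x. \<beta> x $ KL)" shows "smooth (\<lambda>x. lmul m (\<beta> x) $ KL)"
  unfolding lmul_def by (simp, intro smooth_sum smooth_mult smooth_const assms)

text \<open>The linear map \<open>l\<close> is the identity for the top component and multiplication
  by \<open>sym_unit i j\<close> for a component of codimension one. The approximating integrands
  take values in the span, so the pairing equals \<open>LL\<close> there, and \<open>LL\<close>
  passes to the uniform limit.\<close>

lemma order_zero_extension_lim:
  fixes T :: "'n::{finite,linorder} current"
  assumes LL: "order_zero_extension p T LL" and w: "admissible \<omega> \<omega>'"
    and c: "\<And>i j. continuous_on UNIV (\<omega> {i} {j})" and f: "test_fun f"
    and l: "linear l" and sp: "\<And>m. (\<And>i j. m $ i $ j = m $ j $ i) \<Longrightarrow> l (pw m q) \<in> span (range (\<lambda>a. sp a p))"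
    and ls: "\<And>(\<beta> :: real^'n::{finite,linorder} \<Rightarrow> 'n ext) KL. (\<And>KL. smooth (\<lambda>x. \<beta> x $ KL)) \<Longrightarrow> smooth (\<lambda>x. l (\<beta> x) $ KL)"
  shows "(\<lambda>k. pairing T (to_form (\<lambda>x. f x *\<^sub>R l (form_at (wedge_pow (\<omega>' k) q) x))))
     \<longlonglongrightarrow> LL (\<lambda>x. f x *\<^sub>R l (pw (mat_of \<omega> x) q))"
proof -
  have w1: "bidegree_form 1 1 (\<omega>' k)" "symmetric_form (\<omega>' k)" "smooth (\<omega>' k K L)" for k K L
    using w by (auto simp: admissible_def smooth_form_def)
  have fa: "form_at (wedge_pow (\<omega>' k) q) x = pw (mat_of (\<omega>' k) x) q" for k x
    by (rule form_at_wedge_pow[OF w1(1)])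
  have bl: "bounded_linear l" using l by (simp add: linear_conv_bounded_linear)
  have t: "test_ext (\<lambda>x. f x *\<^sub>R l (pw (mat_of (\<omega>' k) x) q))" for k
  proof -
    have "smooth (\<lambda>x. form_at (wedge_pow (\<omega>' k) q) x $ KL)" for KL
      unfolding form_at_def by (simp add: smooth_wedge_pow w1)
    from ls[of "\<lambda>x. form_at (wedge_pow (\<omega>' k) q) x", OF this] show ?thesis unfolding test_ext_def fa by (simp add: test_fun_mult' f)
  qed
  have eq: "pairing T (to_form (\<lambda>x. f x *\<^sub>R l (form_at (wedge_pow (\<omega>' k) q) x)))
     = LL (\<lambda>x. f x *\<^sub>R l (pw (mat_of (\<omega>' k) x) q))" for k
  proof -
    have "mat_of (\<omega>' k) x $ i $ j = mat_of (\<omega>' k) x $ j $ i" for x i j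
      using w1(2)[of k] by (simp add: mat_of_def symmetric_form_def)
    then have "f x *\<^sub>R l (pw (mat_of (\<omega>' k) x) q) \<in> span (range (\<lambda>a. sp a p))" for x
      by (intro span_scale sp)
    with t LL show ?thesis unfolding fa order_zero_extension_def by simp
  qed
  obtain r where r: "\<And>x. f x \<noteq> 0 \<Longrightarrow> norm x \<le> r"
    using f by (auto simp: test_fun_def bounded_iff)
  have mc: "continuous_on UNIV (mat_of \<omega>)"
    unfolding mat_of_def by (intro continuous_on_vec_lambda c)
  have lc: "continuous_on UNIV (\<lambda>x. l (pw (mat_of \<omega> x) q))"
    by (intro bounded_linear.continuous_on[OF bl] continuous_pw mc)
  have Cc: "Cc (\<lambda>x. f x *\<^sub>R l (pw (mat_of \<omega> x) q))"
    using test_fun_Cc[OF f] lc unfolding Cc_def by (auto intro!: continuous_intros elim: bounded_subset)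
  have fb: "bounded (f ` cball 0 r)"
    using compact_imp_bounded[OF compact_continuous_image] test_fun_Cc[OF f] unfolding Cc_def
    by (metis compact_cball continuous_on_subset subset_UNIV)
  have u: "uniform_limit (cball 0 r) (\<lambda>k x. f x *\<^sub>R l (pw (mat_of (\<omega>' k) x) q)) (\<lambda>x. f x *\<^sub>R l (pw (mat_of \<omega> x) q)) sequentially"
  proof (rule bounded_bilinear.bounded_uniform_limit[OF bounded_bilinear_scaleR])
    show "uniform_limit (cball 0 r) (\<lambda>_. f) f sequentially" by (rule uniform_limit_const)
    show "uniform_limit (cball 0 r) (\<lambda>k x. l (pw (mat_of (\<omega>' k) x) q)) (\<lambda>x. l (pw (mat_of \<omega> x) q)) sequentially"
      using w continuous_on_subset[OF mc] unfolding admissible_def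
      by (intro bounded_linear.uniform_limit[OF bl] uniform_limit_pw uniform_limit_mat_of) auto
    show "bounded ((\<lambda>x. l (pw (mat_of \<omega> x) q)) ` cball 0 r)"
      by (intro compact_imp_bounded compact_continuous_image continuous_on_subset[OF lc]) auto
    show "bounded (f ` cball 0 r)" by (rule fb)
  qed
  have u': "uniform_limit UNIV (\<lambda>k x. f x *\<^sub>R l (pw (mat_of (\<omega>' k) x) q)) (\<lambda>x. f x *\<^sub>R l (pw (mat_of \<omega> x) q)) sequentially"
  proof (rule uniform_limitI)
    fix e :: real assume e: "0 < e"
    from uniform_limitD[OF u e]
    show "\<forall>\<^sub>F k in sequentially. \<forall>x\<in>UNIV. dist (f x *\<^sub>R l (pw (mat_of (\<omega>' k) x) q)) (f x *\<^sub>R l (pw (mat_of \<omega> x) q)) < e"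
    proof eventually_elim
      case (elim k)
      show ?case
      proof
        fix x show "dist (f x *\<^sub>R l (pw (mat_of (\<omega>' k) x) q)) (f x *\<^sub>R l (pw (mat_of \<omega> x) q)) < e"
          using elim r[of x] e by (cases "f x = 0") auto
      qed
    qed
  qed
  note lim = order_zero_extensionD(4)[OF LL]
  show ?thesis unfolding eq
    by (rule lim[OF test_ext_Cc[OF t] Cc _ _ u', of r]) (use r in auto)
qed

lemma current_wedge_pow_top:
  fixes T :: "'n::{finite,linorder} current"
  assumes T: "weakly_positive p T" and LL: "order_zero_extension p T LL"
    and c: "\<And>A B. continuous_on UNIV (\<omega> A B)" and b: "bidegree_form 1 1 \<omega>" and s: "symmetric_form \<omega>"
    and f: "test_fun f"
  shows "pairing (current_wedge_pow T \<omega> p) (zero_form f) = LL (\<lambda>x. f x *\<^sub>R pw (mat_of \<omega> x) p)"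
proof -
  let ?v = "vol_sign TYPE('n)"
  have v: "?v * ?v = 1" by (simp add: vol_sign_def power_mult_distrib[symmetric])
  note ex = admissible_exists[OF c b s] and D = weakly_positive_distribution[OF T]
  have "current_wedge_pow T \<omega> p UNIV UNIV f = ?v * LL (\<lambda>x. f x *\<^sub>R pw (mat_of \<omega> x) p)"
  proof (rule current_wedge_pow_eqI[OF ex])
    fix \<omega>' assume w: "admissible \<omega> \<omega>'"
    have "(\<lambda>k. pairing T (to_form (\<lambda>x. f x *\<^sub>R form_at (wedge_pow (\<omega>' k) p) x))) \<longlonglongrightarrow> LL (\<lambda>x. f x *\<^sub>R pw (mat_of \<omega> x) p)"
      by (rule order_zero_extension_lim[OF LL w c f, of "\<lambda>x. x"]) (auto simp: linear_iff intro: pw_sym_span)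
    from tendsto_mult_left[OF this, of ?v]
    show "(\<lambda>k. current_wedge T (wedge_pow (\<omega>' k) p) UNIV UNIV f) \<longlonglongrightarrow> ?v * LL (\<lambda>x. f x *\<^sub>R pw (mat_of \<omega> x) p)"
      unfolding current_wedge_top[symmetric] mult.assoc[symmetric] v by simp
  qed
  then have "?v * current_wedge_pow T \<omega> p UNIV UNIV f = LL (\<lambda>x. f x *\<^sub>R pw (mat_of \<omega> x) p)"
    by (simp add: mult.assoc[symmetric] v)
  then show ?thesis
    using pairing_zero_form[of "current_wedge_pow T \<omega> p" f] current_wedge_pow_zero[OF D ex] by simp
qed

definition sym_unit :: "'n::finite \<Rightarrow> 'n \<Rightarrow> real^'n^'n" where
  "sym_unit i j = (1 / 2) *\<^sub>R (unit_mat i j + unit_mat j i)"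

text \<open>Only symmetric (1,1)-forms are controlled by \<open>T\<close>, so the components of \<open>T \<and> \<omega>^(p - 1)\<close> are
  evaluated after symmetrization, which is harmless because \<open>T\<close> is symmetric.\<close>

lemma current_wedge_pow_codim1:
  fixes T :: "'n::{finite,linorder} current"
  assumes T: "weakly_positive p T" and LL: "order_zero_extension p T LL" and p: "1 \<le> p"
    and c: "\<And>A B. continuous_on UNIV (\<omega> A B)" and b: "bidegree_form 1 1 \<omega>" and s: "symmetric_form \<omega>"
    and f: "test_fun f"
  shows "vol_sign TYPE('n) * (kap i j * current_wedge_pow T \<omega> (p - 1) (- {i}) (- {j}) f)
     = LL (\<lambda>x. f x *\<^sub>R lmul (sym_unit i j) (pw (mat_of \<omega> x) (p - 1)))"
proof -
  let ?v = "vol_sign TYPE('n)"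
  let ?l = "LL (\<lambda>x. f x *\<^sub>R lmul (sym_unit i j) (pw (mat_of \<omega> x) (p - 1)))"
  have sq: "(?v * kap i j) * (?v * kap i j) = 1"
    using shuffle_sign_square[of "{i}" "- {i}"] shuffle_sign_square[of "{j}" "- {j}"]
    by (simp add: vol_sign_def kap_def power_mult_distrib[symmetric] mult_ac)
  note ex = admissible_exists[OF c b s] and D = weakly_positive_distribution[OF T]
  have "current_wedge_pow T \<omega> (p - 1) (- {i}) (- {j}) f = (?v * kap i j) * ?l"
  proof (rule current_wedge_pow_eqI[OF ex])
    fix \<omega>' assume w: "admissible \<omega> \<omega>'"
    have w1: "bidegree_form 1 1 (\<omega>' k)" "symmetric_form (\<omega>' k)" "smooth (\<omega>' k K L)" for k K L
      using w by (auto simp: admissible_def smooth_form_def)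
    have sp: "lmul (sym_unit i j) (pw m (p - 1)) \<in> span (range (\<lambda>a. sp a p))"
      if "\<And>i j. m $ i $ j = m $ j $ i" for m
      using lmul_sym_span[OF _ pw_sym_span[OF that], of "sym_unit i j" "p - 1"] p
      by (simp add: sym_unit_def unit_mat_def add.commute conj_commute)
    have "(\<lambda>k. pairing T (to_form (\<lambda>x. f x *\<^sub>R lmul (sym_unit i j) (form_at (wedge_pow (\<omega>' k) (p - 1)) x)))) \<longlonglongrightarrow> ?l"
      by (rule order_zero_extension_lim[OF LL w c f bounded_linear.linear[OF lmul.bounded_linear_right] sp lmul_smooth])
    moreover have "pairing T (to_form (\<lambda>x. f x *\<^sub>R lmul (sym_unit i j) (form_at (wedge_pow (\<omega>' k) (p - 1)) x)))
      = ?v * (kap i j * current_wedge T (wedge_pow (\<omega>' k) (p - 1)) (- {i}) (- {j}) f)" for k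
    proof -
      let ?\<alpha> = "wedge_pow (\<omega>' k) (p - 1)"
      have sm: "smooth (?\<alpha> K L)" for K L by (intro smooth_wedge_pow w1)
      have te: "test_ext (\<lambda>x. f x *\<^sub>R lmul m (form_at ?\<alpha> x))" for m
      proof -
        have "smooth (\<lambda>x. form_at ?\<alpha> x $ KL)" for KL
          unfolding form_at_def vec_lambda_beta by (rule sm)
        from lmul_smooth[of "\<lambda>x. form_at ?\<alpha> x", OF this] show ?thesis unfolding test_ext_def by (simp add: test_fun_mult' f)
      qed
      have "?v * (kap i j * current_wedge T ?\<alpha> (- {i}) (- {j}) f) = pairing T (to_form (\<lambda>x. f x *\<^sub>R lmul (unit_mat i j) (form_at ?\<alpha> x)))"
        by (rule current_wedge_codim1[OF D sm f])
      moreover have "?v * (kap i j * current_wedge T ?\<alpha> (- {i}) (- {j}) f) = pairing T (to_form (\<lambda>x. f x *\<^sub>R lmul (unit_mat j i) (form_at ?\<alpha> x)))"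
      proof -
        have "current_wedge T ?\<alpha> (- {i}) (- {j}) f = current_wedge T ?\<alpha> (- {j}) (- {i}) f"
          using T bidegree_wedge_pow_symmetric[OF w1(1,2)] sm f unfolding weakly_positive_def
          by (intro current_wedge_symmetric[where a = "CARD('n) - p"]) (auto simp: card_Compl_singleton)
        then show ?thesis unfolding kap_commute[of i j] using current_wedge_codim1[OF D sm f, of j i] by simp
      qed
      moreover have "pairing T (to_form (\<lambda>x. f x *\<^sub>R lmul (sym_unit i j) (form_at ?\<alpha> x)))
        = 1 / 2 * (pairing T (to_form (\<lambda>x. f x *\<^sub>R lmul (unit_mat i j) (form_at ?\<alpha> x)))
           + pairing T (to_form (\<lambda>x. f x *\<^sub>R lmul (unit_mat j i) (form_at ?\<alpha> x))))"
      proof -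
        have "(\<lambda>x. f x *\<^sub>R lmul (sym_unit i j) (form_at ?\<alpha> x))
          = (\<lambda>x. (1 / 2) *\<^sub>R (f x *\<^sub>R lmul (unit_mat i j) (form_at ?\<alpha> x) + f x *\<^sub>R lmul (unit_mat j i) (form_at ?\<alpha> x)))"
          by (simp add: sym_unit_def lmul.scaleR_left lmul.add_left scaleR_add_right mult.commute)
        then show ?thesis
          using pairing_cmult[OF D test_ext_add[OF te te], where c = "1 / 2"] pairing_add[OF D te te] by simp
      qed
      ultimately show ?thesis by simp
    qed
    ultimately have "(\<lambda>k. ?v * (kap i j * current_wedge T (wedge_pow (\<omega>' k) (p - 1)) (- {i}) (- {j}) f)) \<longlonglongrightarrow> ?l" by simp
    from tendsto_mult_left[OF this, of "?v * kap i j"]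
    show "(\<lambda>k. current_wedge T (wedge_pow (\<omega>' k) (p - 1)) (- {i}) (- {j}) f) \<longlonglongrightarrow> (?v * kap i j) * ?l"
      using sq by (simp add: mult.assoc[symmetric])
  qed
  then show ?thesis using sq by (simp add: mult.assoc[symmetric])
qed

text \<open>Expanded in the matrices \<open>sym_unit\<close>, because these are the ones whose
  products with the current are known; the coefficients are the second derivatives left by
  integration by parts.\<close>

definition sym_hess :: "(real^'n::finite \<Rightarrow> real) \<Rightarrow> real^'n \<Rightarrow> real^'n^'n" where
  "sym_hess f x = (\<Sum>i\<in>UNIV. \<Sum>j\<in>UNIV. partial j (partial i f) x *\<^sub>R sym_unit i j)"

text \<open>The two minus signs from moving the derivatives onto \<open>f\<close> cancel, and the
  sign of the component (- {i}, - {j}) in \<open>dd_sharp\<close> is \<open>kap i j\<close>, as in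
  \<open>current_wedge_pow_codim1\<close>.\<close>

lemma pairing_dd_sharp:
  fixes T :: "'n::{finite,linorder} current"
  assumes T: "weakly_positive p T" and LL: "order_zero_extension p T LL" and p: "1 \<le> p"
    and c: "\<And>A B. continuous_on UNIV (\<omega> A B)" and b: "bidegree_form 1 1 \<omega>" and s: "symmetric_form \<omega>"
    and f: "test_fun f"
  shows "pairing (dd_sharp (current_wedge_pow T \<omega> (p - 1))) (zero_form f)
     = LL (\<lambda>x. lmul (sym_hess f x) (pw (mat_of \<omega> x) (p - 1)))"
proof -
  let ?v = "vol_sign TYPE('n)" and ?S = "current_wedge_pow T \<omega> (p - 1)"
  let ?P = "\<lambda>x. pw (mat_of \<omega> x) (p - 1)"
  note ex = admissible_exists[OF c b s] and D = weakly_positive_distribution[OF T]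
  have p0: "partial i (\<lambda>_. 0) = (\<lambda>_. 0)" for i :: 'n by simp
  have z: "dd_sharp ?S A B (\<lambda>_. 0) = 0" for A B
    by (simp add: ext_d_def ext_d_sharp_def dist_partial_def current_wedge_pow_zero[OF D ex])
  have "dd_sharp ?S UNIV UNIV f = (\<Sum>i\<in>UNIV. \<Sum>j\<in>UNIV. kap i j * ?S (- {i}) (- {j}) (partial j (partial i f)))"
    by (simp add: ext_d_def ext_d_sharp_def dist_partial_def kap_def Compl_eq_Diff_UNIV[symmetric] card_Compl_singleton
        sum_distrib_left sum_negf mult_ac)
  then have "pairing (dd_sharp ?S) (zero_form f)
     = (\<Sum>i\<in>UNIV. \<Sum>j\<in>UNIV. ?v * (kap i j * ?S (- {i}) (- {j}) (partial j (partial i f))))"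
    using pairing_zero_form[of "dd_sharp ?S" f] z by (simp add: sum_distrib_left)
  also have "\<dots> = (\<Sum>i\<in>UNIV. \<Sum>j\<in>UNIV. LL (\<lambda>x. partial j (partial i f) x *\<^sub>R lmul (sym_unit i j) (?P x)))"
    by (intro sum.cong refl current_wedge_pow_codim1 assms test_fun_partial)
  also have "\<dots> = LL (\<lambda>x. \<Sum>i\<in>UNIV. \<Sum>j\<in>UNIV. partial j (partial i f) x *\<^sub>R lmul (sym_unit i j) (?P x))"
  proof -
    have mc: "continuous_on UNIV (mat_of \<omega>)"
      unfolding mat_of_def by (intro continuous_on_vec_lambda c)
    have C: "Cc (\<lambda>x. partial j (partial i f) x *\<^sub>R lmul (sym_unit i j) (?P x))" for i j
    proof -
      have "Cc (partial j (partial i f))" by (intro test_fun_Cc test_fun_partial f)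
      moreover have "continuous_on UNIV (\<lambda>x. lmul (sym_unit i j) (?P x))"
        by (intro bounded_linear.continuous_on[OF lmul.bounded_linear_right] continuous_pw mc)
      ultimately show ?thesis unfolding Cc_def by (auto intro!: continuous_intros elim: bounded_subset)
    qed
    note sumL = order_zero_extension_sum[OF LL]
    have "LL (\<lambda>x. \<Sum>i\<in>UNIV. \<Sum>j\<in>UNIV. partial j (partial i f) x *\<^sub>R lmul (sym_unit i j) (?P x))
      = (\<Sum>i\<in>UNIV. LL (\<lambda>x. \<Sum>j\<in>UNIV. partial j (partial i f) x *\<^sub>R lmul (sym_unit i j) (?P x)))"
      by (rule sumL) (intro Cc_sum C)
    also have "\<dots> = (\<Sum>i\<in>UNIV. \<Sum>j\<in>UNIV. LL (\<lambda>x. partial j (partial i f) x *\<^sub>R lmul (sym_unit i j) (?P x)))"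
      by (intro sum.cong refl sumL C)
    finally show ?thesis by simp
  qed
  also have "\<dots> = LL (\<lambda>x. lmul (sym_hess f x) (?P x))"
    by (simp add: sym_hess_def lmul.sum_left lmul.scaleR_left)
  finally show ?thesis .
qed

section \<open>Second derivatives\<close>

lemma partial_local:
  assumes "open U" "x \<in> U" "\<And>y. y \<in> U \<Longrightarrow> f y = g y"
  shows "partial i f x = partial i g x"
proof -
  have "(f has_derivative D) (at x) \<longleftrightarrow> (g has_derivative D) (at x)" for D
    using has_derivative_transform_within_open[OF _ assms(1,2), of f D UNIV g]
      has_derivative_transform_within_open[OF _ assms(1,2), of g D UNIV f] assms(3) by auto
  then show ?thesis by (simp add: partial_def frechet_derivative_def)
qed

lemma partial2_local:
  assumes "open U" "x \<in> U" "\<And>y. y \<in> U \<Longrightarrow> f y = g y"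
  shows "partial j (partial i f) x = partial j (partial i g) x"
  using assms by (intro partial_local[of U]) (auto intro: partial_local[of U])

lemma partial_support: "{x. partial i f x \<noteq> 0} \<subseteq> closure {x. f x \<noteq> 0}"
proof
  fix x assume x: "x \<in> {x. partial i f x \<noteq> 0}"
  show "x \<in> closure {x. f x \<noteq> 0}"
  proof (rule ccontr)
    assume "x \<notin> closure {x. f x \<noteq> 0}"
    then have "partial i f x = partial i (\<lambda>_. 0) x"
      using closure_subset[of "{x. f x \<noteq> 0}"]
      by (intro partial_local[of "- closure {x. f x \<noteq> 0}"]) auto
    with x show False by simp
  qed
qed

lemma bounded_partial_support: "bounded {x. f x \<noteq> 0} \<Longrightarrow> bounded {x. partial i f x \<noteq> 0}"
  by (rule bounded_subset[OF bounded_closure partial_support])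

lemma C_k_2: "C_k 2 f \<longleftrightarrow> C_k (Suc (Suc 0)) f" by (simp only: numeral_2_eq_2)

lemma C_k_2D:
  assumes "C_k 2 f"
  shows "C_k (Suc 0) f" "C_k (Suc 0) (partial i f)" "continuous_on UNIV f" "continuous_on UNIV (partial i f)"
    "continuous_on UNIV (partial j (partial i f))" "f differentiable (at x)" "partial i f differentiable (at x)"
proof -
  have 2: "C_k (Suc (Suc 0)) f" using assms by (simp only: C_k_2)
  show 1: "C_k (Suc 0) f" by (rule C_k_Suc[OF 2])
  show 3: "C_k (Suc 0) (partial i f)" using 2 unfolding C_k.simps(2)[of "Suc 0" f] by blast
  show "continuous_on UNIV f" "continuous_on UNIV (partial i f)"
    using C_k_continuous 1 3 by blast+
  show "continuous_on UNIV (partial j (partial i f))" "partial i f differentiable (at x)" "f differentiable (at x)"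
    using 1 3 by simp_all
qed

lemma partial2_conv:
  fixes u :: "real^'n::finite \<Rightarrow> real"
  assumes u: "C_k 2 u" "bounded {x. u x \<noteq> 0}"
  shows "partial j (partial i (conv u (moll k))) = conv (partial j (partial i u)) (moll k)"
  by (simp only: partial_conv_left[OF C_k_2D(1)[OF u(1)] continuous_moll bounded_moll]
      partial_conv_left[OF C_k_2D(2)[OF u(1)] continuous_moll bounded_moll])

text \<open>Both mixed derivatives of a mollification can be computed by differentiating each factor once.\<close>

lemma partial_commute_Cc:
  fixes u :: "real^'n::finite \<Rightarrow> real"
  assumes u: "C_k 2 u" "bounded {x. u x \<noteq> 0}"
  shows "partial j (partial i u) x = partial i (partial j u) x"
proof -
  note uc = C_k_2D[OF u(1)]
  have m1: "C_k (Suc 0) (moll k)" for k using test_fun_smooth[OF test_fun_moll] unfolding smooth_def by blast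
  have mp: "continuous_on UNIV (partial i (moll k))" "bounded {x. partial i (moll k) x \<noteq> 0}" for i k
    using test_fun_Cc[OF test_fun_partial[OF test_fun_moll]] by (auto simp: Cc_def)
  have "partial j (partial i (conv u (moll k))) = conv (partial i u) (partial j (moll k))" for i j k
    unfolding partial_conv_left[OF uc(1) continuous_moll bounded_moll]
    by (rule partial_conv_right[OF uc(4) bounded_partial_support[OF u(2)] m1])
  moreover have "partial i (partial j (conv u (moll k))) = conv (partial i u) (partial j (moll k))" for i j k
    unfolding partial_conv_right[OF uc(3) u(2) m1]
    by (rule partial_conv_left[OF uc(1) mp])
  ultimately have eq: "conv (partial j (partial i u)) (moll k) = conv (partial i (partial j u)) (moll k)" for k
    unfolding partial2_conv[OF u, symmetric] by metis
  have lim: "(\<lambda>k. conv (partial l (partial m u)) (moll k) x) \<longlonglongrightarrow> partial l (partial m u) x" for l m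
    by (rule tendsto_uniform_limitI[OF conv_moll_uniform_limit[OF uc(5) bounded_partial_support[OF bounded_partial_support[OF u(2)]]]]) simp
  show ?thesis
    by (rule LIMSEQ_unique[OF lim[of j i, unfolded eq] lim[of i j]])
qed

text \<open>A cutoff equal to 1 near x reduces the claim to bounded support, where mollification
  applies.\<close>

lemma partial_commute:
  fixes u :: "real^'n::finite \<Rightarrow> real"
  assumes u: "C_k 2 u" shows "partial j (partial i u) x = partial i (partial j u) x"
proof -
  obtain \<theta> U where \<theta>: "test_fun \<theta>" "\<And>x. 0 \<le> \<theta> x" "\<And>x. \<theta> x \<le> 1" "open U" "{x} \<subseteq> U" "\<And>x. x \<in> U \<Longrightarrow> \<theta> x = 1"
    by (rule cutoff_exists[of "{x}"]) auto
  have c: "C_k 2 (\<lambda>x. \<theta> x * u x)"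
    using \<theta>(1) u by (intro C_k_mult) (auto simp: test_fun_def smooth_def)
  have b: "bounded {x. \<theta> x * u x \<noteq> 0}"
    by (rule bounded_subset[of "{x. \<theta> x \<noteq> 0}"]) (use \<theta>(1) in \<open>auto simp: test_fun_def\<close>)
  have "partial j (partial i u) x = partial j (partial i (\<lambda>x. \<theta> x * u x)) x" for i j
    by (rule partial2_local[OF \<theta>(4)]) (use \<theta>(5,6) in auto)
  then show ?thesis using partial_commute_Cc[OF c b] by simp
qed

section \<open>Convexity of the square root and the Hessian\<close>

definition grad :: "(real^'n::finite \<Rightarrow> real) \<Rightarrow> real^'n \<Rightarrow> real^'n" where
  "grad f x = (\<chi> i. partial i f x)"

definition hess :: "(real^'n::finite \<Rightarrow> real) \<Rightarrow> real^'n \<Rightarrow> real^'n^'n" where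
  "hess f x = (\<chi> i j. partial i (partial j f) x)"

lemma line_derivative:
  fixes f :: "real^'n::finite \<Rightarrow> real"
  assumes "\<And>x. f differentiable (at x)"
  shows "((\<lambda>t. f (x + t *\<^sub>R v)) has_real_derivative v \<bullet> grad f (x + t *\<^sub>R v)) (at t)"
proof -
  have l: "((\<lambda>t. x + t *\<^sub>R v) has_derivative (\<lambda>s. s *\<^sub>R v)) (at t)"
    by (auto intro!: derivative_eq_intros)
  have "((\<lambda>t. f (x + t *\<^sub>R v)) has_derivative (\<lambda>s. \<Sum>i\<in>UNIV. (s *\<^sub>R v) $ i * partial i f (x + t *\<^sub>R v))) (at t)"
    by (rule has_derivative_compose[OF l has_derivative_partial[OF assms]])
  moreover have "(\<lambda>s. \<Sum>i\<in>UNIV. (s *\<^sub>R v) $ i * partial i f (x + t *\<^sub>R v)) = (*) (v \<bullet> grad f (x + t *\<^sub>R v))"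
    by (simp add: fun_eq_iff grad_def inner_vec_def sum_distrib_left mult_ac)
  ultimately show ?thesis by (simp add: has_field_derivative_def)
qed

lemma line_derivative2:
  fixes f :: "real^'n::finite \<Rightarrow> real"
  assumes "C_k 2 f"
  shows "((\<lambda>t. v \<bullet> grad f (x + t *\<^sub>R v)) has_real_derivative v \<bullet> (hess f (x + t *\<^sub>R v) *v v)) (at t)"
proof -
  have "((\<lambda>t. \<Sum>i\<in>UNIV. v $ i * partial i f (x + t *\<^sub>R v)) has_real_derivative
      (\<Sum>i\<in>UNIV. v $ i * (v \<bullet> grad (partial i f) (x + t *\<^sub>R v)))) (at t)"
    by (intro DERIV_sum DERIV_cmult line_derivative C_k_2D[OF assms])
  moreover have "(\<Sum>i\<in>UNIV. v $ i * (v \<bullet> grad (partial i f) (x + t *\<^sub>R v))) = v \<bullet> (hess f (x + t *\<^sub>R v) *v v)"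
    by (simp add: grad_def hess_def inner_vec_def matrix_vector_mult_def partial_commute[OF assms] mult_ac)
  ultimately show ?thesis by (simp add: inner_vec_def[of v] grad_def)
qed

text \<open>If g'' were negative, the derivative g' t - g' (- t) of g t + g (- t) would be negative
  for small t > 0, and by the mean value theorem this function would drop below its value 2 g 0. A
  second derivative at the single point 0 suffices, which suits the square root of a C^2
  function.\<close>

lemma midpoint_second_derivative:
  fixes g :: "real \<Rightarrow> real"
  assumes d: "0 < d" and g1: "\<And>t. \<bar>t\<bar> < d \<Longrightarrow> (g has_real_derivative g' t) (at t)"
    and g2: "(g' has_real_derivative g'') (at 0)" and mid: "\<And>t. 2 * g 0 \<le> g t + g (- t)"
  shows "0 \<le> g''"
proof (rule ccontr)
  assume "\<not> 0 \<le> g''"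
  then have neg: "2 * g'' < 0" by simp
  have "((\<lambda>t. g' t - g' (- t)) has_real_derivative 2 * g'') (at 0)"
  proof -
    have "((\<lambda>t. g' (- t)) has_real_derivative g'' * (- 1)) (at 0)"
      by (rule DERIV_chain2[where g = uminus]) (use g2 in \<open>auto intro!: derivative_eq_intros\<close>)
    from DERIV_diff[OF g2 this] show ?thesis by simp
  qed
  from DERIV_neg_dec_right[OF this neg] obtain e where e: "0 < e"
    "\<And>h. 0 < h \<Longrightarrow> h < e \<Longrightarrow> g' h - g' (- h) < 0" by auto
  define t where "t = min e d / 2"
  have t: "0 < t" "t < e" "t < d" using e d by (auto simp: t_def)
  have "\<exists>z>0. z < t \<and> (g t + g (- t)) - (g 0 + g (- 0)) = (t - 0) * (g' z - g' (- z))"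
  proof (rule MVT2[OF t(1)])
    fix s assume s: "0 \<le> s" "s \<le> t"
    have "((\<lambda>t. g (- t)) has_real_derivative g' (- s) * (- 1)) (at s)"
      by (rule DERIV_chain2[where g = uminus]) (use g1[of "- s"] s t in \<open>auto intro!: derivative_eq_intros\<close>)
    from DERIV_add[OF g1[of s] this] s t
    show "((\<lambda>t. g t + g (- t)) has_real_derivative g' s - g' (- s)) (at s)" by simp
  qed
  then obtain z where z: "0 < z" "z < t" "g t + g (- t) - 2 * g 0 = t * (g' z - g' (- z))" by auto
  have "t * (g' z - g' (- z)) < 0" using e(2)[of z] z t by (simp add: mult_pos_neg)
  with z(3) mid[of t] show False by linarith
qed

context
  fixes \<phi> :: "real^'n::finite \<Rightarrow> real"
  assumes C2: "C_k 2 \<phi>" and nn: "\<And>x. 0 \<le> \<phi> x" and cv: "convex_on UNIV (\<lambda>x. sqrt (\<phi> x))"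
begin

lemma sqrt_midpoint: "2 * sqrt (\<phi> x) \<le> sqrt (\<phi> (x + t *\<^sub>R v)) + sqrt (\<phi> (x + (- t) *\<^sub>R v))"
proof -
  have "sqrt (\<phi> ((1 - 1/2) *\<^sub>R (x + t *\<^sub>R v) + (1/2) *\<^sub>R (x + (- t) *\<^sub>R v)))
      \<le> (1 - 1/2) * sqrt (\<phi> (x + t *\<^sub>R v)) + (1/2) * sqrt (\<phi> (x + (- t) *\<^sub>R v))"
    by (rule convex_onD[OF cv]) auto
  moreover have "(1 - 1/2) *\<^sub>R (x + t *\<^sub>R v) + (1/2) *\<^sub>R (x + (- t) *\<^sub>R v) = x"
    by (simp add: vec_eq_iff field_simps)
  ultimately show ?thesis by simp
qed

lemma hess_sym: "hess \<phi> x $ i $ j = hess \<phi> x $ j $ i"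
  by (simp add: hess_def partial_commute[OF C2])

text \<open>If 2 sqrt \<phi> \<le> a + b at a midpoint, then 4 \<phi> \<le> (a + b)^2 \<le> 2 (a^2 +
  b^2), so \<phi> itself is midpoint convex.\<close>

lemma psd_hess: "psd (hess \<phi> x)"
  unfolding psd_def
proof (intro conjI allI)
  show "hess \<phi> x $ i $ j = hess \<phi> x $ j $ i" for i j by (rule hess_sym)
  fix v :: "real^'n"
  show "0 \<le> v \<bullet> (hess \<phi> x *v v)"
  proof (rule midpoint_second_derivative[of 1 "\<lambda>t. \<phi> (x + t *\<^sub>R v)" "\<lambda>t. v \<bullet> grad \<phi> (x + t *\<^sub>R v)"])
    show "((\<lambda>t. \<phi> (x + t *\<^sub>R v)) has_real_derivative v \<bullet> grad \<phi> (x + t *\<^sub>R v)) (at t)" for t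
      by (intro line_derivative C_k_2D[OF C2])
    show "((\<lambda>t. v \<bullet> grad \<phi> (x + t *\<^sub>R v)) has_real_derivative v \<bullet> (hess \<phi> x *v v)) (at 0)"
      using line_derivative2[OF C2, of v x 0] by simp
    fix t
    let ?a = "sqrt (\<phi> (x + t *\<^sub>R v))" and ?b = "sqrt (\<phi> (x + (- t) *\<^sub>R v))"
    have "(2 * sqrt (\<phi> x))\<^sup>2 \<le> (?a + ?b)\<^sup>2" by (rule power_mono[OF sqrt_midpoint]) (simp add: nn)
    also have "\<dots> \<le> 2 * (?a\<^sup>2 + ?b\<^sup>2)" using sum_squares_bound[of ?a ?b] by (simp add: power2_sum)
    finally show "2 * \<phi> (x + 0 *\<^sub>R v) \<le> \<phi> (x + t *\<^sub>R v) + \<phi> (x + (- t) *\<^sub>R v)"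
      by (simp add: nn power_mult_distrib)
  qed simp
qed

text \<open>Where \<open>\<phi>\<close> is positive, up to the factor \<open>4 \<phi> powr (3 / 2)\<close>, this is the Hessian of the square root of \<open>\<phi>\<close>.\<close>

lemma psd_sqrt: "psd ((2 * \<phi> x) *\<^sub>R hess \<phi> x - rank1 (grad \<phi> x))"
  unfolding psd_def
proof (intro conjI allI)
  show "((2 * \<phi> x) *\<^sub>R hess \<phi> x - rank1 (grad \<phi> x)) $ i $ j = ((2 * \<phi> x) *\<^sub>R hess \<phi> x - rank1 (grad \<phi> x)) $ j $ i" for i j
    using hess_sym[of x i j] by (simp add: rank1_def mult.commute)
  fix v :: "real^'n"
  define f where "f t = \<phi> (x + t *\<^sub>R v)" for t
  define f' where "f' t = v \<bullet> grad \<phi> (x + t *\<^sub>R v)" for t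
  define f'' where "f'' = v \<bullet> (hess \<phi> x *v v)"
  have d1: "(f has_real_derivative f' t) (at t)" for t
    unfolding f_def f'_def by (intro line_derivative C_k_2D[OF C2])
  have d2: "(f' has_real_derivative f'') (at 0)"
    unfolding f'_def f''_def using line_derivative2[OF C2, of v x 0] by simp
  have f0: "f 0 = \<phi> x" "f' 0 = v \<bullet> grad \<phi> x" by (simp_all add: f_def f'_def)
  have eq: "v \<bullet> (((2 * \<phi> x) *\<^sub>R hess \<phi> x - rank1 (grad \<phi> x)) *v v) = 2 * f 0 * f'' - f' 0 * f' 0"
    by (simp add: matrix_vector_mult_diff_rdistrib rank1_mult_vec scaleR_matrix_vector_assoc[symmetric]
      inner_diff_right f''_def f0 inner_commute)
  show "0 \<le> v \<bullet> (((2 * \<phi> x) *\<^sub>R hess \<phi> x - rank1 (grad \<phi> x)) *v v)"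
  proof (cases "\<phi> x = 0")
    \<comment> \<open>A zero of \<phi> is a minimum, so the gradient vanishes there and so does the
      form; the square root, which may fail to be differentiable, is not touched.\<close>
    case True
    have "f' 0 = 0"
      by (rule DERIV_local_min[OF d1 zero_less_one]) (simp add: f_def True nn)
    then show ?thesis unfolding eq by (simp add: f0 True)
  next
    case False
    then have pos: "0 < f 0" using nn[of x] by (simp add: f0)
    have "continuous (at 0) f" using DERIV_isCont[OF d1] .
    then have "(f \<longlongrightarrow> f 0) (at 0)" by (simp add: isCont_def)
    then have "\<forall>\<^sub>F t in at 0. 0 < f t" using pos by (rule order_tendstoD(1))
    then obtain d where d: "0 < d" "\<And>t. t \<noteq> 0 \<Longrightarrow> \<bar>t\<bar> < d \<Longrightarrow> 0 < f t"
      unfolding eventually_at by (auto simp: dist_real_def)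
    have fpos: "0 < f t" if "\<bar>t\<bar> < d" for t using d(2)[of t] that pos by (cases "t = 0") auto
    \<comment> \<open>The second derivative of \<open>\<lambda>t. sqrt (f t)\<close> at 0, in the
      shape delivered by the quotient rule.\<close>
    define g'' where "g'' = (f'' * (2 * sqrt (f 0)) - f' 0 * (2 * (inverse (sqrt (f 0)) / 2 * f' 0))) / (2 * sqrt (f 0))\<^sup>2"
    have "0 \<le> g''"
    proof (rule midpoint_second_derivative[OF d(1), of "\<lambda>t. sqrt (f t)" "\<lambda>t. f' t / (2 * sqrt (f t))"])
      have sq: "((\<lambda>t. sqrt (f t)) has_real_derivative inverse (sqrt (f t)) / 2 * f' t) (at t)" if "\<bar>t\<bar> < d" for t
        by (rule DERIV_chain2[where f = sqrt and g = f, OF DERIV_real_sqrt[OF fpos[OF that]] d1])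
      show "((\<lambda>t. sqrt (f t)) has_real_derivative f' t / (2 * sqrt (f t))) (at t)" if "\<bar>t\<bar> < d" for t
        by (rule DERIV_cong[OF sq[OF that]]) (simp add: field_simps)
      show "((\<lambda>t. f' t / (2 * sqrt (f t))) has_real_derivative g'') (at 0)"
        unfolding g''_def power2_eq_square
      proof (rule DERIV_divide[OF d2 DERIV_cmult[OF sq]])
        show "\<bar>0\<bar> < d" using d(1) by simp
        show "2 * sqrt (f 0) \<noteq> 0" using pos by simp
      qed
      show "2 * sqrt (f 0) \<le> sqrt (f t) + sqrt (f (- t))" for t
        using sqrt_midpoint[of x t v] by (simp add: f_def)
    qed
    moreover have "4 * f 0 * sqrt (f 0) * g'' = 2 * f 0 * f'' - f' 0 * f' 0"
    proof -
      define s where "s = sqrt (f 0)"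
      have s: "s \<noteq> 0" "f 0 = s * s" using pos by (simp_all add: s_def)
      have "s * s * s * ((f'' * (2 * s) - f' 0 * (2 * (inverse s / 2 * f' 0))) / (2 * s)\<^sup>2) * 4
        = s * (f'' * (2 * s) - f' 0 * (inverse s * f' 0))"
        using s(1) by (simp add: power2_eq_square)
      also have "\<dots> = 2 * (s * s) * f'' - f' 0 * f' 0" using s(1) by (simp add: algebra_simps)
      finally show ?thesis unfolding g''_def s_def[symmetric] unfolding s(2) by (simp only: mult_ac)
    qed
    ultimately show ?thesis
      unfolding eq using pos mult_nonneg_nonneg[of "4 * f 0 * sqrt (f 0)" g''] by simp
  qed
qed

end

section \<open>Integrals over sublevel sets\<close>

text \<open>\<open>h k\<close> approaches the indicator from inside \<open>A\<close>, and
  \<open>c k\<close> cuts off large norms so that the products have bounded support.\<close>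

lemma open_indicator_approx:
  fixes A :: "(real^'n::finite) set"
  assumes A: "open A"
  obtains f :: "nat \<Rightarrow> real^'n \<Rightarrow> real" where "\<And>k. Cc (f k)" "\<And>k x. 0 \<le> f k x" "\<And>k x. f k x \<le> 1"
    "\<And>k x. x \<notin> A \<Longrightarrow> f k x = 0" "\<And>x. (\<lambda>k. f k x) \<longlonglongrightarrow> indicator A x"
proof -
  define h where "h k x = (if A = UNIV then 1 else min 1 (real k * infdist x (- A)))" for k :: nat and x
  define c where "c k x = max 0 (min 1 (real k - norm x))" for k :: nat and x :: "real^'n"
  have cC: "Cc (c k)" for k
  proof -
    have "c k x = 0" if "x \<notin> cball 0 (real k)" for x using that by (simp add: c_def)
    then have "{x. c k x \<noteq> 0} \<subseteq> cball 0 (real k)" by blast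
    from bounded_subset[OF bounded_cball this] show ?thesis
      unfolding Cc_def c_def by (auto intro!: continuous_intros)
  qed
  have hc: "continuous_on UNIV (h k)" for k
    unfolding h_def by (cases "A = UNIV") (simp_all, intro continuous_intros)
  have h0: "0 \<le> h k x" "h k x \<le> 1" for k x by (simp_all add: h_def infdist_nonneg)
  have c0: "0 \<le> c k x" "c k x \<le> 1" for k x by (simp_all add: c_def)
  have c1: "\<forall>\<^sub>F k in sequentially. c k x = 1" for x
    by (rule eventually_sequentiallyI[of "nat \<lceil>norm x + 1\<rceil>"]) (simp add: c_def, linarith)
  have h1: "\<forall>\<^sub>F k in sequentially. h k x = 1" if x: "x \<in> A" for x
  proof (cases "A = UNIV")
    case False
    then have ne: "closed (- A)" "- A \<noteq> {}"
      using closed_Compl[OF A] Compl_UNIV_eq double_complement by metis+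
    have pos: "0 < infdist x (- A)"
      using x in_closed_iff_infdist_zero[OF ne, of x] infdist_nonneg[of x "- A"] by simp
    obtain K where K: "1 < real K * infdist x (- A)" using reals_Archimedean3[OF pos] by blast
    show ?thesis
    proof (rule eventually_sequentiallyI[of K])
      fix k assume "K \<le> k"
      then have "real K * infdist x (- A) \<le> real k * infdist x (- A)" using pos by (intro mult_right_mono) auto
      then show "h k x = 1" using K False by (simp add: h_def)
    qed
  qed (simp add: h_def)
  show ?thesis
  proof (rule that[of "\<lambda>k x. h k x * c k x"])
    show "Cc (\<lambda>x. h k x * c k x)" for k by (rule Cc_mult[OF hc cC])
    show "0 \<le> h k x * c k x" for k x using h0 c0 by simp
    show "h k x * c k x \<le> 1" for k x using h0 c0 by (simp add: mult_le_one)
    show z: "h k x * c k x = 0" if "x \<notin> A" for k x using that by (auto simp: h_def)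
    show "(\<lambda>k. h k x * c k x) \<longlonglongrightarrow> indicator A x" for x
    proof (cases "x \<in> A")
      case True
      have "\<forall>\<^sub>F k in sequentially. h k x * c k x = indicator A x"
        using h1[OF True] c1[of x] by eventually_elim (simp add: True)
      then show ?thesis by (rule tendsto_eventually)
    qed (simp add: z)
  qed
qed

lemma radon_open_lim:
  assumes L: "radon_measure L" and A: "open A" "emeasure L A < \<infinity>"
    and f: "\<And>k. Cc (f k)" "\<And>k x. 0 \<le> f k x" "\<And>k x. f k x \<le> 1" "\<And>k x. x \<notin> A \<Longrightarrow> f k x = 0"
      "\<And>x. (\<lambda>k. f k x) \<longlonglongrightarrow> indicator A x"
  shows "(\<lambda>k. \<integral>x. f k x \<partial>L) \<longlonglongrightarrow> measure L A"
proof -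
  have sL: "A \<in> sets L" using L A(1) by (simp add: radon_measure_def)
  have "(\<lambda>k. \<integral>x. f k x \<partial>L) \<longlonglongrightarrow> (\<integral>x. indicator A x \<partial>L)"
  proof (rule integral_dominated_convergence[where w = "indicator A"])
    show "integrable L (indicator A :: _ \<Rightarrow> real)" using sL A(2) by simp
    show "f k \<in> borel_measurable L" for k using radon_integrable[OF L f(1)] by simp
    show "AE x in L. norm (f k x) \<le> indicator A x" for k
    proof (rule AE_I2)
      fix x show "norm (f k x) \<le> indicator A x"
        using f(2,3)[of k x] f(4)[of x k] by (cases "x \<in> A") simp_all
    qed
  qed (use sL f(5) in simp_all)
  then show ?thesis using sL A(2) by simp
qed

text \<open>The decomposition M - N is not unique, so independence of it is the point. Equality on
  test functions extends to continuous functions by mollification and then to the indicator of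
  \<open>A\<close> by dominated convergence, thanks to the finiteness of all four measures of
  \<open>A\<close>.\<close>

lemma current_integral_eqI:
  fixes U :: "'n::{finite,linorder} current"
  assumes A: "open A" and M: "radon_measure M" "emeasure M A < \<infinity>" and N: "radon_measure N" "emeasure N A < \<infinity>"
    and eq: "\<And>f. test_fun f \<Longrightarrow> pairing U (zero_form f) = (\<integral>x. f x \<partial>M) - (\<integral>x. f x \<partial>N)"
  shows "current_integral A U = measure M A - measure N A"
  unfolding current_integral_def
proof (rule the_equality)
  show "\<exists>M' N'. radon_measure M' \<and> radon_measure N' \<and>
      (\<forall>f. test_fun f \<longrightarrow> pairing U (zero_form f) = (\<integral>x. f x \<partial>M') - (\<integral>x. f x \<partial>N')) \<and>
      emeasure M' A < \<infinity> \<and> emeasure N' A < \<infinity> \<and> measure M A - measure N A = measure M' A - measure N' A"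
    using assms by blast
  fix v assume "\<exists>M' N'. radon_measure M' \<and> radon_measure N' \<and>
      (\<forall>f. test_fun f \<longrightarrow> pairing U (zero_form f) = (\<integral>x. f x \<partial>M') - (\<integral>x. f x \<partial>N')) \<and>
      emeasure M' A < \<infinity> \<and> emeasure N' A < \<infinity> \<and> v = measure M' A - measure N' A"
  then obtain M' N' where M': "radon_measure M'" "emeasure M' A < \<infinity>" and N': "radon_measure N'" "emeasure N' A < \<infinity>"
    and eq': "\<And>f. test_fun f \<Longrightarrow> pairing U (zero_form f) = (\<integral>x. f x \<partial>M') - (\<integral>x. f x \<partial>N')"
    and v: "v = measure M' A - measure N' A" by blast
  obtain f :: "nat \<Rightarrow> real^'n::{finite,linorder} \<Rightarrow> real" where f: "\<And>k. Cc (f k)" "\<And>k x. 0 \<le> f k x" "\<And>k x. f k x \<le> 1"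
    "\<And>k x. x \<notin> A \<Longrightarrow> f k x = 0" "\<And>x. (\<lambda>k. f k x) \<longlonglongrightarrow> indicator A x"
    by (rule open_indicator_approx[OF A]) blast
  have Cc: "(\<integral>x. h x \<partial>M) - (\<integral>x. h x \<partial>N) = (\<integral>x. h x \<partial>M') - (\<integral>x. h x \<partial>N')" if h: "Cc h" for h :: "real^'n::{finite,linorder} \<Rightarrow> real"
  proof -
    have e: "(\<integral>x. conv h (moll j) x \<partial>M) - (\<integral>x. conv h (moll j) x \<partial>N)
      = (\<integral>x. conv h (moll j) x \<partial>M') - (\<integral>x. conv h (moll j) x \<partial>N')" for j
      using eq[OF Cc_conv_moll[OF h], of j] eq'[OF Cc_conv_moll[OF h], of j] by linarith
    show ?thesis
      using LIMSEQ_unique[OF tendsto_diff[OF radon_moll_limit[OF M(1) h] radon_moll_limit[OF N(1) h], unfolded e]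
        tendsto_diff[OF radon_moll_limit[OF M'(1) h] radon_moll_limit[OF N'(1) h]]] .
  qed
  have "(\<lambda>k. (\<integral>x. f k x \<partial>M) - (\<integral>x. f k x \<partial>N)) \<longlonglongrightarrow> measure M A - measure N A"
    by (intro tendsto_diff radon_open_lim A M N f)
  moreover have "(\<lambda>k. (\<integral>x. f k x \<partial>M) - (\<integral>x. f k x \<partial>N)) \<longlonglongrightarrow> measure M' A - measure N' A"
    unfolding Cc[OF f(1)] by (intro tendsto_diff radon_open_lim A M' N' f)
  ultimately show "v = measure M A - measure N A" unfolding v by (rule LIMSEQ_unique[symmetric])
qed

section \<open>The test profile\<close>

lemma antiderivative_exists:
  fixes f :: "real \<Rightarrow> real"
  assumes f: "continuous_on UNIV f"
  shows "\<exists>F. \<forall>x. (F has_real_derivative f x) (at x)"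
proof (intro exI allI)
  fix x :: real
  define a b where "a = min 0 x - 1" and "b = max 0 x + 1"
  have "((\<lambda>u. LBINT y=ereal 0..ereal u. f y) has_vector_derivative f x) (at x within {a..b})"
    by (rule interval_integral_FTC2) (use f in \<open>auto simp: a_def b_def intro: continuous_on_subset\<close>)
  moreover have "at x within {a..b} = at x"
    by (rule at_within_interior) (auto simp: a_def b_def)
  ultimately show "((\<lambda>u. LBINT y=ereal 0..ereal u. f y) has_real_derivative f x) (at x)"
    by (simp add: has_real_derivative_iff_has_vector_derivative)
qed

lemma DERIV_nonpos_le:
  fixes f :: "real \<Rightarrow> real"
  assumes "a \<le> b" "\<And>x. a \<le> x \<Longrightarrow> x \<le> b \<Longrightarrow> (f has_real_derivative f' x) (at x)"
    "\<And>x. a \<le> x \<Longrightarrow> x \<le> b \<Longrightarrow> f' x \<le> 0"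
  shows "f b \<le> f a"
  by (rule DERIV_nonpos_imp_nonincreasing[OF assms(1)]) (use assms in blast)

text \<open>With sharp cutoffs (\<open>a' = a\<close>, \<open>b' = b\<close>) the profile is
  \<open>g t = max a t powr - c - b powr - c\<close> for \<open>t \<le> b\<close>, the solution of
  \<open>g t + t / c * g' t = a powr - c * indicator {..<a} t - b powr - c * indicator {..<b} t\<close>.\<close>

lemma profile_exists:
  fixes a' a b' b c :: real
  assumes ab: "0 < a'" "a' < a" "a < b'" "b' < b" and c: "0 < c"
  obtains h g ch :: "real \<Rightarrow> real" where
    "continuous_on UNIV h" "\<And>t. (g has_real_derivative - h t) (at t)" "\<And>t. (ch has_real_derivative - g t) (at t)"
    "\<And>t. 0 \<le> h t" "\<And>t. t \<le> a' \<Longrightarrow> h t = 0" "\<And>t. b \<le> t \<Longrightarrow> h t = 0" "\<And>t. b \<le> t \<Longrightarrow> g t = 0" "\<And>t. b \<le> t \<Longrightarrow> ch t = 0"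
    "\<And>t. 0 \<le> g t" "\<And>t. 0 \<le> ch t" "\<And>t. 0 < t \<Longrightarrow> g t \<le> t powr - c"
    "\<And>t. g t - t * h t / c \<ge> (if t < a' then a powr - c else 0) - (if t < b then b' powr - c else 0)"
proof -
  \<comment> \<open>A trapezoid: 0 outside the interval from a' to b, 1 between a and b', linear in
    between. It makes h continuous, hence ch of class C^2.\<close>
  define k where "k t = max 0 (min 1 (min ((t - a') / (a - a')) ((b - t) / (b - b'))))" for t
  \<comment> \<open>The maximum with a' changes the power only where k vanishes, and keeps it
    continuous on the whole line.\<close>
  define h where "h t = k t * (c * (max a' t) powr (- c - 1))" for t
  have kc: "continuous_on UNIV k" unfolding k_def using ab by (auto intro!: continuous_intros)
  have k0: "0 \<le> k t" "k t \<le> 1" for t by (simp_all add: k_def)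
  have ka: "k t = 0" if "t \<le> a'" for t
  proof -
    have "(t - a') / (a - a') \<le> 0" using that ab by (simp add: divide_le_0_iff)
    then show ?thesis by (simp add: k_def)
  qed
  have kb: "k t = 0" if "b \<le> t" for t
  proof -
    have "(b - t) / (b - b') \<le> 0" using that ab by (simp add: divide_le_0_iff)
    then show ?thesis by (simp add: k_def)
  qed
  have k1: "k t = 1" if "a \<le> t" "t \<le> b'" for t
  proof -
    have "1 \<le> (t - a') / (a - a')" "1 \<le> (b - t) / (b - b')" using that ab by (simp_all add: le_divide_eq)
    then show ?thesis by (simp add: k_def)
  qed
  have kmono: "k s \<le> k t" if "s \<le> t" "t \<le> b'" for s t
  proof -
    have 1: "(s - a') / (a - a') \<le> (t - a') / (a - a')" using that ab by (simp add: divide_right_mono)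
    have 2: "1 \<le> (b - t) / (b - b')" using that ab by (simp add: le_divide_eq)
    from 1 2 show ?thesis unfolding k_def by linarith
  qed
  have hc: "continuous_on UNIV h" unfolding h_def using ab(1) by (intro continuous_intros kc) auto
  have h0: "0 \<le> h t" for t unfolding h_def using k0 c by simp
  have hform: "h t = k t * (c * t powr (- c - 1))" if "0 < t" for t
    using ka[of t] by (cases "t \<le> a'") (auto simp: h_def max_def)
  have pd: "((\<lambda>t. t powr - c) has_real_derivative - (c * t powr (- c - 1))) (at t)" if "0 < t" for t
    using that by (auto intro!: derivative_eq_intros)
  obtain H where H: "\<And>x. (H has_real_derivative h x) (at x)" using antiderivative_exists[OF hc] by blast
  define g where "g t = H b - H t" for t
  have gd: "(g has_real_derivative - h t) (at t)" for t
    unfolding g_def using DERIV_diff[OF DERIV_const H, of "H b"] by simp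
  have gmono: "g t \<le> g s" if "s \<le> t" for s t
    by (rule DERIV_nonpos_le[OF that gd]) (simp add: h0)
  have gb: "g t = 0" if "b \<le> t" for t
  proof -
    have "- g t \<le> - g b"
      by (rule DERIV_nonpos_le[OF that DERIV_minus[OF gd]]) (use kb in \<open>simp add: h_def\<close>)
    then show ?thesis using gmono[OF that] by (simp add: g_def)
  qed
  have g0: "0 \<le> g t" for t using gmono[of t "max t b"] gb[of "max t b"] by simp
  have gle: "g t \<le> t powr - c" if t: "0 < t" for t
  proof (cases "t \<le> b")
    case True
    have "b powr - c - g b \<le> t powr - c - g t"
    proof (rule DERIV_nonpos_le[OF True])
      fix x assume "t \<le> x" "x \<le> b"
      then have x: "0 < x" using t by simp
      show "((\<lambda>x. x powr - c - g x) has_real_derivative - (c * x powr (- c - 1)) - (- h x)) (at x)"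
        by (rule DERIV_diff[OF pd[OF x] gd])
      show "- (c * x powr (- c - 1)) - (- h x) \<le> 0"
        unfolding hform[OF x] using k0[of x] c mult_right_mono[of "k x" 1 "c * x powr (- c - 1)"] by simp
    qed
    then show ?thesis using gb[of b] powr_ge_zero[of b "- c"] by linarith
  next
    case False then show ?thesis using gb[of t] by simp
  qed
  \<comment> \<open>Between t and b' the cutoff is at least k t, so the integral of h over this
    range is at least k t times that of the uncut density.\<close>
  have gge: "k t * (t powr - c - b' powr - c) \<le> g t" if t: "0 < t" "t \<le> b'" for t
  proof -
    have "g b' - k t * b' powr - c \<le> g t - k t * t powr - c"
    proof (rule DERIV_nonpos_le[OF t(2)])
      fix x assume tx: "t \<le> x" "x \<le> b'"
      then have x: "0 < x" using t by simp
      show "((\<lambda>x. g x - k t * x powr - c) has_real_derivative - h x - k t * - (c * x powr (- c - 1))) (at x)"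
        by (rule DERIV_diff[OF gd DERIV_cmult[OF pd[OF x]]])
      show "- h x - k t * - (c * x powr (- c - 1)) \<le> 0"
        unfolding hform[OF x] using mult_right_mono[OF kmono[OF tx], of "c * x powr (- c - 1)"] c by simp
    qed
    then show ?thesis using g0[of b'] by (simp add: right_diff_distrib)
  qed
  have gc: "continuous_on UNIV g"
    by (intro continuous_at_imp_continuous_on ballI DERIV_isCont[OF gd])
  obtain G where G: "\<And>x. (G has_real_derivative g x) (at x)" using antiderivative_exists[OF gc] by blast
  define ch where "ch t = G b - G t" for t
  have chd: "(ch has_real_derivative - g t) (at t)" for t
    unfolding ch_def using DERIV_diff[OF DERIV_const G, of "G b"] by simp
  have chmono: "ch t \<le> ch s" if "s \<le> t" for s t
    by (rule DERIV_nonpos_le[OF that chd]) (simp add: g0)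
  have chb: "ch t = 0" if "b \<le> t" for t
  proof -
    have "- ch t \<le> - ch b"
      by (rule DERIV_nonpos_le[OF that DERIV_minus[OF chd]]) (use gb in simp)
    then show ?thesis using chmono[OF that] by (simp add: ch_def)
  qed
  have ch0: "0 \<le> ch t" for t using chmono[of t "max t b"] chb[of "max t b"] by simp
  \<comment> \<open>Below a' the term with h vanishes and g is at least g a. Up to b' the bound
    \<open>gge\<close> absorbs t h / c = k t * t powr - c. Beyond b' that term is at most b' powr -
    c and g is nonnegative.\<close>
  have D: "g t - t * h t / c \<ge> (if t < a' then a powr - c else 0) - (if t < b then b' powr - c else 0)" for t
  proof -
    have th: "t * h t / c = k t * t powr - c" if "0 < t" for t
      using that c by (simp add: hform powr_diff powr_minus field_simps)
    consider "t < a'" | "a' \<le> t" "t \<le> b'" | "b' < t" "t < b" | "b \<le> t" by linarith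
    then show ?thesis
    proof cases
      case 1
      have "k a * (a powr - c - b' powr - c) \<le> g a" using ab by (intro gge) auto
      also have "g a \<le> g t" using 1 ab by (intro gmono) auto
      finally show ?thesis using 1 ab ka[of t] k1[of a] by (simp add: h_def)
    next
      case 2
      then have t: "0 < t" using ab by simp
      have "k t * b' powr - c \<le> b' powr - c" using k0[of t] by (simp add: mult_left_le_one_le)
      with gge[OF t 2(2)] have "- (b' powr - c) \<le> g t - t * h t / c"
        unfolding th[OF t] right_diff_distrib by linarith
      then show ?thesis using 2 ab by simp
    next
      case 3
      then have t: "0 < t" using ab by simp
      have "k t * t powr - c \<le> t powr - c" using k0[of t] by (simp add: mult_left_le_one_le)
      also have "t powr - c \<le> b' powr - c" using 3 ab c by (intro powr_mono2') auto
      finally have "- (b' powr - c) \<le> g t - t * h t / c"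
        using g0[of t] unfolding th[OF t] by linarith
      then show ?thesis using 3 ab by simp
    next
      case 4
      then show ?thesis using gb[of t] kb[of t] ab by (simp add: h_def)
    qed
  qed
  show ?thesis
    by (rule that[of h g ch]) (use hc gd chd h0 ka kb gb chb g0 ch0 gle D in \<open>auto simp: h_def\<close>)
qed

text \<open>The limit is the infimum I of R + E. A value R b + E b below I + e bounds R t for all t
  < b from above, and I \<le> R t + E t with E t tending to 0 bounds it from below.\<close>

lemma limit_at_zero_exists:
  fixes R E :: "real \<Rightarrow> real"
  assumes r: "0 < r" and R: "\<And>t. 0 \<le> R t" and E: "(E \<longlongrightarrow> 0) (at_right 0)"
    and E0: "\<And>t. 0 < t \<Longrightarrow> t < r \<Longrightarrow> 0 \<le> E t"
    and le: "\<And>a b. 0 < a \<Longrightarrow> a < b \<Longrightarrow> b < r \<Longrightarrow> R a \<le> R b + E b"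
  shows "\<exists>L. (R \<longlongrightarrow> L) (at_right 0)"
proof -
  let ?S = "(\<lambda>t. R t + E t) ` {0<..<r}"
  define I where "I = Inf ?S"
  have bdd: "bdd_below ?S" using R E0 by (intro bdd_belowI[of _ 0]) auto
  have ne: "?S \<noteq> {}" using r by simp
  have "(R \<longlongrightarrow> I) (at_right 0)"
  proof (rule tendstoI)
    fix e :: real assume e: "0 < e"
    obtain b where b: "0 < b" "b < r" "R b + E b < I + e"
      using cInf_lessD[OF ne, of "I + e"] e by (auto simp: I_def)
    have "\<forall>\<^sub>F t in at_right 0. t < b" using b(1) by (auto simp: eventually_at_right_less eventually_at_right[of _ b])
    moreover have "\<forall>\<^sub>F t in at_right (0::real). 0 < t" by (rule eventually_at_right_less)
    moreover have "\<forall>\<^sub>F t in at_right 0. E t < e" using E e by (rule order_tendstoD(2))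
    ultimately show "\<forall>\<^sub>F t in at_right 0. dist (R t) I < e"
    proof eventually_elim
      case (elim t)
      have "R t < I + e" using le[of t b] elim b by simp
      moreover have "I \<le> R t + E t"
        unfolding I_def using elim b by (intro cInf_lower bdd) auto
      ultimately show ?case using elim by (simp add: dist_real_def)
    qed
  qed
  then show ?thesis ..
qed

section \<open>The two measures\<close>

lemma omega_zero:
  assumes "card K \<noteq> 1 \<or> card L \<noteq> 1" shows "omega \<phi> K L = (\<lambda>_. 0)"
proof (cases "card K = 1")
  case False
  have "partial i (ext_d_sharp partial (zero_form \<phi>) (K - {i}) L) = (\<lambda>_. 0)" if "i \<in> K" for i
  proof -
    have "K - {i} \<noteq> {}" using that False by (cases "K = {i}") auto
    then show ?thesis by (simp add: ext_d_sharp_def zero_form_def)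
  qed
  then show ?thesis by (auto simp: omega_def ext_d_def intro!: sum.neutral)
next
  case True
  then have L: "card L \<noteq> 1" using assms by simp
  have "partial j (zero_form \<phi> K' (L - {j})) = (\<lambda>_. 0)" if "j \<in> L" for K' j
  proof -
    have "L - {j} \<noteq> {}" using that L by (cases "L = {j}") auto
    then show ?thesis by (simp add: zero_form_def)
  qed
  then have "ext_d_sharp partial (zero_form \<phi>) K' L = (\<lambda>_. 0)" for K'
    by (auto simp: ext_d_sharp_def intro!: sum.neutral)
  then show ?thesis by (simp add: omega_def ext_d_def)
qed

lemma bidegree_omega: "bidegree_form 1 1 (omega \<phi>)"
  unfolding bidegree_form_def using omega_zero by blast

lemma mat_of_omega: "mat_of (omega \<phi>) = hess \<phi>"
  by (simp add: fun_eq_iff mat_of_def hess_def omega_apply)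

lemma omega_C2:
  assumes C2: "C_k 2 \<phi>"
  shows "continuous_on UNIV (omega \<phi> A B)" "symmetric_form (omega \<phi>)"
proof -
  show "continuous_on UNIV (omega \<phi> A B)"
  proof (cases "card A = 1 \<and> card B = 1")
    case True
    then obtain i j where "A = {i}" "B = {j}" by (auto simp: card_1_singleton_iff)
    then show ?thesis using C_k_2D(5)[OF C2] by (simp add: omega_apply)
  qed (auto simp: omega_zero)
  show "symmetric_form (omega \<phi>)"
    unfolding symmetric_form_def
  proof (intro allI)
    fix K L show "omega \<phi> K L = omega \<phi> L K"
    proof (cases "card K = 1 \<and> card L = 1")
      case True
      then obtain i j where "K = {i}" "L = {j}" by (auto simp: card_1_singleton_iff)
      then show ?thesis using partial_commute[OF C2] by (auto simp: omega_apply)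
    qed (auto simp: omega_zero)
  qed
qed

lemma continuous_hess: "C_k 2 \<phi> \<Longrightarrow> continuous_on UNIV (hess \<phi>)"
  unfolding hess_def by (intro continuous_on_vec_lambda C_k_2D)

lemma continuous_rank1_grad: "C_k 2 \<phi> \<Longrightarrow> continuous_on UNIV (\<lambda>x. rank1 (grad \<phi> x))"
  unfolding rank1_def grad_def by (auto intro!: continuous_on_vec_lambda continuous_intros C_k_2D(4))

lemma Cc_scaleR': "continuous_on UNIV c \<Longrightarrow> Cc f \<Longrightarrow> Cc (\<lambda>x. f x *\<^sub>R c x)"
  for f :: "'a::metric_space \<Rightarrow> real"
proof -
  assume c: "continuous_on UNIV c" and f: "Cc f"
  have "bounded {x. f x *\<^sub>R c x \<noteq> 0}"
    by (rule bounded_subset[of "{x. f x \<noteq> 0}"]) (use f in \<open>auto simp: Cc_def\<close>)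
  then show ?thesis using c f by (simp add: Cc_def continuous_on_scaleR)
qed

text \<open>The second derivatives of a C^2 function are merely continuous coefficients; this
  reaches them from those of test functions.\<close>

lemma order_zero_extension_moll:
  fixes T :: "'n::{finite,linorder} current"
  assumes LL: "order_zero_extension p T LL" and F: "Cc F" and c: "continuous_on UNIV c"
  shows "(\<lambda>j. LL (\<lambda>x. conv F (moll j) x *\<^sub>R c x)) \<longlonglongrightarrow> LL (\<lambda>x. F x *\<^sub>R c x)"
proof -
  have F': "continuous_on UNIV F" "bounded {x. F x \<noteq> 0}" using F by (auto simp: Cc_def)
  obtain r where r: "\<And>j x. conv F (moll j) x \<noteq> 0 \<Longrightarrow> norm x \<le> r" "\<And>x. F x \<noteq> 0 \<Longrightarrow> norm x \<le> r"
    by (rule conv_moll_common_support[OF F'(2)]) blast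
  have "uniform_limit (cball 0 r) (\<lambda>j x. conv F (moll j) x *\<^sub>R c x) (\<lambda>x. F x *\<^sub>R c x) sequentially"
  proof (rule bounded_bilinear.bounded_uniform_limit[OF bounded_bilinear_scaleR])
    show "uniform_limit (cball 0 r) (\<lambda>j. conv F (moll j)) F sequentially"
      by (rule uniform_limit_on_subset[OF conv_moll_uniform_limit[OF F']]) simp
    show "uniform_limit (cball 0 r) (\<lambda>_. c) c sequentially" by (rule uniform_limit_const)
    show "bounded (c ` cball 0 r)" "bounded (F ` cball 0 r)"
      by (intro compact_imp_bounded compact_continuous_image compact_cball continuous_on_subset[OF c]
          continuous_on_subset[OF F'(1)] subset_UNIV)+
  qed
  then have u: "uniform_limit UNIV (\<lambda>j x. conv F (moll j) x *\<^sub>R c x) (\<lambda>x. F x *\<^sub>R c x) sequentially"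
  proof (intro uniform_limitI)
    fix e :: real assume e: "0 < e"
      and l: "uniform_limit (cball 0 r) (\<lambda>j x. conv F (moll j) x *\<^sub>R c x) (\<lambda>x. F x *\<^sub>R c x) sequentially"
    from uniform_limitD[OF l e]
    show "\<forall>\<^sub>F j in sequentially. \<forall>x\<in>UNIV. dist (conv F (moll j) x *\<^sub>R c x) (F x *\<^sub>R c x) < e"
    proof eventually_elim
      case (elim j)
      show ?case
      proof
        fix x show "dist (conv F (moll j) x *\<^sub>R c x) (F x *\<^sub>R c x) < e"
        proof (cases "norm x \<le> r")
          case True
          then show ?thesis by (intro bspec[OF elim]) simp
        next
          case False
          then have "conv F (moll j) x = 0" "F x = 0" using r(1)[of j x] r(2)[of x] by blast+
          then show ?thesis using e by simp
        qed
      qed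
    qed
  qed
  show ?thesis
    by (rule order_zero_extensionD(4)[OF LL _ _ _ _ u, of r])
       (use r in \<open>auto intro!: Cc_scaleR' c F test_fun_Cc Cc_conv_moll\<close>)
qed

text \<open>Monotonicity of the integral in b reduces the limit to the sequence r1 / Suc n, where
  dominated convergence applies.\<close>

lemma set_integral_tendsto_zero:
  fixes W :: "real \<Rightarrow> real"
  assumes r1: "0 < r1" and W0: "\<And>s. 0 \<le> W s" and Wint: "set_integrable lborel {0<..<r1} W"
  shows "((\<lambda>b. LINT s:{0<..<b}|lborel. W s) \<longlongrightarrow> 0) (at_right 0)"
proof -
  define E where "E b = (LINT s:{0<..<b}|lborel. W s)" for b
  have Wb: "set_integrable lborel {0<..<b} W" if "b \<le> r1" for b
    by (rule set_integrable_subset[OF Wint]) (use that in auto)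
  have E0: "0 \<le> E b" for b unfolding E_def set_lebesgue_integral_def by (intro integral_nonneg_AE) (simp add: W0)
  have Emono: "E a \<le> E b" if "a \<le> b" "b \<le> r1" for a b
    unfolding E_def set_lebesgue_integral_def
    using Wb[of a] Wb[of b] that W0 unfolding set_integrable_def
    by (intro integral_mono) (auto simp: indicator_def)
  have "(E \<longlongrightarrow> 0) (at_right 0)"
  proof (rule order_tendstoI)
    fix d :: real assume "d < 0" then show "\<forall>\<^sub>F x in at_right 0. d < E x" using E0 by (intro always_eventually allI) (rule less_le_trans)
  next
    fix d :: real assume d: "0 < d"
    have "(\<lambda>n. \<integral>s. indicator {0<..<r1 / Suc n} s *\<^sub>R W s \<partial>lborel) \<longlonglongrightarrow> (\<integral>s. 0 \<partial>(lborel::real measure))"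
    proof (rule integral_dominated_convergence[where w = "\<lambda>s. indicator {0<..<r1} s *\<^sub>R W s"])
      show "integrable lborel (\<lambda>s. indicator {0<..<r1} s *\<^sub>R W s)" using Wint by (simp add: set_integrable_def)
      show "(\<lambda>s. indicator {0<..<r1 / Suc n} s *\<^sub>R W s) \<in> borel_measurable lborel" for n
        using Wb[of "r1 / Suc n"] r1 unfolding set_integrable_def
        by (intro borel_measurable_integrable) (simp add: divide_le_eq)
      show "AE s in lborel. norm (indicator {0<..<r1 / Suc n} s *\<^sub>R W s) \<le> indicator {0<..<r1} s *\<^sub>R W s" for n
      proof (rule AE_I2)
        fix s
        have "r1 / Suc n \<le> r1" using r1 by (simp add: divide_le_eq)
        then show "norm (indicator {0<..<r1 / Suc n} s *\<^sub>R W s) \<le> indicator {0<..<r1} s *\<^sub>R W s"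
          using W0[of s] by (auto simp: indicator_def)
      qed
      show "AE s in lborel. (\<lambda>n. indicator {0<..<r1 / Suc n} s *\<^sub>R W s) \<longlonglongrightarrow> 0"
      proof (rule AE_I2)
        fix s :: real
        show "(\<lambda>n. indicator {0<..<r1 / Suc n} s *\<^sub>R W s) \<longlonglongrightarrow> 0"
        proof (cases "0 < s")
          case True
          obtain N where N: "r1 < real N * s" using reals_Archimedean3[OF True] by blast
          have "\<forall>\<^sub>F n in sequentially. indicator {0<..<r1 / Suc n} s *\<^sub>R W s = 0"
          proof (rule eventually_sequentiallyI[of N])
            fix n assume "N \<le> n"
            then have "real N * s \<le> real (Suc n) * s" using True by (intro mult_right_mono) auto
            then have "r1 / Suc n \<le> s" using N by (simp add: divide_le_eq mult.commute)
            then show "indicator {0<..<r1 / Suc n} s *\<^sub>R W s = 0" by simp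
          qed
          then show ?thesis by (rule tendsto_eventually)
        qed simp
      qed
    qed simp
    then have "(\<lambda>n. E (r1 / Suc n)) \<longlonglongrightarrow> 0" by (simp add: E_def set_lebesgue_integral_def)
    from order_tendstoD(2)[OF this d] obtain n where n: "E (r1 / Suc n) < d"
      unfolding eventually_sequentially by blast
    have "\<forall>\<^sub>F t in at_right 0. t < r1 / Suc n"
      using r1 by (auto simp: eventually_at_right[of 0 "r1 / Suc n"] intro!: exI[of _ "r1 / Suc n"])
    then show "\<forall>\<^sub>F t in at_right 0. E t < d"
    proof eventually_elim
      case (elim t)
      have "E t \<le> E (r1 / Suc n)" using elim r1 by (intro Emono) (auto simp: divide_le_eq)
      then show ?case using n by simp
    qed
  qed
  then show ?thesis by (simp only: E_def[abs_def])
qed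

section \<open>The measures on the support of T, and the comparison of two radii\<close>

context
  fixes T :: "'n::{finite,linorder} current" and p :: nat
    and \<phi> :: "real^'n::{finite,linorder} \<Rightarrow> real" and LL :: "(real^'n::{finite,linorder} \<Rightarrow> 'n ext) \<Rightarrow> real"
  assumes p: "1 \<le> p" and T: "weakly_positive p T" and LL: "order_zero_extension p T LL"
    and C2: "C_k 2 \<phi>" and nn: "\<And>x. 0 \<le> \<phi> x" and cv: "convex_on UNIV (\<lambda>x. sqrt (\<phi> x))"
begin

private abbreviation (input) "X \<equiv> current_support T"
private abbreviation (input) "B \<equiv> sublevel \<phi>"
private abbreviation (input) "P \<equiv> \<lambda>x. pw (hess \<phi> x) (p - 1)"

private lemma closed_X: "closed X"
  unfolding current_support_def by (rule closed_Compl) auto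

private lemma phi_cont: "continuous_on UNIV \<phi>" by (rule C_k_2D[OF C2])

private lemma open_B: "open (B r)"
  unfolding sublevel_def using phi_cont by (intro open_Collect_less continuous_intros)

private lemma P_cont: "continuous_on UNIV (\<lambda>x. pw (hess \<phi> x) q)"
  by (rule continuous_pw[OF continuous_hess[OF C2]])

private lemma lmul_hess: "lmul (hess \<phi> x) (P x) = pw (hess \<phi> x) p"
  using pw_Suc[of "hess \<phi> x" "p - 1"] p by simp

text \<open>\<open>B r\<close> itself may be unbounded; finiteness comes from its bounded part in
  the support and from the absence of mass elsewhere.\<close>

private lemma finite_sublevel:
  assumes M: "radon_measure M" and X0: "emeasure M (- X) = 0" and b: "bounded (X \<inter> B r)"
  shows "emeasure M (B r) < \<infinity>"
proof -
  have s: "sets M = sets borel" using M by (simp add: radon_measure_def)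
  have sets: "X \<inter> B r \<in> sets borel" "- X \<in> sets borel"
    using closed_X open_B by auto
  have "emeasure M (B r) \<le> emeasure M ((X \<inter> B r) \<union> (- X))"
    using sets by (intro emeasure_mono) (auto simp: s)
  also have "\<dots> \<le> emeasure M (X \<inter> B r) + emeasure M (- X)"
    using sets by (intro emeasure_subadditive) (auto simp: s)
  also have "\<dots> < \<infinity>" using radon_bounded_finite[OF M b sets(1)] X0 by simp
  finally show ?thesis .
qed

private lemma AE_X:
  assumes M: "radon_measure M" and X0: "emeasure M (- X) = 0" shows "AE x in M. x \<in> X"
proof -
  have "- X \<in> null_sets M"
    using X0 M closed_X by (auto simp: null_sets_def radon_measure_def)
  from AE_not_in[OF this] show ?thesis by simp
qed

private lemma lelong_measure:
  obtains \<mu> where "radon_measure \<mu>" "\<And>F. Cc F \<Longrightarrow> (\<integral>x. F x \<partial>\<mu>) = LL (\<lambda>x. F x *\<^sub>R pw (hess \<phi> x) p)"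
    "emeasure \<mu> (- X) = 0"
    "\<And>r. bounded (X \<inter> B r) \<Longrightarrow> current_integral (B r) (current_wedge_pow T (omega \<phi>) p) = measure \<mu> (B r)"
proof -
  have C: "Cc (\<lambda>x. f x *\<^sub>R pw (hess \<phi> x) p)" if "Cc f" for f
    by (rule Cc_scaleR'[OF P_cont that])
  have "positive_functional Cc (\<lambda>f. LL (\<lambda>x. f x *\<^sub>R pw (hess \<phi> x) p))"
    unfolding positive_functional_def
  proof (intro conjI allI impI)
    fix f g :: "real^'n::{finite,linorder} \<Rightarrow> real" assume "Cc f" "Cc g"
    from order_zero_extensionD(1)[OF LL C[OF this(1)] C[OF this(2)]]
    show "LL (\<lambda>x. (f x + g x) *\<^sub>R pw (hess \<phi> x) p) = LL (\<lambda>x. f x *\<^sub>R pw (hess \<phi> x) p) + LL (\<lambda>x. g x *\<^sub>R pw (hess \<phi> x) p)"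
      by (simp add: scaleR_left_distrib)
  next
    fix c and f :: "real^'n::{finite,linorder} \<Rightarrow> real" assume "Cc f"
    from order_zero_extensionD(2)[OF LL C[OF this], of c]
    show "LL (\<lambda>x. (c * f x) *\<^sub>R pw (hess \<phi> x) p) = c * LL (\<lambda>x. f x *\<^sub>R pw (hess \<phi> x) p)" by simp
  next
    fix f :: "real^'n::{finite,linorder} \<Rightarrow> real" assume f: "Cc f" "\<forall>x. 0 \<le> f x"
    show "0 \<le> LL (\<lambda>x. f x *\<^sub>R pw (hess \<phi> x) p)"
      by (rule order_zero_extension_nonneg[OF T LL C[OF f(1)]])
         (use f(2) in \<open>blast intro: spcone_scaleR pw_spcone psd_hess[OF C2 nn cv]\<close>)
  qed
  from riesz_representation_Cc[OF this] obtain \<mu> where \<mu>: "radon_measure \<mu>"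
    "\<And>F. Cc F \<Longrightarrow> LL (\<lambda>x. F x *\<^sub>R pw (hess \<phi> x) p) = (\<integral>x. F x \<partial>\<mu>)"
    unfolding radon_measure_def by blast
  have X0: "emeasure \<mu> (- X) = 0"
  proof (rule radon_null_test[OF \<mu>(1)])
    show "open (- X)" using closed_X by (rule open_Compl)
    fix f :: "real^'n::{finite,linorder} \<Rightarrow> real" assume f: "test_fun f" "closure {x. f x \<noteq> 0} \<subseteq> - X"
    have "f x = 0" if "x \<in> X" for x using f(2) closure_subset[of "{x. f x \<noteq> 0}"] that by auto
    then have "LL (\<lambda>x. f x *\<^sub>R pw (hess \<phi> x) p) = 0"
      by (intro order_zero_extensionD(5)[OF LL] C test_fun_Cc f(1)) simp
    then show "(\<integral>x. f x \<partial>\<mu>) = 0" using \<mu>(2)[OF test_fun_Cc[OF f(1)]] by simp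
  qed
  have "current_integral (B r) (current_wedge_pow T (omega \<phi>) p) = measure \<mu> (B r)" if b: "bounded (X \<inter> B r)" for r
  proof -
    have "current_integral (B r) (current_wedge_pow T (omega \<phi>) p) = measure \<mu> (B r) - measure (null_measure borel) (B r)"
    proof (rule current_integral_eqI[OF open_B \<mu>(1) finite_sublevel[OF \<mu>(1) X0 b]])
      show "radon_measure (null_measure borel)" by (simp add: radon_measure_def)
      show "emeasure (null_measure borel) (B r) < \<infinity>" by simp
      fix f :: "real^'n::{finite,linorder} \<Rightarrow> real" assume f: "test_fun f"
      show "pairing (current_wedge_pow T (omega \<phi>) p) (zero_form f) = (\<integral>x. f x \<partial>\<mu>) - (\<integral>x. f x \<partial>null_measure borel)"
        using current_wedge_pow_top[OF T LL omega_C2(1)[OF C2] bidegree_omega omega_C2(2)[OF C2] f]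
          \<mu>(2)[OF test_fun_Cc[OF f]] by (simp add: mat_of_omega integral_null_measure)
    qed
    then show ?thesis by (simp add: measure_def)
  qed
  with \<mu> X0 show ?thesis by (intro that[of \<mu>]) auto
qed

text \<open>Concavity makes the negative of the pairing a positive functional on test functions,
  hence a measure \<rho>. The formula is then extended by mollification to C^2 functions with
  bounded support, because a profile composed with \<phi> is not smooth.\<close>

private lemma dd_sharp_measure:
  assumes conc: "concave_current 1 (current_wedge_pow T (omega \<phi>) (p - 1))"
  obtains \<rho> where "radon_measure \<rho>"
    "\<And>u. C_k 2 u \<Longrightarrow> bounded {x. u x \<noteq> 0} \<Longrightarrow> (\<integral>x. u x \<partial>\<rho>) = - LL (\<lambda>x. lmul (sym_hess u x) (P x))"
    "emeasure \<rho> (- X) = 0"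
    "\<And>r. bounded (X \<inter> B r) \<Longrightarrow>
       current_integral (B r) (dd_sharp (current_wedge_pow T (omega \<phi>) (p - 1))) = - measure \<rho> (B r)"
proof -
  let ?S = "current_wedge_pow T (omega \<phi>) (p - 1)"
  let ?v = "vol_sign TYPE('n)"
  have wp: "weakly_positive 0 (dd_sharp (neg_current ?S))"
    using conc by (simp add: concave_current_def convex_current_def)
  have neg: "dd_sharp (neg_current ?S) K L f = - dd_sharp ?S K L f" for K L f
    by (simp add: ext_d_def ext_d_sharp_def dist_partial_def neg_current_def sum_negf)
  have pneg: "pairing (dd_sharp (neg_current ?S)) \<alpha> = - pairing (dd_sharp ?S) \<alpha>" for \<alpha>
    by (simp only: pairing_def neg mult_minus_right sum_negf)
  note D = weakly_positive_distribution[OF wp]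
  have pz: "pairing (dd_sharp (neg_current ?S)) (zero_form f) = ?v * dd_sharp (neg_current ?S) UNIV UNIV f" for f
    by (rule pairing_zero_form) (rule distribution_zero[OF D])
  have dd: "pairing (dd_sharp ?S) (zero_form f) = LL (\<lambda>x. lmul (sym_hess f x) (P x))" if "test_fun f" for f
    using pairing_dd_sharp[OF T LL p omega_C2(1)[OF C2] bidegree_omega omega_C2(2)[OF C2] that]
    by (simp add: mat_of_omega)
  have "positive_functional test_fun (\<lambda>f. pairing (dd_sharp (neg_current ?S)) (zero_form f))"
    unfolding positive_functional_def
  proof (intro conjI allI impI)
    fix f :: "real^'n::{finite,linorder} \<Rightarrow> real" assume f: "test_fun f" "\<forall>x. 0 \<le> f x"
    \<comment> \<open>In degree 0 a nonnegative function is strongly positive: one summand, with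
      weight f and an empty product.\<close>
    have "zero_form f = (\<lambda>K L x. \<Sum>s<1::nat. f x * J_product (\<lambda>_. zero_form f) 0 K L x)"
      by (simp add: zero_form_def fun_eq_iff)
    then have "strongly_positive_form 0 (zero_form f)"
      unfolding strongly_positive_form_def using f
      by (intro exI[of _ 1] exI[of _ "\<lambda>_. f"] exI[of _ "\<lambda>_ _. zero_form f"]) (auto simp: test_fun_def)
    moreover have "test_form (zero_form f)" using f(1) by (simp add: test_form_def zero_form_def test_fun_zero)
    ultimately show "0 \<le> pairing (dd_sharp (neg_current ?S)) (zero_form f)"
      using wp unfolding weakly_positive_def by blast
  qed (simp_all only: pz distribution_add[OF D] distribution_cmult[OF D] distrib_left mult.left_commute)
  from riesz_representation[OF this] obtain \<rho> where \<rho>: "radon_measure \<rho>"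
    "\<And>f. test_fun f \<Longrightarrow> pairing (dd_sharp (neg_current ?S)) (zero_form f) = (\<integral>x. f x \<partial>\<rho>)" by blast
  have \<rho>LL: "(\<integral>x. f x \<partial>\<rho>) = - LL (\<lambda>x. lmul (sym_hess f x) (P x))" if "test_fun f" for f
    using \<rho>(2)[OF that] dd[OF that] pneg by simp
  have lc: "continuous_on UNIV (\<lambda>x. lmul m (P x))" for m
    by (intro bounded_linear.continuous_on[OF lmul.bounded_linear_right] P_cont)
  \<comment> \<open>Separates the second derivatives from the fixed continuous factors, so that the
    mollification limit can be taken term by term.\<close>
  have expand: "LL (\<lambda>x. lmul (sym_hess u x) (P x)) = (\<Sum>i\<in>UNIV. \<Sum>j\<in>UNIV. LL (\<lambda>x. partial j (partial i u) x *\<^sub>R lmul (sym_unit i j) (P x)))"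
    if c: "\<And>i j. Cc (partial j (partial i u))" for u
  proof -
    have C: "Cc (\<lambda>x. partial j (partial i u) x *\<^sub>R lmul (sym_unit i j) (P x))" for i j
      by (rule Cc_scaleR'[OF lc c])
    have "LL (\<lambda>x. lmul (sym_hess u x) (P x)) = LL (\<lambda>x. \<Sum>i\<in>UNIV. \<Sum>j\<in>UNIV. partial j (partial i u) x *\<^sub>R lmul (sym_unit i j) (P x))"
      by (simp add: sym_hess_def lmul.sum_left lmul.scaleR_left)
    also have "\<dots> = (\<Sum>i\<in>UNIV. LL (\<lambda>x. \<Sum>j\<in>UNIV. partial j (partial i u) x *\<^sub>R lmul (sym_unit i j) (P x)))"
      by (rule order_zero_extension_sum[OF LL]) (intro Cc_sum C)
    also have "\<dots> = (\<Sum>i\<in>UNIV. \<Sum>j\<in>UNIV. LL (\<lambda>x. partial j (partial i u) x *\<^sub>R lmul (sym_unit i j) (P x)))"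
      by (intro sum.cong refl order_zero_extension_sum[OF LL] C)
    finally show ?thesis .
  qed
  have u: "(\<integral>x. u x \<partial>\<rho>) = - LL (\<lambda>x. lmul (sym_hess u x) (P x))" if u: "C_k 2 u" "bounded {x. u x \<noteq> 0}" for u
  proof -
    have uC: "Cc u" "Cc (partial j (partial i u))" for i j
      using C_k_2D(3,5)[OF u(1)] u(2) bounded_partial_support[OF bounded_partial_support[OF u(2)]] by (simp_all add: Cc_def)
    have t: "test_fun (conv u (moll k))" for k by (rule Cc_conv_moll[OF uC(1)])
    have tC: "Cc (partial j (partial i (conv u (moll k))))" for i j k
      by (intro test_fun_Cc test_fun_partial t)
    have "(\<lambda>k. LL (\<lambda>x. lmul (sym_hess (conv u (moll k)) x) (P x))) \<longlonglongrightarrow> LL (\<lambda>x. lmul (sym_hess u x) (P x))"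
      unfolding expand[OF tC] expand[OF uC(2)] partial2_conv[OF u]
      by (intro tendsto_sum order_zero_extension_moll[OF LL uC(2) lc])
    from tendsto_minus[OF this] have "(\<lambda>k. \<integral>x. conv u (moll k) x \<partial>\<rho>) \<longlonglongrightarrow> - LL (\<lambda>x. lmul (sym_hess u x) (P x))"
      by (simp add: \<rho>LL[OF t])
    from LIMSEQ_unique[OF radon_moll_limit[OF \<rho>(1) uC(1)] this] show ?thesis .
  qed
  have X0: "emeasure \<rho> (- X) = 0"
  proof (rule radon_null_test[OF \<rho>(1)])
    show "open (- X)" using closed_X by (rule open_Compl)
    fix f :: "real^'n::{finite,linorder} \<Rightarrow> real" assume f: "test_fun f" "closure {x. f x \<noteq> 0} \<subseteq> - X"
    have tC: "Cc (partial j (partial i f))" for i j by (intro test_fun_Cc test_fun_partial f)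
    have z: "partial j (partial i f) x = 0" if x: "x \<in> X" for x i j
    proof -
      have "partial j (partial i f) x = partial j (partial i (\<lambda>_. 0)) x"
        using f(2) x closure_subset[of "{x. f x \<noteq> 0}"]
        by (intro partial2_local[of "- closure {x. f x \<noteq> 0}"]) auto
      then show ?thesis by simp
    qed
    have "LL (\<lambda>x. partial j (partial i f) x *\<^sub>R lmul (sym_unit i j) (P x)) = 0" for i j
      by (intro order_zero_extensionD(5)[OF LL] Cc_scaleR' lc tC) (simp add: z)
    then show "(\<integral>x. f x \<partial>\<rho>) = 0" unfolding \<rho>LL[OF f(1)] expand[OF tC] by simp
  qed
  have "current_integral (B r) (dd_sharp ?S) = - measure \<rho> (B r)" if b: "bounded (X \<inter> B r)" for r
  proof -
    have "current_integral (B r) (dd_sharp ?S) = measure (null_measure borel) (B r) - measure \<rho> (B r)"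
    proof (rule current_integral_eqI[OF open_B _ _ \<rho>(1) finite_sublevel[OF \<rho>(1) X0 b]])
      show "radon_measure (null_measure borel)" by (simp add: radon_measure_def)
      show "emeasure (null_measure borel) (B r) < \<infinity>" by simp
      fix f :: "real^'n::{finite,linorder} \<Rightarrow> real" assume f: "test_fun f"
      show "pairing (dd_sharp ?S) (zero_form f) = (\<integral>x. f x \<partial>null_measure borel) - (\<integral>x. f x \<partial>\<rho>)"
        using \<rho>(2)[OF f] pneg by (simp add: integral_null_measure)
    qed
    then show ?thesis by (simp add: measure_def)
  qed
  with \<rho>(1) u X0 show ?thesis by (intro that[of \<rho>]) auto
qed

text \<open>Since \<open>rank1 (grad \<phi> x)\<close> squares to zero, \<open>(2 \<phi> \<omega> - p d\<phi> \<and> d\<^sup>#\<phi>)\<close> times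
  \<open>(2 \<phi>)^(p - 1) \<omega>^(p - 1)\<close> is the p-th power of the positive form \<open>2 \<phi> \<omega> - d\<phi> \<and> d\<^sup>#\<phi>\<close>.\<close>

private lemma pw_sqrt_eq:
  "pw ((2 * \<phi> x) *\<^sub>R hess \<phi> x - rank1 (grad \<phi> x)) p
     = (2 * \<phi> x) ^ p *\<^sub>R pw (hess \<phi> x) p - (real p * (2 * \<phi> x) ^ (p - 1)) *\<^sub>R lmul (rank1 (grad \<phi> x)) (P x)"
  using pw_add_rank1_diff[OF p, of "(2 * \<phi> x) *\<^sub>R hess \<phi> x - rank1 (grad \<phi> x)" "grad \<phi> x"]
  by (simp add: pw_scaleR lmul.scaleR_right)

text \<open>Tests the p-th power of the positive form
  \<open>2 \<phi> \<omega> - d\<phi> \<and> d\<^sup>#\<phi>\<close> with the weight w / (2 \<phi>) ^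
  (p - 1), which cancels the common power of 2 \<phi>. The division is harmless since w vanishes
  where \<phi> \<le> d.\<close>

private lemma gradient_bound:
  assumes w: "Cc w" "\<And>x. 0 \<le> w x" and d: "0 < d" "\<And>x. \<phi> x \<le> d \<Longrightarrow> w x = 0"
  shows "real p * LL (\<lambda>x. w x *\<^sub>R lmul (rank1 (grad \<phi> x)) (P x)) \<le> 2 * LL (\<lambda>x. (w x * \<phi> x) *\<^sub>R pw (hess \<phi> x) p)"
proof -
  define Q where "Q x = (2 * \<phi> x) *\<^sub>R hess \<phi> x - rank1 (grad \<phi> x)" for x
  \<comment> \<open>The maximum agrees with \<phi> wherever w is nonzero and keeps the quotient
    continuous at the zeros of \<phi>.\<close>
  define w' where "w' x = w x / (2 * max (\<phi> x) d) ^ (p - 1)" for x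
  have m: "0 < max (\<phi> x) d" for x using d(1) by (simp add: less_max_iff_disj)
  have mc: "continuous_on UNIV (\<lambda>x. inverse ((2 * max (\<phi> x) d) ^ (p - 1)))"
    using m by (intro continuous_intros phi_cont) (simp add: less_imp_neq[symmetric])
  have "w' = (\<lambda>x. inverse ((2 * max (\<phi> x) d) ^ (p - 1)) * w x)"
    by (rule ext) (simp only: w'_def divide_inverse mult.commute)
  then have w'c: "Cc w'" using Cc_mult[OF mc w(1)] by simp
  have w'0: "0 \<le> w' x" for x
    unfolding w'_def using w(2)[of x] m[of x] by (intro divide_nonneg_nonneg zero_le_power) simp_all
  have Qc: "continuous_on UNIV Q"
    unfolding Q_def by (intro continuous_intros phi_cont continuous_hess continuous_rank1_grad C2)
  have rc: "continuous_on UNIV (\<lambda>x. lmul (rank1 (grad \<phi> x)) (P x))"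
    by (intro bounded_bilinear.continuous_on[OF bounded_bilinear_lmul] continuous_rank1_grad C2 P_cont)
  have C1: "Cc (\<lambda>x. (w x * \<phi> x) *\<^sub>R pw (hess \<phi> x) p)"
    using Cc_mult[OF phi_cont w(1)] by (intro Cc_scaleR' P_cont) (simp add: mult.commute)
  have C3: "Cc (\<lambda>x. w x *\<^sub>R lmul (rank1 (grad \<phi> x)) (P x))" by (rule Cc_scaleR'[OF rc w(1)])
  have "0 \<le> LL (\<lambda>x. w' x *\<^sub>R pw (Q x) p)"
    by (rule order_zero_extension_nonneg[OF T LL Cc_scaleR'[OF continuous_pw[OF Qc] w'c]])
       (intro spcone_scaleR pw_spcone w'0, simp add: Q_def psd_sqrt[OF C2 nn cv])
  also have "(\<lambda>x. w' x *\<^sub>R pw (Q x) p) = (\<lambda>x. 2 *\<^sub>R ((w x * \<phi> x) *\<^sub>R pw (hess \<phi> x) p)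
      + (- real p) *\<^sub>R (w x *\<^sub>R lmul (rank1 (grad \<phi> x)) (P x)))"
  proof
    fix x
    show "w' x *\<^sub>R pw (Q x) p = 2 *\<^sub>R ((w x * \<phi> x) *\<^sub>R pw (hess \<phi> x) p)
      + (- real p) *\<^sub>R (w x *\<^sub>R lmul (rank1 (grad \<phi> x)) (P x))"
    proof (cases "\<phi> x \<le> d")
      case True then show ?thesis using d(2)[OF True] by (simp add: w'_def)
    next
      case False
      then have pos: "0 < \<phi> x" and mx: "max (\<phi> x) d = \<phi> x" using d(1) by auto
      have "w' x * (2 * \<phi> x) ^ (p - 1) = w x" using pos by (simp add: w'_def mx)
      moreover have "(2 * \<phi> x) ^ p = (2 * \<phi> x) ^ (p - 1) * (2 * \<phi> x)"
        using p by (simp add: power_eq_if mult.commute)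
      ultimately have "w' x * (2 * \<phi> x) ^ p = 2 * (w x * \<phi> x)" "w' x * (real p * (2 * \<phi> x) ^ (p - 1)) = real p * w x"
        by (simp_all add: mult_ac)
      then show ?thesis unfolding Q_def pw_sqrt_eq by (simp add: scaleR_diff_right)
    qed
  qed
  also have "LL \<dots> = 2 * LL (\<lambda>x. (w x * \<phi> x) *\<^sub>R pw (hess \<phi> x) p) + (- real p) * LL (\<lambda>x. w x *\<^sub>R lmul (rank1 (grad \<phi> x)) (P x))"
    by (simp only: order_zero_extensionD(1)[OF LL Cc_scaleR[OF continuous_on_const C1] Cc_scaleR[OF continuous_on_const C3]]
      order_zero_extensionD(2)[OF LL C1] order_zero_extensionD(2)[OF LL C3])
  finally show ?thesis by simp
qed

text \<open>The chain rule with ch' = - g and ch'' = h. Symmetry of the resulting matrix undoes the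
  symmetrization in \<open>sym_hess\<close>.\<close>

private lemma sym_hess_profile:
  assumes ch: "\<And>t. (ch has_real_derivative - g t) (at t)" and g: "\<And>t. (g has_real_derivative - h t) (at t)"
  shows "sym_hess (\<lambda>x. ch (\<phi> x)) x = (- g (\<phi> x)) *\<^sub>R hess \<phi> x + h (\<phi> x) *\<^sub>R rank1 (grad \<phi> x)"
proof -
  have g': "((\<lambda>t. - g t) has_real_derivative h t) (at t)" for t using DERIV_minus[OF g] by simp
  have 1: "partial i (\<lambda>x. ch (\<phi> x)) = (\<lambda>x. - g (\<phi> x) * partial i \<phi> x)" for i
    by (rule partial_compose[OF C_k_2D(6)[OF C2] ch])
  have dg: "(\<lambda>x. - g (\<phi> x)) differentiable (at x)" for x
    using C_k_2D(6)[OF C2, of x] g'[of "\<phi> x"] differentiable_chain_at[of \<phi> x "\<lambda>t. - g t"]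
    by (auto simp: o_def has_field_derivative_def differentiable_def)
  have 2: "partial j (partial i (\<lambda>x. ch (\<phi> x))) x
     = - g (\<phi> x) * hess \<phi> x $ i $ j + h (\<phi> x) * (grad \<phi> x $ i * grad \<phi> x $ j)" for i j
    unfolding 1 partial_mult[OF dg C_k_2D(7)[OF C2]] partial_compose[OF C_k_2D(6)[OF C2] g']
    by (simp add: hess_def grad_def partial_commute[OF C2, of j])
  have "sym_hess (\<lambda>x. ch (\<phi> x)) x $ k $ l = (- g (\<phi> x)) * hess \<phi> x $ k $ l + h (\<phi> x) * (grad \<phi> x $ k * grad \<phi> x $ l)" for k l
  proof -
    define m where "m i j = - g (\<phi> x) * hess \<phi> x $ i $ j + h (\<phi> x) * (grad \<phi> x $ i * grad \<phi> x $ j)" for i j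
    have ms: "m i j = m j i" for i j using hess_sym[OF C2 nn cv, of x i j] by (simp add: m_def mult.commute)
    have e: "(\<Sum>i\<in>UNIV. \<Sum>j\<in>UNIV. m i j * unit_mat i j $ k $ l) = m k l" for k l
      using arg_cong[OF mat_expand[of "\<chi> i j. m i j"], of "\<lambda>M. M $ k $ l"] by simp
    have pm: "partial j (partial i (\<lambda>x. ch (\<phi> x))) x = m i j" for i j by (simp only: 2 m_def)
    have "(\<Sum>i\<in>UNIV. \<Sum>j\<in>UNIV. m i j * unit_mat j i $ k $ l) = (\<Sum>j\<in>UNIV. \<Sum>i\<in>UNIV. m j i * unit_mat j i $ k $ l)"
      by (subst sum.swap) (simp add: ms)
    with e have e': "(\<Sum>i\<in>UNIV. \<Sum>j\<in>UNIV. m i j * unit_mat j i $ k $ l) = m k l" by simp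
    have "sym_hess (\<lambda>x. ch (\<phi> x)) x $ k $ l
      = (\<Sum>i\<in>UNIV. \<Sum>j\<in>UNIV. m i j * unit_mat i j $ k $ l) / 2 + (\<Sum>i\<in>UNIV. \<Sum>j\<in>UNIV. m i j * unit_mat j i $ k $ l) / 2"
      by (simp add: sym_hess_def pm sym_unit_def distrib_left sum.distrib sum_divide_distrib add_divide_distrib)
    then show ?thesis unfolding e e' by (simp add: m_def)
  qed
  then show ?thesis by (simp add: vec_eq_iff rank1_def)
qed

text \<open>Pairing with u = \<theta> ch(\<phi>) expresses the \<rho>-integral of u as the
  \<mu>-integral of \<theta> g(\<phi>) minus a gradient term \<kappa>, and
  \<open>gradient_bound\<close> estimates \<kappa> by the \<mu>-integral of \<theta> \<phi>
  h(\<phi>) / c. The profile bounds g - t h / c from below by the two weighted indicators; the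
  \<rho>-integral is estimated by Fubini's theorem. The gaps a' < a and b' < b leave room for the
  transitions of the profile.\<close>

private lemma key_inequality:
  fixes \<mu> \<rho> :: "(real^'n::{finite,linorder}) measure"
  assumes \<mu>: "radon_measure \<mu>" "\<And>F. Cc F \<Longrightarrow> (\<integral>x. F x \<partial>\<mu>) = LL (\<lambda>x. F x *\<^sub>R pw (hess \<phi> x) p)" "emeasure \<mu> (- X) = 0"
    and \<rho>: "radon_measure \<rho>"
      "\<And>u. C_k 2 u \<Longrightarrow> bounded {x. u x \<noteq> 0} \<Longrightarrow> (\<integral>x. u x \<partial>\<rho>) = - LL (\<lambda>x. lmul (sym_hess u x) (P x))"
      "emeasure \<rho> (- X) = 0"
    and r0: "bounded (X \<inter> B r0)" and ab: "0 < a'" "a' < a" "a < b'" "b' < b" "b < r0"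
    and c: "c = real p / 2"
    and int: "set_integrable lborel {0<..<b} (\<lambda>s. s powr - c * measure \<rho> (B s))"
  shows "a powr - c * measure \<mu> (B a') - b' powr - c * measure \<mu> (B b)
    \<le> (LINT s:{0<..<b}|lborel. s powr - c * measure \<rho> (B s))"
proof -
  have c0: "0 < c" using p c by simp
  obtain h g ch :: "real \<Rightarrow> real" where hc: "continuous_on UNIV h" and gd: "\<And>t. (g has_real_derivative - h t) (at t)"
    and chd: "\<And>t. (ch has_real_derivative - g t) (at t)"
    and h0: "\<And>t. 0 \<le> h t" and ha: "\<And>t. t \<le> a' \<Longrightarrow> h t = 0" and hb: "\<And>t. b \<le> t \<Longrightarrow> h t = 0"
    and gb: "\<And>t. b \<le> t \<Longrightarrow> g t = 0" and chb: "\<And>t. b \<le> t \<Longrightarrow> ch t = 0"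
    and g0: "\<And>t. 0 \<le> g t" and ch0: "\<And>t. 0 \<le> ch t" and gle: "\<And>t. 0 < t \<Longrightarrow> g t \<le> t powr - c"
    and Dge: "\<And>t. g t - t * h t / c \<ge> (if t < a' then a powr - c else 0) - (if t < b then b' powr - c else 0)"
    by (rule profile_exists[OF ab(1,2,3,4) c0]) blast
  have gc: "continuous_on UNIV g" by (intro continuous_at_imp_continuous_on ballI DERIV_isCont[OF gd])
  obtain \<theta> U where \<theta>: "test_fun \<theta>" "\<And>x. 0 \<le> \<theta> x" "\<And>x. \<theta> x \<le> 1" "open U" "X \<inter> B r0 \<subseteq> U" "\<And>x. x \<in> U \<Longrightarrow> \<theta> x = 1"
    by (rule cutoff_exists[OF r0]) blast
  note \<theta>C = test_fun_Cc[OF \<theta>(1)]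
  have \<theta>1: "\<theta> x = 1" if "x \<in> X" "\<phi> x < r0" for x using that \<theta>(5,6) by (auto simp: sublevel_def)
  \<comment> \<open>The cutoff gives u bounded support. It equals 1 near the part of the support of
    \<open>T\<close> where \<phi> < r0, while ch(\<phi>) vanishes for \<phi> \<ge> b, so it leaves
    no trace on the support.\<close>
  define u where "u x = \<theta> x * ch (\<phi> x)" for x
  have uC2: "C_k 2 u"
    unfolding u_def
  proof (rule C_k_mult)
    show "C_k 2 \<theta>" using \<theta>(1) by (simp add: test_fun_def smooth_def)
    define H where "H m = (if m = 0 then ch else if m = 1 then (\<lambda>t. - g t) else h)" for m :: nat
    have "C_k 2 (\<lambda>x. H 0 (\<phi> x))"
    proof (rule C_k_compose[OF _ _ C2])
      fix m :: nat and t assume "m < 2"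
      then have "m = 0 \<or> m = 1" by auto
      then show "(H m has_real_derivative H (Suc m) t) (at t)"
        using chd[of t] DERIV_minus[OF gd[of t]] by (auto simp: H_def)
    qed (use hc in \<open>simp add: H_def\<close>)
    then show "C_k 2 (\<lambda>x. ch (\<phi> x))" by (simp add: H_def)
  qed
  have ub: "bounded {x. u x \<noteq> 0}"
    by (rule bounded_subset[of "{x. \<theta> x \<noteq> 0}"]) (use \<theta>C in \<open>auto simp: Cc_def u_def\<close>)
  have comp: "continuous_on UNIV (\<lambda>x. k (\<phi> x))" if "continuous_on UNIV k" for k :: "real \<Rightarrow> real"
    by (rule continuous_on_compose2[OF that phi_cont]) simp
  have \<theta>h: "Cc (\<lambda>x. \<theta> x * h (\<phi> x))" and \<theta>g: "Cc (\<lambda>x. \<theta> x * g (\<phi> x))"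
    using Cc_mult[OF comp[OF hc] \<theta>C] Cc_mult[OF comp[OF gc] \<theta>C] by (simp_all add: mult.commute)
  have \<theta>hp: "Cc (\<lambda>x. (\<theta> x * h (\<phi> x)) * \<phi> x)"
    using Cc_mult[OF phi_cont \<theta>h] by (simp add: mult.commute)
  have rc: "continuous_on UNIV (\<lambda>x. lmul (rank1 (grad \<phi> x)) (P x))"
    by (intro bounded_bilinear.continuous_on[OF bounded_bilinear_lmul] continuous_rank1_grad C2 P_cont)
  define \<kappa> where "\<kappa> = LL (\<lambda>x. (\<theta> x * h (\<phi> x)) *\<^sub>R lmul (rank1 (grad \<phi> x)) (P x))"
  \<comment> \<open>Where \<phi> < r0 the cutoff is 1 nearby; elsewhere \<phi> > b, so u vanishes
    nearby and g and h vanish as well.\<close>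
  have hess_u: "sym_hess u x = \<theta> x *\<^sub>R ((- g (\<phi> x)) *\<^sub>R hess \<phi> x + h (\<phi> x) *\<^sub>R rank1 (grad \<phi> x))" if x: "x \<in> X" for x
  proof (cases "\<phi> x < r0")
    case True
    then have xU: "x \<in> U" using \<theta>(5) x by (auto simp: sublevel_def)
    have "partial j (partial i u) x = partial j (partial i (\<lambda>x. ch (\<phi> x))) x" for i j
      by (rule partial2_local[OF \<theta>(4) xU]) (simp add: u_def \<theta>(6))
    then have "sym_hess u x = sym_hess (\<lambda>x. ch (\<phi> x)) x" by (simp add: sym_hess_def)
    then show ?thesis using sym_hess_profile[OF chd gd] \<theta>(6)[OF xU] by simp
  next
    case False
    then have xb: "b < \<phi> x" using ab by simp
    have "open {x. b < \<phi> x}" using phi_cont by (intro open_Collect_less continuous_intros)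
    then have "partial j (partial i u) x = partial j (partial i (\<lambda>_. 0)) x" for i j
      by (rule partial2_local) (use xb chb in \<open>auto simp: u_def\<close>)
    then have "sym_hess u x = 0" by (simp add: sym_hess_def)
    then show ?thesis using gb[of "\<phi> x"] hb[of "\<phi> x"] xb by simp
  qed
  have LLu: "LL (\<lambda>x. lmul (sym_hess u x) (P x)) = - (\<integral>x. \<theta> x * g (\<phi> x) \<partial>\<mu>) + \<kappa>"
  proof -
    let ?a = "\<lambda>x. (\<theta> x * g (\<phi> x)) *\<^sub>R pw (hess \<phi> x) p" and ?b = "\<lambda>x. (\<theta> x * h (\<phi> x)) *\<^sub>R lmul (rank1 (grad \<phi> x)) (P x)"
    have a: "Cc ?a" "Cc ?b" by (rule Cc_scaleR'[OF P_cont \<theta>g], rule Cc_scaleR'[OF rc \<theta>h])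
    have ma: "Cc (\<lambda>x. (- 1) *\<^sub>R ?a x)" by (rule Cc_scaleR[OF continuous_on_const a(1)])
    have uC: "Cc (partial j (partial i u))" for i j
      using C_k_2D(5)[OF uC2] bounded_partial_support[OF bounded_partial_support[OF ub]] by (simp add: Cc_def)
    have uL: "Cc (\<lambda>x. lmul (sym_hess u x) (P x))"
    proof -
      have "Cc (\<lambda>x. \<Sum>i\<in>UNIV. \<Sum>j\<in>UNIV. partial j (partial i u) x *\<^sub>R lmul (sym_unit i j) (P x))"
        by (intro Cc_sum Cc_scaleR' uC bounded_linear.continuous_on[OF lmul.bounded_linear_right] P_cont)
      then show ?thesis by (simp add: sym_hess_def lmul.sum_left lmul.scaleR_left)
    qed
    have n: "Cc (\<lambda>x. (- 1) *\<^sub>R ((- 1) *\<^sub>R ?a x + ?b x))" by (intro Cc_scaleR continuous_on_const Cc_add ma a)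
    \<comment> \<open>The two integrands are known to agree on the support only, which suffices
      because \<open>LL\<close> is local.\<close>
    have "LL (\<lambda>x. lmul (sym_hess u x) (P x) + (- 1) *\<^sub>R ((- 1) *\<^sub>R ?a x + ?b x)) = 0"
    proof (rule order_zero_extensionD(5)[OF LL Cc_add[OF uL n]])
      fix x assume "x \<in> X"
      then show "lmul (sym_hess u x) (P x) + (- 1) *\<^sub>R ((- 1) *\<^sub>R ?a x + ?b x) = 0"
        unfolding hess_u[OF \<open>x \<in> X\<close>] lmul.scaleR_left lmul.add_left lmul_hess
        by (simp add: scaleR_add_right scaleR_diff_right)
    qed
    then show ?thesis
      unfolding order_zero_extensionD(1)[OF LL uL n] order_zero_extensionD(2)[OF LL Cc_add[OF ma a(2)]]
        order_zero_extensionD(1)[OF LL ma a(2)] order_zero_extensionD(2)[OF LL a(1)] \<mu>(2)[OF \<theta>g] \<kappa>_def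
      by simp
  qed
  have "real p * \<kappa> \<le> 2 * (\<integral>x. (\<theta> x * h (\<phi> x)) * \<phi> x \<partial>\<mu>)"
    unfolding \<kappa>_def \<mu>(2)[OF \<theta>hp]
    by (rule gradient_bound[OF \<theta>h _ ab(1)]) (use \<theta>(2) h0 ha in simp_all)
  then have k: "\<kappa> \<le> (\<integral>x. (\<theta> x * h (\<phi> x)) * \<phi> x \<partial>\<mu>) / c"
    using p by (simp add: c field_simps)
  define D where "D x = \<theta> x * (g (\<phi> x) - \<phi> x * h (\<phi> x) / c)" for x
  have i1: "integrable \<mu> (\<lambda>x. \<theta> x * g (\<phi> x))" "integrable \<mu> (\<lambda>x. (\<theta> x * h (\<phi> x)) * \<phi> x)"
    using radon_integrable[OF \<mu>(1)] \<theta>g \<theta>hp by blast+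
  have Deq: "D x = \<theta> x * g (\<phi> x) - (\<theta> x * h (\<phi> x)) * \<phi> x / c" for x
    by (simp add: D_def right_diff_distrib)
  have Dint: "integrable \<mu> D" unfolding Deq[abs_def] using i1 by simp
  have "(\<integral>x. D x \<partial>\<mu>) = (\<integral>x. \<theta> x * g (\<phi> x) \<partial>\<mu>) - (\<integral>x. (\<theta> x * h (\<phi> x)) * \<phi> x \<partial>\<mu>) / c"
    unfolding Deq using i1 by simp
  with k LLu \<rho>(2)[OF uC2 ub] have Du: "(\<integral>x. D x \<partial>\<mu>) \<le> (\<integral>x. u x \<partial>\<rho>)" by simp
  have bB: "bounded (X \<inter> B s)" if "s \<le> r0" for s
    by (rule bounded_subset[OF r0]) (use that in \<open>auto simp: sublevel_def\<close>)
  have sB: "B s \<in> sets \<mu>" "B s \<in> sets \<rho>" for s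
    using open_B[of s] \<mu>(1) \<rho>(1) by (auto simp: radon_measure_def)
  have fin\<mu>: "emeasure \<mu> (B s) < \<infinity>" and fin\<rho>: "emeasure \<rho> (B s) < \<infinity>" if "s \<le> r0" for s
    using finite_sublevel[OF \<mu>(1,3) bB[OF that]] finite_sublevel[OF \<rho>(1,3) bB[OF that]] .
  have "a powr - c * measure \<mu> (B a') - b' powr - c * measure \<mu> (B b)
     = (\<integral>x. a powr - c * indicator (B a') x - b' powr - c * indicator (B b) x \<partial>\<mu>)"
    using fin\<mu>[of a'] fin\<mu>[of b] ab sB by simp
  also have "\<dots> \<le> (\<integral>x. D x \<partial>\<mu>)"
  proof (rule integral_mono_AE)
    show "integrable \<mu> (\<lambda>x. a powr - c * indicator (B a') x - b' powr - c * indicator (B b) x)"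
      using fin\<mu>[of a'] fin\<mu>[of b] ab sB by simp
    show "integrable \<mu> D" by (rule Dint)
    show "AE x in \<mu>. a powr - c * indicator (B a') x - b' powr - c * indicator (B b) x \<le> D x"
      using AE_X[OF \<mu>(1,3)]
    proof eventually_elim
      case (elim x)
      show ?case
      proof (cases "\<phi> x < r0")
        case True
        then show ?thesis using Dge[of "\<phi> x"] \<theta>1[OF elim True]
          by (simp add: D_def indicator_def sublevel_def split: if_splits)
      next
        case False
        then show ?thesis using ab gb[of "\<phi> x"] hb[of "\<phi> x"] by (simp add: D_def indicator_def sublevel_def)
      qed
    qed
  qed
  also note Du
  also have "(\<integral>x. u x \<partial>\<rho>) \<le> (LINT s:{0<..<b}|lborel. s powr - c * measure \<rho> (B s))"
  proof -
    let ?E = "LINT s:{0<..<b}|lborel. s powr - c * measure \<rho> (B s)"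
    have E0: "0 \<le> ?E" unfolding set_lebesgue_integral_def by (intro integral_nonneg_AE) simp
    have s\<rho>: "sets \<rho> = sets borel" using \<rho>(1) by (simp add: radon_measure_def)
    have uint: "integrable \<rho> u"
      by (rule radon_integrable[OF \<rho>(1)]) (use C_k_2D(3)[OF uC2] ub in \<open>simp add: Cc_def\<close>)
    have u0: "0 \<le> u x" for x using \<theta>(2) ch0 by (simp add: u_def)
    \<comment> \<open>Fubini's theorem asks for \<sigma>-finiteness, which an exhaustion by closed
      balls provides.\<close>
    have sfl: "sigma_finite_measure \<rho>"
    proof
      show "\<exists>A. countable A \<and> A \<subseteq> sets \<rho> \<and> \<Union>A = space \<rho> \<and> (\<forall>a\<in>A. emeasure \<rho> a \<noteq> \<infinity>)"
      proof (intro exI[of _ "range (\<lambda>n::nat. cball (0::real^'n::{finite,linorder}) (real n))"] conjI ballI)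
        show "\<Union> (range (\<lambda>n::nat. cball (0::real^'n::{finite,linorder}) (real n))) = space \<rho>"
          using sets_eq_imp_space_eq[OF s\<rho>] real_arch_simple by fastforce
        fix A assume "A \<in> range (\<lambda>n::nat. cball (0::real^'n::{finite,linorder}) (real n))"
        then have "compact A" by auto
        then show "emeasure \<rho> A \<noteq> \<infinity>" using \<rho>(1) by (auto simp: radon_measure_def)
      qed (auto simp: s\<rho>)
    qed
    interpret pair_sigma_finite lborel \<rho>
      by (intro pair_sigma_finite.intro lborel.sigma_finite_measure_axioms sfl)
    have phm[measurable]: "\<phi> \<in> borel_measurable \<rho>"
      using continuous_borel[OF phi_cont] by (simp add: measurable_cong_sets[OF s\<rho> refl])
    have gm[measurable]: "g \<in> borel_measurable borel" using gc by (rule borel_measurable_continuous_onI)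
    have FTC: "(\<integral>\<^sup>+s. ennreal (g s) * indicator {t<..<b} s \<partial>lborel) = ennreal (ch t)" if t: "t \<le> b" for t
    proof -
      have "(\<integral>\<^sup>+s. ennreal (g s) * indicator {t<..<b} s \<partial>lborel) = (\<integral>\<^sup>+s. ennreal (g s) * indicator {t..b} s \<partial>lborel)"
        using AE_lborel_singleton[of t] AE_lborel_singleton[of b]
        by (intro nn_integral_cong_AE, eventually_elim) (auto simp: indicator_def)
      also have "\<dots> = ennreal (- ch b - - ch t)"
        by (rule nn_integral_FTC_Icc[where F="\<lambda>s. - ch s", OF gm])
          (use g0 t DERIV_minus[OF chd] in simp_all)
      finally show ?thesis using chb[of b] by simp
    qed
    \<comment> \<open>Layer cake: ch (\<phi> x) is the integral of g s over \<phi> x < s < b, a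
      range inside {0<..<b} as \<phi> is nonnegative. Exchanging the integrals turns the condition
      \<phi> x < s into the sublevel set \<open>B s\<close>.\<close>
    have "(\<integral>\<^sup>+x. ennreal (u x) \<partial>\<rho>) \<le> (\<integral>\<^sup>+x. (\<integral>\<^sup>+s. ennreal (g s) * indicator {0<..<b} s * indicator {x. \<phi> x < s} x \<partial>lborel) \<partial>\<rho>)"
    proof (rule nn_integral_mono)
      fix x
      show "ennreal (u x) \<le> (\<integral>\<^sup>+s. ennreal (g s) * indicator {0<..<b} s * indicator {x. \<phi> x < s} x \<partial>lborel)"
      proof (cases "\<phi> x \<le> b")
        case True
        have "u x \<le> ch (\<phi> x)" using \<theta>(2,3)[of x] ch0[of "\<phi> x"] by (simp add: u_def mult_left_le_one_le)
        then have "ennreal (u x) \<le> ennreal (ch (\<phi> x))" by (rule ennreal_leI)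
        also have "\<dots> = (\<integral>\<^sup>+s. ennreal (g s) * indicator {\<phi> x<..<b} s \<partial>lborel)" by (simp add: FTC[OF True])
        also have "\<dots> \<le> (\<integral>\<^sup>+s. ennreal (g s) * indicator {0<..<b} s * indicator {x. \<phi> x < s} x \<partial>lborel)"
          using nn[of x] by (intro nn_integral_mono) (auto simp: indicator_def)
        finally show ?thesis .
      next
        case False then show ?thesis using chb[of "\<phi> x"] by (simp add: u_def)
      qed
    qed
    also have "\<dots> = (\<integral>\<^sup>+s. (\<integral>\<^sup>+x. ennreal (g s) * indicator {0<..<b} s * indicator {x. \<phi> x < s} x \<partial>\<rho>) \<partial>lborel)"
    proof (rule Fubini')
      have "(\<lambda>z. ennreal (g (fst z)) * indicator {0<..<b} (fst z) * indicator {z. \<phi> (snd z) < fst z} z) \<in> borel_measurable (lborel \<Otimes>\<^sub>M \<rho>)"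
        by measurable
      then show "(\<lambda>(s, x). ennreal (g s) * indicator {0<..<b} s * indicator {x. \<phi> x < s} x) \<in> borel_measurable (lborel \<Otimes>\<^sub>M \<rho>)"
        by (simp add: case_prod_beta indicator_def)
    qed
    also have "\<dots> \<le> (\<integral>\<^sup>+s. ennreal (indicator {0<..<b} s *\<^sub>R (s powr - c * measure \<rho> (B s))) \<partial>lborel)"
    proof (rule nn_integral_mono)
      fix s
      show "(\<integral>\<^sup>+x. ennreal (g s) * indicator {0<..<b} s * indicator {x. \<phi> x < s} x \<partial>\<rho>)
        \<le> ennreal (indicator {0<..<b} s *\<^sub>R (s powr - c * measure \<rho> (B s)))"
      proof (cases "s \<in> {0<..<b}")
        case True
        then have "s \<le> r0" using ab by simp
        have "(\<integral>\<^sup>+x. ennreal (g s) * indicator {0<..<b} s * indicator {x. \<phi> x < s} x \<partial>\<rho>) = ennreal (g s) * emeasure \<rho> (B s)"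
          using True sB(2)[of s] by (simp add: sublevel_def nn_integral_cmult_indicator)
        also have "\<dots> = ennreal (g s * measure \<rho> (B s))"
          using fin\<rho>[OF \<open>s \<le> r0\<close>] g0 by (simp add: emeasure_eq_ennreal_measure less_top[symmetric] ennreal_mult)
        also have "\<dots> \<le> ennreal (s powr - c * measure \<rho> (B s))"
          using gle[of s] True by (intro ennreal_leI mult_right_mono) auto
        finally show ?thesis using True by simp
      qed simp
    qed
    also have "\<dots> = ennreal ?E"
      unfolding set_lebesgue_integral_def
      by (rule nn_integral_eq_integral) (use int in \<open>auto simp: set_integrable_def\<close>)
    finally have "ennreal (\<integral>x. u x \<partial>\<rho>) \<le> ennreal ?E"
      using nn_integral_eq_integral[OF uint] u0 by simp
    then show ?thesis using E0 by (simp add: ennreal_le_iff)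
  qed
  finally show ?thesis .
qed

lemma lelong_number_exists:
  assumes se: "semi_exhaustive_on X \<phi>"
    and conc: "concave_current 1 (current_wedge_pow T (omega \<phi>) (p - 1))"
    and int: "\<exists>\<epsilon>>0. set_integrable lborel {0<..<\<epsilon>} (\<lambda>r. lelong_ratio_dd_sharp T p \<phi> r / (2 * sqrt r))"
  shows "\<exists>L. (lelong_ratio T p \<phi> \<longlongrightarrow> L) (at_right 0)"
proof -
  obtain r0 where r0: "0 < r0" "bounded (X \<inter> B r0)" using se by (auto simp: semi_exhaustive_on_def)
  obtain e where e: "0 < e" "set_integrable lborel {0<..<e} (\<lambda>r. lelong_ratio_dd_sharp T p \<phi> r / (2 * sqrt r))"
    using int by blast
  define r1 where "r1 = min r0 e"
  have r1: "0 < r1" "r1 \<le> r0" "r1 \<le> e" using r0 e by (auto simp: r1_def)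
  have bB: "bounded (X \<inter> B s)" if "s \<le> r0" for s
    by (rule bounded_subset[OF r0(2)]) (use that in \<open>auto simp: sublevel_def\<close>)
  obtain \<mu> where \<mu>: "radon_measure \<mu>" "\<And>F. Cc F \<Longrightarrow> (\<integral>x. F x \<partial>\<mu>) = LL (\<lambda>x. F x *\<^sub>R pw (hess \<phi> x) p)"
    "emeasure \<mu> (- X) = 0"
    "\<And>r. bounded (X \<inter> B r) \<Longrightarrow> current_integral (B r) (current_wedge_pow T (omega \<phi>) p) = measure \<mu> (B r)"
    by (rule lelong_measure) blast
  obtain \<rho> where \<rho>: "radon_measure \<rho>"
    "\<And>u. C_k 2 u \<Longrightarrow> bounded {x. u x \<noteq> 0} \<Longrightarrow> (\<integral>x. u x \<partial>\<rho>) = - LL (\<lambda>x. lmul (sym_hess u x) (P x))"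
    "emeasure \<rho> (- X) = 0"
    "\<And>r. bounded (X \<inter> B r) \<Longrightarrow>
       current_integral (B r) (dd_sharp (current_wedge_pow T (omega \<phi>) (p - 1))) = - measure \<rho> (B r)"
    by (rule dd_sharp_measure[OF conc]) blast
  define c where "c = real p / 2"
  define W where "W s = s powr - c * measure \<rho> (B s)" for s
  have ratio: "lelong_ratio T p \<phi> r = (1 / 2 ^ p) * (r powr - c * measure \<mu> (B r))" if "0 < r" "r < r0" for r
  proof -
    have "current_integral (B r) (current_wedge_pow T (omega \<phi>) p) = measure \<mu> (B r)"
      by (rule \<mu>(4)[OF bB]) (use that in simp)
    then show ?thesis by (simp add: lelong_ratio_def c_def powr_minus_divide)
  qed
  \<comment> \<open>The exponent (p - 1) / 2 of \<nu> and the 1 / 2 of sqrt r add up to c, and the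
    powers of 2 combine to 2 ^ p; hence the integrability hypothesis is that of W.\<close>
  have W: "lelong_ratio_dd_sharp T p \<phi> r / (2 * sqrt r) = (- (1 / 2 ^ p)) * W r" if "0 < r" "r < r0" for r
  proof -
    have "r powr (real (p - 1) / 2) * sqrt r = r powr c"
    proof -
      have "real (p - 1) / 2 + 1 / 2 = c" using p by (simp add: c_def of_nat_diff field_simps)
      then show ?thesis using that by (simp add: powr_half_sqrt[symmetric] powr_add[symmetric])
    qed
    moreover have "(2::real) ^ (p - 1) * 2 = 2 ^ p" using p by (simp add: power_eq_if mult.commute)
    moreover have "lelong_ratio_dd_sharp T p \<phi> r / (2 * sqrt r)
      = - (measure \<rho> (B r) / ((2 ^ (p - 1) * 2) * (r powr (real (p - 1) / 2) * sqrt r)))"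
    proof -
      have "current_integral (B r) (dd_sharp (current_wedge_pow T (omega \<phi>) (p - 1))) = - measure \<rho> (B r)"
        by (rule \<rho>(4)[OF bB]) (use that in simp)
      then show ?thesis by (simp only: lelong_ratio_dd_sharp_def) (simp add: mult_ac)
    qed
    ultimately show ?thesis by (simp only: W_def powr_minus_divide) simp
  qed
  have Wint: "set_integrable lborel {0<..<r1} W"
  proof -
    have "set_integrable lborel {0<..<r1} (\<lambda>r. lelong_ratio_dd_sharp T p \<phi> r / (2 * sqrt r))"
      by (rule set_integrable_subset[OF e(2)]) (use r1 in auto)
    then have "set_integrable lborel {0<..<r1} (\<lambda>r. - (2 ^ p) * (lelong_ratio_dd_sharp T p \<phi> r / (2 * sqrt r)))"
      by (rule set_integrable_mult_right)
    then show ?thesis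
      by (rule set_integrable_cong[THEN iffD1, rotated -1]) (use W r1 in auto)
  qed
  have W0: "0 \<le> W s" for s by (simp add: W_def)
  define E where "E b = (LINT s:{0<..<b}|lborel. W s)" for b
  have Wb: "set_integrable lborel {0<..<b} W" if "b \<le> r1" for b
    by (rule set_integrable_subset[OF Wint]) (use that in auto)
  have E0: "0 \<le> E b" for b unfolding E_def set_lebesgue_integral_def by (intro integral_nonneg_AE) (simp add: W0)
  define R where "R t = t powr - c * measure \<mu> (B t)" for t
  have "\<exists>L. (R \<longlongrightarrow> L) (at_right 0)"
  proof (rule limit_at_zero_exists[OF r1(1)])
    show "0 \<le> R t" for t by (simp add: R_def)
    show "0 \<le> E t" for t by (rule E0)
    show "(E \<longlongrightarrow> 0) (at_right 0)"
      unfolding E_def by (rule set_integral_tendsto_zero[OF r1(1) W0 Wint])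
    fix a b assume ab: "0 < a" "a < b" "b < r1"
    \<comment> \<open>\<open>key_inequality\<close> is applied with the inner radii a < a + s and
      the outer radii b - s < b. The bound on s keeps a + s < b - s, and afterwards s tends to
      0.\<close>
    have ineq: "(a + s) powr - c * measure \<mu> (B a) - (b - s) powr - c * measure \<mu> (B b) \<le> E b"
      if s: "0 < s" "s < (b - a) / 2" for s
      unfolding E_def W_def
      by (rule key_inequality[OF \<mu>(1,2,3) \<rho>(1,2,3) r0(2) ab(1)])
         (use s ab r1 c_def Wb[of b] W_def[abs_def] in auto)
    have "((\<lambda>s. (a + s) powr - c * measure \<mu> (B a) - (b - s) powr - c * measure \<mu> (B b))
        \<longlongrightarrow> (a + 0) powr - c * measure \<mu> (B a) - (b - 0) powr - c * measure \<mu> (B b)) (at_right 0)"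
      using ab by (intro tendsto_intros) auto
    moreover have "\<forall>\<^sub>F s in at_right 0. (a + s) powr - c * measure \<mu> (B a) - (b - s) powr - c * measure \<mu> (B b) \<le> E b"
      unfolding eventually_at_right[of 0 "(b - a) / 2", OF half_gt_zero[OF diff_gt_0_iff_gt[THEN iffD2, OF ab(2)]]]
      using ineq ab by (intro exI[of _ "(b - a) / 2"]) auto
    ultimately have "(a + 0) powr - c * measure \<mu> (B a) - (b - 0) powr - c * measure \<mu> (B b) \<le> E b"
      by (rule tendsto_upperbound) simp
    then show "R a \<le> R b + E b" by (simp add: R_def)
  qed
  then obtain L where L: "(R \<longlongrightarrow> L) (at_right 0)" by blast
  have "((\<lambda>r. (1 / 2 ^ p) * R r) \<longlongrightarrow> (1 / 2 ^ p) * L) (at_right 0)" by (intro tendsto_intros L)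
  then have "(lelong_ratio T p \<phi> \<longlongrightarrow> (1 / 2 ^ p) * L) (at_right 0)"
  proof (rule Lim_transform_eventually)
    show "\<forall>\<^sub>F r in at_right 0. (1 / 2 ^ p) * R r = lelong_ratio T p \<phi> r"
      unfolding eventually_at_right[of 0 r0, OF r0(1)] using ratio r0(1) by (auto simp: R_def)
  qed
  then show ?thesis ..
qed

end

theorem theorem3:
  fixes T :: "'n::{finite,linorder} current"
    and p :: nat
    and \<phi> :: "real^'n::{finite,linorder} \<Rightarrow> real"
  assumes "1 \<le> p" and "p \<le> CARD('n)"
    and "weakly_positive p T"
    and "C_k 2 \<phi>" and "\<And>x. 0 \<le> \<phi> x"
    and "convex_on UNIV (\<lambda>x. sqrt (\<phi> x))"
    and "semi_exhaustive_on (current_support T) \<phi>"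
    and "concave_current 1 (current_wedge_pow T (omega \<phi>) (p - 1))"
    and "\<exists>\<epsilon>>0. set_integrable lborel {0<..<\<epsilon>}
           (\<lambda>r. lelong_ratio_dd_sharp T p \<phi> r / (2 * sqrt r))"
  shows "\<exists>L::real. (lelong_ratio T p \<phi> \<longlongrightarrow> L) (at_right 0)"
proof -
  obtain LL where "order_zero_extension p T LL"
    using order_zero_extension_exists[OF assms(3)] by blast
  from lelong_number_exists[OF assms(1,3) this assms(4-9)] show ?thesis .
qed

end
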